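(* Let $X$ be a symmetric space on $[0,1]$ and let $w$ be a non-trivial weight on $[0,1]$ whose associated sequence $(w_k)_{k\ge1}$ (defined in the context) satisfies: there are $k_0\in\mathbb N$ and $c_0>0$ such that $w_k2^k\ge c_0$ for all $k\ge k_0$. Assume that either $X$ is $w$-decomposable, or $X$ has the Fatou property and $(X,X(w))$ is a $K$-monotone couple. If the fundamental function of $X$ is $\varphi_X(t)=t^{1/p}$ for some $1<p<\infty$, then $X=L_p[0,1]$ (up to equivalence of norms).
   Context: $m$ is Lebesgue measure; functions are identified if they agree a.e., and supports and infima/suprema of $w$ over sets are understood up to null sets. A symmetric space on $[0,1]$ is a Banach space $X\neq\{0\}$ of (classes of) measurable real functions on $[0,1]$ such that (i) $|x|\le|y|$ a.e. with $y\in X$, $x$ measurable, implies $x\in X$, $\|x\|_X\le\|y\|_X$; (ii) if $x\in X$ and $y$ is measurable with $m\{|y|>\lambda\}=m\{|x|>\lambda\}$ for all $\lambda\ge0$, then $y\in X$ and $\|y\|_X=\|x\|_X$. Fatou property: $0\le x_n\uparrow x$ measurable, $x_n\in X$, $\sup_n\|x_n\|_X<\infty$ imply $x\in X$ and $\|x_n\|_X\uparrow\|x\|_X$. Fundamental function: $\varphi_X(t)=\|\chi_{[0,t]}\|_X$, $t\in[0,1]$. A weight on $[0,1]$ is a measurable function positive and finite a.e.; it is non-trivial if $w$ or $1/w$ is unbounded. For the weight $w$ put $M_k=\{t\in[0,1]: w(t)\in[2^k,2^{k+1})\}$, $k\in\mathbb Z$; $(w_k)_{k=1}^\infty$ is the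 non-increasing rearrangement of $(m(M_k))_{k\in\mathbb Z}$. $X(w)=\{x: xw\in X\}$ with $\|x\|_{X(w)}=\|xw\|_X$. $X$ is $w$-decomposable if there is $C>0$ such that for every $n\in\mathbb N$ and all nonzero $x_1,\dots,x_n,y_1,\dots,y_n\in X$ with $\|x_i\|_X=\|y_i\|_X$ ($1\le i\le n$) and $\inf w(\operatorname{supp}x_i\cup\operatorname{supp}y_i)\ge 2\sup w(\operatorname{supp}x_{i+1}\cup\operatorname{supp}y_{i+1})$ ($1\le i\le n-1$), one has $C^{-1}\|\sum_{i=1}^n x_i\|_X\le\|\sum_{i=1}^n y_i\|_X\le C\|\sum_{i=1}^n x_i\|_X$. For a Banach couple $(X_0,X_1)$, $K(t,x;X_0,X_1)=\inf\{\|x_0\|_{X_0}+t\|x_1\|_{X_1}: x=x_0+x_1,\ x_i\in X_i\}$. A Banach space $E$ with $X_0\cap X_1\subset E\subset X_0+X_1$ (continuous embeddings) is an interpolation space if every linear operator on $X_0+X_1$ that maps $X_i$ boundedly into $X_i$ for $i=0,1$ maps $E$ boundedly into $E$. $E$ is a $K$-monotone space if there is $C\ge1$ such that whenever $x\in E$, $y\in X_0+X_1$ and $K(t,y;X_0,X_1)\le K(t,x;X_0,X_1)$ for all $t>0$, then $y\in E$ and $\|y\|_E\le C\|x\|_E$. The couple is $K$-monotone if all its interpolation spaces are $K$-monotone spaces. *)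

theory Defs
  imports "HOL-Analysis.Analysis" "HOL-Probability.Essential_Supremum"
begin

abbreviation leb01 :: "real measure" where
  "leb01 \<equiv> lebesgue_on {0..1}"

text \<open>
  A space of classes of measurable functions on \<open>[0,1]\<close> is represented by the set of all
  representatives of its elements, together with a norm on representatives. Hence carriers are
  saturated under equality almost everywhere, norms are definite only up to null sets, and the
  values of a function outside \<open>[0,1]\<close> are irrelevant.
\<close>

record fun_space =
  carr :: "(real \<Rightarrow> real) set"
  nrm :: "(real \<Rightarrow> real) \<Rightarrow> real"

definition ae_eq :: "(real \<Rightarrow> real) \<Rightarrow> (real \<Rightarrow> real) \<Rightarrow> bool" where
  "ae_eq x y \<longleftrightarrow> (AE t in leb01. x t = y t)"

definition banach_fun_space :: "fun_space \<Rightarrow> bool" where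
  "banach_fun_space X \<longleftrightarrow>
     carr X \<subseteq> borel_measurable leb01 \<and>
     (\<forall>x\<in>carr X. \<forall>y\<in>borel_measurable leb01. ae_eq x y \<longrightarrow> y \<in> carr X) \<and>
     (\<lambda>t. 0) \<in> carr X \<and>
     (\<forall>x\<in>carr X. \<forall>y\<in>carr X. (\<lambda>t. x t + y t) \<in> carr X) \<and>
     (\<forall>a. \<forall>x\<in>carr X. (\<lambda>t. a * x t) \<in> carr X) \<and>
     (\<forall>x\<in>carr X. 0 \<le> nrm X x) \<and>
     (\<forall>x\<in>carr X. nrm X x = 0 \<longleftrightarrow> ae_eq x (\<lambda>t. 0)) \<and>
     (\<forall>x\<in>carr X. \<forall>y\<in>carr X. nrm X (\<lambda>t. x t + y t) \<le> nrm X x + nrm X y) \<and>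
     (\<forall>a. \<forall>x\<in>carr X. nrm X (\<lambda>t. a * x t) = \<bar>a\<bar> * nrm X x) \<and>
     (\<forall>u::nat \<Rightarrow> real \<Rightarrow> real.
        (\<forall>n. u n \<in> carr X) \<and>
        (\<forall>e>0. \<exists>N. \<forall>m\<ge>N. \<forall>n\<ge>N. nrm X (\<lambda>t. u m t - u n t) < e) \<longrightarrow>
        (\<exists>x\<in>carr X. (\<lambda>n. nrm X (\<lambda>t. u n t - x t)) \<longlonglongrightarrow> 0))"

definition symmetric_space :: "fun_space \<Rightarrow> bool" where
  "symmetric_space X \<longleftrightarrow>
     banach_fun_space X \<and>
     (\<exists>x\<in>carr X. \<not> ae_eq x (\<lambda>t. 0)) \<and>
     (\<forall>x\<in>borel_measurable leb01. \<forall>y\<in>carr X.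
        (AE t in leb01. \<bar>x t\<bar> \<le> \<bar>y t\<bar>) \<longrightarrow> x \<in> carr X \<and> nrm X x \<le> nrm X y) \<and>
     (\<forall>x\<in>carr X. \<forall>y\<in>borel_measurable leb01.
        (\<forall>l\<ge>0. measure leb01 {t\<in>{0..1}. \<bar>y t\<bar> > l} = measure leb01 {t\<in>{0..1}. \<bar>x t\<bar> > l}) \<longrightarrow>
        y \<in> carr X \<and> nrm X y = nrm X x)"

definition fatou_property :: "fun_space \<Rightarrow> bool" where
  "fatou_property X \<longleftrightarrow>
     (\<forall>(u::nat \<Rightarrow> real \<Rightarrow> real) x.
        (\<forall>n. u n \<in> carr X) \<and> x \<in> borel_measurable leb01 \<and>
        (AE t in leb01. 0 \<le> u 0 t \<and> incseq (\<lambda>n. u n t) \<and> (\<lambda>n. u n t) \<longlonglongrightarrow> x t) \<and>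
        bdd_above (range (\<lambda>n. nrm X (u n))) \<longrightarrow>
        x \<in> carr X \<and> incseq (\<lambda>n. nrm X (u n)) \<and> (\<lambda>n. nrm X (u n)) \<longlonglongrightarrow> nrm X x)"

definition fundamental_function :: "fun_space \<Rightarrow> real \<Rightarrow> real" where
  "fundamental_function X t = nrm X (indicator {0..t})"

definition weight :: "(real \<Rightarrow> real) \<Rightarrow> bool" where
  "weight w \<longleftrightarrow> w \<in> borel_measurable leb01 \<and> (AE t in leb01. 0 < w t)"

definition nontrivial_weight :: "(real \<Rightarrow> real) \<Rightarrow> bool" where
  "nontrivial_weight w \<longleftrightarrow>
     weight w \<and> (\<not> (\<exists>C. AE t in leb01. w t \<le> C) \<or> \<not> (\<exists>C. AE t in leb01. 1 / w t \<le> C))"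

definition level_set :: "(real \<Rightarrow> real) \<Rightarrow> int \<Rightarrow> real set" where
  "level_set w k = {t\<in>{0..1}. w t \<in> {2 powi k ..< 2 powi (k + 1)}}"

text \<open>
  The \<open>k\<close>-th term, \<open>k \<ge> 1\<close>, of the non-increasing rearrangement of a bounded non-negative family:
  the least \<open>s \<ge> 0\<close> exceeded by fewer than \<open>k\<close> members.
\<close>

definition decreasing_rearrangement :: "(int \<Rightarrow> real) \<Rightarrow> nat \<Rightarrow> real" where
  "decreasing_rearrangement a k = Inf {s. 0 \<le> s \<and> finite {j. s < a j} \<and> card {j. s < a j} < k}"

definition weight_seq :: "(real \<Rightarrow> real) \<Rightarrow> nat \<Rightarrow> real" where
  "weight_seq w = decreasing_rearrangement (\<lambda>j. measure leb01 (level_set w j))"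

definition weighted_space :: "fun_space \<Rightarrow> (real \<Rightarrow> real) \<Rightarrow> fun_space" where
  "weighted_space X w =
     \<lparr>carr = {x\<in>borel_measurable leb01. (\<lambda>t. x t * w t) \<in> carr X},
      nrm = (\<lambda>x. nrm X (\<lambda>t. x t * w t))\<rparr>"

definition fsupp :: "(real \<Rightarrow> real) \<Rightarrow> real set" where
  "fsupp x = {t\<in>{0..1}. x t \<noteq> 0}"

definition ess_sup_on :: "real set \<Rightarrow> (real \<Rightarrow> real) \<Rightarrow> ereal" where
  "ess_sup_on A w = esssup (lebesgue_on A) (\<lambda>t. ereal (w t))"

definition ess_inf_on :: "real set \<Rightarrow> (real \<Rightarrow> real) \<Rightarrow> ereal" where
  "ess_inf_on A w = - esssup (lebesgue_on A) (\<lambda>t. - ereal (w t))"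

definition decomposable :: "(real \<Rightarrow> real) \<Rightarrow> fun_space \<Rightarrow> bool" where
  "decomposable w X \<longleftrightarrow>
     (\<exists>C>0. \<forall>n\<ge>1. \<forall>x y :: nat \<Rightarrow> real \<Rightarrow> real.
        (\<forall>i\<in>{1..n}. x i \<in> carr X \<and> y i \<in> carr X \<and>
           \<not> ae_eq (x i) (\<lambda>t. 0) \<and> \<not> ae_eq (y i) (\<lambda>t. 0) \<and> nrm X (x i) = nrm X (y i)) \<and>
        (\<forall>i\<in>{1..<n}. ess_inf_on (fsupp (x i) \<union> fsupp (y i)) w
           \<ge> 2 * ess_sup_on (fsupp (x (i + 1)) \<union> fsupp (y (i + 1))) w) \<longrightarrow>
        inverse C * nrm X (\<lambda>t. \<Sum>i=1..n. x i t) \<le> nrm X (\<lambda>t. \<Sum>i=1..n. y i t) \<and>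
        nrm X (\<lambda>t. \<Sum>i=1..n. y i t) \<le> C * nrm X (\<lambda>t. \<Sum>i=1..n. x i t))"

definition sum_carr :: "fun_space \<Rightarrow> fun_space \<Rightarrow> (real \<Rightarrow> real) set" where
  "sum_carr X0 X1 =
     {x\<in>borel_measurable leb01. \<exists>x0\<in>carr X0. \<exists>x1\<in>carr X1. ae_eq x (\<lambda>t. x0 t + x1 t)}"

definition K_functional :: "real \<Rightarrow> (real \<Rightarrow> real) \<Rightarrow> fun_space \<Rightarrow> fun_space \<Rightarrow> real" where
  "K_functional s x X0 X1 =
     Inf {nrm X0 x0 + s * nrm X1 x1 | x0 x1.
            x0 \<in> carr X0 \<and> x1 \<in> carr X1 \<and> ae_eq x (\<lambda>t. x0 t + x1 t)}"

text \<open>The intersection and the sum carry their usual norms, the latter being the K-functional at 1.\<close>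

definition intermediate_space :: "fun_space \<Rightarrow> fun_space \<Rightarrow> fun_space \<Rightarrow> bool" where
  "intermediate_space X0 X1 E \<longleftrightarrow>
     banach_fun_space E \<and>
     carr X0 \<inter> carr X1 \<subseteq> carr E \<and> carr E \<subseteq> sum_carr X0 X1 \<and>
     (\<exists>C. \<forall>x\<in>carr X0 \<inter> carr X1. nrm E x \<le> C * max (nrm X0 x) (nrm X1 x)) \<and>
     (\<exists>C. \<forall>x\<in>carr E. K_functional 1 x X0 X1 \<le> C * nrm E x)"

definition linear_operator_on ::
  "(real \<Rightarrow> real) set \<Rightarrow> ((real \<Rightarrow> real) \<Rightarrow> real \<Rightarrow> real) \<Rightarrow> bool" where
  "linear_operator_on V T \<longleftrightarrow>
     (\<forall>x\<in>V. T x \<in> V) \<and>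
     (\<forall>x\<in>V. \<forall>y\<in>V. ae_eq x y \<longrightarrow> ae_eq (T x) (T y)) \<and>
     (\<forall>x\<in>V. \<forall>y\<in>V. ae_eq (T (\<lambda>t. x t + y t)) (\<lambda>t. T x t + T y t)) \<and>
     (\<forall>a. \<forall>x\<in>V. ae_eq (T (\<lambda>t. a * x t)) (\<lambda>t. a * T x t))"

definition maps_boundedly :: "((real \<Rightarrow> real) \<Rightarrow> real \<Rightarrow> real) \<Rightarrow> fun_space \<Rightarrow> bool" where
  "maps_boundedly T X \<longleftrightarrow>
     (\<forall>x\<in>carr X. T x \<in> carr X) \<and> (\<exists>C. \<forall>x\<in>carr X. nrm X (T x) \<le> C * nrm X x)"

definition interpolation_space :: "fun_space \<Rightarrow> fun_space \<Rightarrow> fun_space \<Rightarrow> bool" where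
  "interpolation_space X0 X1 E \<longleftrightarrow>
     intermediate_space X0 X1 E \<and>
     (\<forall>T. linear_operator_on (sum_carr X0 X1) T \<and> maps_boundedly T X0 \<and> maps_boundedly T X1
        \<longrightarrow> maps_boundedly T E)"

definition K_monotone_space :: "fun_space \<Rightarrow> fun_space \<Rightarrow> fun_space \<Rightarrow> bool" where
  "K_monotone_space X0 X1 E \<longleftrightarrow>
     (\<exists>C\<ge>1. \<forall>x\<in>carr E. \<forall>y\<in>sum_carr X0 X1.
        (\<forall>s>0. K_functional s y X0 X1 \<le> K_functional s x X0 X1) \<longrightarrow>
        y \<in> carr E \<and> nrm E y \<le> C * nrm E x)"

definition K_monotone_couple :: "fun_space \<Rightarrow> fun_space \<Rightarrow> bool" where
  "K_monotone_couple X0 X1 \<longleftrightarrow>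
     (\<forall>E. interpolation_space X0 X1 E \<longrightarrow> K_monotone_space X0 X1 E)"

definition Lp_space :: "real \<Rightarrow> fun_space" where
  "Lp_space p =
     \<lparr>carr = {x\<in>borel_measurable leb01. integrable leb01 (\<lambda>t. \<bar>x t\<bar> powr p)},
      nrm = (\<lambda>x. (integral\<^sup>L leb01 (\<lambda>t. \<bar>x t\<bar> powr p)) powr (1 / p))\<rparr>"

definition equal_up_to_equivalent_norms :: "fun_space \<Rightarrow> fun_space \<Rightarrow> bool" where
  "equal_up_to_equivalent_norms X Y \<longleftrightarrow>
     carr X = carr Y \<and>
     (\<exists>C>0. \<forall>x\<in>carr X. nrm X x \<le> C * nrm Y x \<and> nrm Y x \<le> C * nrm X x)"

end

theory Submission
  imports Defs "HOL-Probability.Probability_Measure"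
begin

text \<open>
  Both alternatives of the hypothesis give \<^emph>\<open>level decomposability\<close>: if \<open>x\<close> and \<open>y\<close> live on finitely
  many level sets \<open>M\<^sub>k = {2^k \<le> w < 2^(k+1)}\<close> and have the same norm on each of them, then their norms are
  comparable. For a decomposable space this is a splitting into even and odd levels.

  For a \<open>K\<close>-monotone couple suppose it fails. It then fails on finite sets \<open>F\<^sub>n\<close> of levels that are
  arbitrarily sparse and far apart, say for \<open>x\<^sub>n\<close> and \<open>y\<^sub>n\<close>. Rescale \<open>x\<^sub>n\<close> and \<open>y\<^sub>n\<close> on \<open>M\<^sub>k\<close> to norm
  \<open>2^(-k/2)\<close>; the \<open>K\<close>-functionals become comparable, being geometric sums. In the largest interpolation
  space on which the inverse rescalings into \<open>X\<close> are bounded (up to factors \<open>\<epsilon>\<^sub>n\<close>) the rescaled \<open>x\<^sub>n\<close> are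
  bounded: the off-diagonal part of an operator of the couple decays exponentially in the distance of
  levels, and its diagonal part is bounded on \<open>X\<close> by averaging over signs. The rescaled \<open>y\<^sub>n\<close> are unbounded.

  Finally let \<open>\<phi>(t) = t^(1/p)\<close>. By level decomposability a function \<open>\<Sum> a\<^sub>k \<chi>(B\<^sub>k)\<close> with \<open>B\<^sub>k \<subseteq> M\<^sub>k\<close> has norm
  comparable to that of a multiple of one indicator, hence to \<open>(\<Sum> a\<^sub>k^p m(B\<^sub>k))^(1/p)\<close>. If \<open>x\<close> has norm at most 1
  in \<open>X\<close> or in \<open>L\<^sub>p\<close>, the set \<open>{2^j \<le> |x| < 2^(j+1)}\<close> has measure at most \<open>2^(-jp)\<close>, and since \<open>p > 1\<close> and
  \<open>w\<^sub>j \<ge> c 2^(-j)\<close> these sets fit into distinct levels for large \<open>j\<close>. So the two norms are equivalent.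
\<close>

section \<open>Symmetric spaces\<close>

text \<open>The exponent -1/2 lies halfway between X, where a block on level k keeps its norm, and
  X(w), where it gains a factor of about 2^k. Blocks of norm 2^(-k/2) therefore form series that
  decay geometrically upwards in X and downwards in X(w), so up to constants the K-functional is
  attained on a single level and depends only on which levels are occupied. The obstacle is that,
  once the rescaling is undone, the off-diagonal part of an operator is controlled only through the
  quantity \<Lambda> n that is to be bounded, the largest norm of a function dominated by the n-th
  one on every level: it is at most 2 \<delta> n \<Lambda> n, where \<delta> n is a geometric tail
  beyond the gap n. The factor \<epsilon> n = 1 / (1 + 2 \<delta> n \<Lambda> n) compensates for
  this. K-monotonicity then yields \<epsilon> n \<Lambda> n \<le> R, that is, \<Lambda> n \<le> R +
  2 R \<delta> n \<Lambda> n, and the last term can be absorbed because \<delta> n tends to 0. Hence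
  the need for growing gaps, both inside the sets of levels and between them.\<close>

lemma sets_leb01_Collect:
  assumes "Measurable.pred leb01 P"
  shows "{t\<in>{0..1}. P t} \<in> sets leb01"
proof -
  have "{t\<in>space leb01. P t} \<in> sets leb01"
    using assms by measurable
  then show ?thesis by simp
qed

interpretation leb01: prob_space leb01
  by (rule prob_spaceI) (simp add: emeasure_restrict_space)

lemma AE_leb01_mem: "AE t in leb01. t \<in> {0..1}"
  by (rule AE_I2) simp

lemma level_set_sets [measurable]:
  assumes "w \<in> borel_measurable leb01"
  shows "level_set w k \<in> sets leb01"
  unfolding level_set_def using assms by (intro sets_leb01_Collect) measurable

lemma measure_indicator_level:
  fixes A :: "real set"
  assumes "A \<subseteq> {0..1}" "0 \<le> l"
  shows "measure leb01 {t\<in>{0..1}. \<bar>indicator A t :: real\<bar> > l} = (if l < 1 then measure leb01 A else 0)"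
proof (cases "l < 1")
  case True
  then have "{t\<in>{0..1}. \<bar>indicator A t :: real\<bar> > l} = A"
    using assms by (auto simp: indicator_def)
  then show ?thesis using True by simp
next
  case False
  then have "{t\<in>{0..1}. \<bar>indicator A t :: real\<bar> > l} = {}"
    using assms by (auto simp: indicator_def)
  then show ?thesis unfolding \<open>{t\<in>{0..1}. \<bar>indicator A t :: real\<bar> > l} = {}\<close> using False by simp
qed

text \<open>Lebesgue measure has no atoms: the measure of the part of \<open>A\<close> in
  \<open>{0..r}\<close> is a 1-Lipschitz function of \<open>r\<close>, and the intermediate value
  theorem applies.\<close>

lemma exists_subset_measure_eq:
  assumes A: "A \<in> sets leb01" and s: "0 \<le> s" "s \<le> measure leb01 A"
  shows "\<exists>B\<in>sets leb01. B \<subseteq> A \<and> measure leb01 B = s"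
proof -
  define f where "f r = measure leb01 (A \<inter> {0..r})" for r :: real
  have I: "{a..b} \<inter> {0..1} \<in> sets leb01" for a b :: real
    by (subst sets_restrict_space_iff) auto
  have sub: "A \<subseteq> {0..1}" using sets.sets_into_space[OF A] by simp
  have AI: "A \<inter> {a..b} \<in> sets leb01" for a b :: real
  proof -
    have "A \<inter> {a..b} = A \<inter> ({a..b} \<inter> {0..1})" using sub by auto
    then show ?thesis using A I by (metis sets.Int)
  qed
  have lip: "\<bar>f b - f a\<bar> \<le> b - a" if ab: "a \<le> b" "0 \<le> a" "b \<le> 1" for a b
  proof -
    have J: "{a..b} \<in> sets leb01" using I[of a b] ab by (simp add: Int_absorb2)
    have "f b \<le> measure leb01 ((A \<inter> {0..a}) \<union> {a..b})"
      unfolding f_def by (rule leb01.finite_measure_mono) (use AI J in auto)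
    also have "\<dots> \<le> f a + measure leb01 {a..b}"
      unfolding f_def by (rule measure_Un_le) (use AI J in auto)
    also have "measure leb01 {a..b} = b - a"
      using ab by (subst measure_restrict_space) auto
    finally have "f b \<le> f a + (b - a)" .
    moreover have "f a \<le> f b"
      unfolding f_def by (rule leb01.finite_measure_mono) (use AI ab in auto)
    ultimately show ?thesis by linarith
  qed
  have cont: "continuous_on {0..1} f"
  proof (rule continuous_onI)
    fix x e :: real assume x: "x \<in> {0..1}" "0 < e"
    show "\<exists>d>0. \<forall>x'\<in>{0..1}. dist x' x < d \<longrightarrow> dist (f x') (f x) \<le> e"
    proof (intro exI[of _ e] conjI ballI impI)
      fix x' :: real assume x': "x' \<in> {0..1}" "dist x' x < e"
      show "dist (f x') (f x) \<le> e"
        using lip[of x x'] lip[of x' x] x x' by (cases "x \<le> x'") (auto simp: dist_real_def)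
    qed (use x in auto)
  qed
  have "f 0 = 0"
  proof -
    have "f 0 \<le> measure leb01 {0::real}"
      unfolding f_def using I[of 0 0] by (intro leb01.finite_measure_mono) (auto simp: Int_absorb2)
    also have "\<dots> = 0" by (subst measure_restrict_space) auto
    finally show ?thesis unfolding f_def by (simp add: measure_le_0_iff)
  qed
  moreover have "f 1 = measure leb01 A" using sub by (simp add: f_def Int_absorb2)
  ultimately obtain r where "0 \<le> r" "r \<le> 1" "f r = s"
    using IVT'[of f 0 s 1] s cont by auto
  then show ?thesis using AI[of 0 r] unfolding f_def by auto
qed

section \<open>Calculus in a symmetric space\<close>

locale symmetric_fun_space =
  fixes X :: fun_space
  assumes symm: "symmetric_space X"
begin

lemma banach: "banach_fun_space X"
  using symm by (simp add: symmetric_space_def)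

lemma carr_measurable: "x \<in> carr X \<Longrightarrow> x \<in> borel_measurable leb01"
  using banach by (auto simp: banach_fun_space_def)

lemma carr_zero: "(\<lambda>t. 0) \<in> carr X"
  using banach by (simp add: banach_fun_space_def)

lemma carr_add: "x \<in> carr X \<Longrightarrow> y \<in> carr X \<Longrightarrow> (\<lambda>t. x t + y t) \<in> carr X"
  using banach by (simp add: banach_fun_space_def)

lemma carr_scale: "x \<in> carr X \<Longrightarrow> (\<lambda>t. a * x t) \<in> carr X"
  using banach by (simp add: banach_fun_space_def)

lemma nrm_nonneg: "x \<in> carr X \<Longrightarrow> 0 \<le> nrm X x"
  using banach by (simp add: banach_fun_space_def)

lemma nrm_eq_0_iff: "x \<in> carr X \<Longrightarrow> nrm X x = 0 \<longleftrightarrow> (AE t in leb01. x t = 0)"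
  using banach by (simp add: banach_fun_space_def ae_eq_def)

lemma nrm_add: "x \<in> carr X \<Longrightarrow> y \<in> carr X \<Longrightarrow> nrm X (\<lambda>t. x t + y t) \<le> nrm X x + nrm X y"
  using banach by (simp add: banach_fun_space_def)

lemma nrm_scale: "x \<in> carr X \<Longrightarrow> nrm X (\<lambda>t. a * x t) = \<bar>a\<bar> * nrm X x"
  using banach by (simp add: banach_fun_space_def)

lemma nrm_zero: "nrm X (\<lambda>t. 0) = 0"
  using nrm_eq_0_iff[OF carr_zero] by simp

lemma complete:
  assumes "\<And>n. u n \<in> carr X"
    "\<And>e. 0 < e \<Longrightarrow> \<exists>N. \<forall>m\<ge>N. \<forall>n\<ge>N. nrm X (\<lambda>t. u m t - u n t) < e"
  shows "\<exists>x\<in>carr X. (\<lambda>n. nrm X (\<lambda>t. u n t - x t)) \<longlonglongrightarrow> 0"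
  using banach assms unfolding banach_fun_space_def by blast

lemma dominated:
  assumes "x \<in> borel_measurable leb01" "y \<in> carr X" "AE t in leb01. \<bar>x t\<bar> \<le> \<bar>y t\<bar>"
  shows carr_dominated: "x \<in> carr X" and nrm_dominated: "nrm X x \<le> nrm X y"
  using symm assms unfolding symmetric_space_def by blast+

lemma equimeasurable:
  assumes "x \<in> carr X" "y \<in> borel_measurable leb01"
    "\<And>l. 0 \<le> l \<Longrightarrow> measure leb01 {t\<in>{0..1}. \<bar>y t\<bar> > l} = measure leb01 {t\<in>{0..1}. \<bar>x t\<bar> > l}"
  shows carr_equimeasurable: "y \<in> carr X" and nrm_equimeasurable: "nrm X y = nrm X x"
  using symm assms unfolding symmetric_space_def by blast+

lemma AE_eq_cong:
  assumes "x \<in> carr X" "y \<in> borel_measurable leb01" "AE t in leb01. y t = x t"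
  shows carr_AE_cong: "y \<in> carr X" and nrm_AE_cong: "nrm X y = nrm X x"
proof -
  have 1: "AE t in leb01. \<bar>y t\<bar> \<le> \<bar>x t\<bar>" "AE t in leb01. \<bar>x t\<bar> \<le> \<bar>y t\<bar>"
    using assms(3) by auto
  show y: "y \<in> carr X" using carr_dominated[OF assms(2,1) 1(1)] .
  show "nrm X y = nrm X x"
    using nrm_dominated[OF assms(2,1) 1(1)] nrm_dominated[OF carr_measurable[OF assms(1)] y 1(2)]
    by simp
qed

lemma carr_diff: "x \<in> carr X \<Longrightarrow> y \<in> carr X \<Longrightarrow> (\<lambda>t. x t - y t) \<in> carr X"
  using carr_add[of x "\<lambda>t. -1 * y t"] carr_scale[of y "-1"] by simp

lemma nrm_diff: "x \<in> carr X \<Longrightarrow> y \<in> carr X \<Longrightarrow> nrm X (\<lambda>t. x t - y t) \<le> nrm X x + nrm X y"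
  using nrm_add[of x "\<lambda>t. -1 * y t"] carr_scale[of y "-1"] nrm_scale[of y "-1"] by simp

lemma nrm_minus_commute: "x \<in> carr X \<Longrightarrow> y \<in> carr X \<Longrightarrow> nrm X (\<lambda>t. x t - y t) = nrm X (\<lambda>t. y t - x t)"
  using nrm_scale[OF carr_diff[of x y], of "-1"] by (simp add: algebra_simps)

lemma carr_sum: "(\<And>i. i \<in> I \<Longrightarrow> x i \<in> carr X) \<Longrightarrow> (\<lambda>t. \<Sum>i\<in>I. x i t) \<in> carr X"
  by (induction I rule: infinite_finite_induct) (auto simp: carr_zero intro: carr_add)

lemma nrm_sum:
  "(\<And>i. i \<in> I \<Longrightarrow> x i \<in> carr X) \<Longrightarrow> nrm X (\<lambda>t. \<Sum>i\<in>I. x i t) \<le> (\<Sum>i\<in>I. nrm X (x i))"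
proof (induction I rule: infinite_finite_induct)
  case (insert i I)
  have "nrm X (\<lambda>t. x i t + (\<Sum>i\<in>I. x i t)) \<le> nrm X (x i) + nrm X (\<lambda>t. \<Sum>i\<in>I. x i t)"
    by (intro nrm_add carr_sum) (use insert in auto)
  then show ?case using insert by (auto intro: order_trans)
qed (auto simp: nrm_zero)

lemma bounded_mult:
  assumes "x \<in> carr X" "g \<in> borel_measurable leb01" "AE t in leb01. \<bar>g t\<bar> \<le> c"
  shows carr_bounded_mult: "(\<lambda>t. g t * x t) \<in> carr X"
    and nrm_bounded_mult: "nrm X (\<lambda>t. g t * x t) \<le> c * nrm X x"
proof -
  note [measurable] = assms(2) carr_measurable[OF assms(1)]
  have g: "AE t in leb01. 0 \<le> c \<and> \<bar>g t * x t\<bar> \<le> \<bar>c * x t\<bar>"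
    using assms(3) by eventually_elim (auto simp: abs_mult intro: mult_right_mono)
  then have "0 \<le> c" using leb01.AE_const by fastforce
  show "(\<lambda>t. g t * x t) \<in> carr X"
    by (rule carr_dominated[OF _ carr_scale[OF assms(1)]]) (use g in auto)
  have "nrm X (\<lambda>t. g t * x t) \<le> nrm X (\<lambda>t. c * x t)"
    by (rule nrm_dominated[OF _ carr_scale[OF assms(1)]]) (use g in auto)
  then show "nrm X (\<lambda>t. g t * x t) \<le> c * nrm X x"
    using nrm_scale[OF assms(1), of c] \<open>0 \<le> c\<close> by simp
qed

lemma carr_indicator_mult: "x \<in> carr X \<Longrightarrow> A \<in> sets leb01 \<Longrightarrow> (\<lambda>t. indicator A t * x t) \<in> carr X"
  by (rule carr_bounded_mult[where c=1]) (auto simp: indicator_def)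

lemma nrm_indicator_mult: "x \<in> carr X \<Longrightarrow> A \<in> sets leb01 \<Longrightarrow> nrm X (\<lambda>t. indicator A t * x t) \<le> nrm X x"
  using nrm_bounded_mult[of x "indicator A" 1] by (auto simp: indicator_def)

text \<open>Completeness replaces the Fatou property: the limit of the truncations is identified on each
  \<open>A n\<close> separately.\<close>

lemma truncations_Cauchy:
  assumes z: "z \<in> borel_measurable leb01"
    and A: "\<And>n. A n \<in> sets leb01" "incseq A" "AE t in leb01. \<exists>n. t \<in> A n"
    and zA: "\<And>n. (\<lambda>t. indicator (A n) t * z t) \<in> carr X"
    and Cau: "\<And>e. 0 < e \<Longrightarrow> \<exists>N. \<forall>m\<ge>N. \<forall>n\<ge>N.
       nrm X (\<lambda>t. indicator (A m) t * z t - indicator (A n) t * z t) < e"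
    and B: "\<And>n. nrm X (\<lambda>t. indicator (A n) t * z t) \<le> B"
  shows "z \<in> carr X" "nrm X z \<le> B"
proof -
  define u where "u n t = indicator (A n) t * z t" for n t
  have u: "u n \<in> carr X" for n using zA by (simp add: u_def[abs_def])
  obtain g where g: "g \<in> carr X" and lim: "(\<lambda>n. nrm X (\<lambda>t. u n t - g t)) \<longlonglongrightarrow> 0"
    using complete[of u] u Cau unfolding u_def by blast
  note [measurable] = z carr_measurable[OF g] A(1)
  have "AE t in leb01. t \<in> A n \<longrightarrow> z t = g t" for n
  proof -
    \<comment> \<open>On \<open>A n\<close> every later truncation already equals \<open>z\<close>,
      so this function is bounded by \<open>u m - g\<close> for all \<open>m \<ge> n\<close>; its
      norm is therefore 0.\<close>
    define d where "d t = indicator (A n) t * (z t - g t)" for t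
    have dm: "d \<in> borel_measurable leb01" unfolding d_def[abs_def] by measurable
    have le: "AE t in leb01. \<bar>d t\<bar> \<le> \<bar>u m t - g t\<bar>" if "n \<le> m" for m
      using incseqD[OF A(2) that] by (intro AE_I2) (auto simp: d_def u_def indicator_def)
    have d: "d \<in> carr X"
      using carr_dominated[OF dm carr_diff[OF u g] le] by blast
    have "nrm X d \<le> nrm X (\<lambda>t. u m t - g t)" if "n \<le> m" for m
      using nrm_dominated[OF dm carr_diff[OF u g] le[OF that]] .
    then have "nrm X d \<le> 0"
      using lim by (intro LIMSEQ_le_const[OF lim]) auto
    then have "nrm X d = 0" using nrm_nonneg[OF d] by simp
    then have "AE t in leb01. d t = 0" using nrm_eq_0_iff[OF d] by simp
    then show ?thesis by eventually_elim (auto simp: d_def)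
  qed
  then have "AE t in leb01. \<forall>n. t \<in> A n \<longrightarrow> z t = g t" unfolding AE_all_countable by blast
  then have eq: "AE t in leb01. z t = g t" using A(3) by eventually_elim auto
  show "z \<in> carr X" by (rule carr_AE_cong[OF g z eq])
  have "nrm X z = nrm X g" by (rule nrm_AE_cong[OF g z eq])
  also have "nrm X g \<le> 0 + B"
  proof (rule LIMSEQ_le_const)
    show "(\<lambda>n. nrm X (\<lambda>t. u n t - g t) + B) \<longlonglongrightarrow> 0 + B"
      by (intro tendsto_intros lim)
    have "nrm X g \<le> nrm X (\<lambda>t. u n t - g t) + B" for n
    proof -
      have "nrm X (\<lambda>t. u n t - (u n t - g t)) \<le> nrm X (u n) + nrm X (\<lambda>t. u n t - g t)"
        by (intro nrm_diff carr_diff u g)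
      moreover have "nrm X (u n) \<le> B" using B[of n] by (simp add: u_def[abs_def])
      ultimately show ?thesis by simp
    qed
    then show "\<exists>N. \<forall>n\<ge>N. nrm X g \<le> nrm X (\<lambda>t. u n t - g t) + B" by blast
  qed
  finally show "nrm X z \<le> B" by simp
qed

lemma indicator_equimeasurable:
  assumes A: "A \<in> sets leb01" and B: "B \<in> sets leb01"
    and eq: "measure leb01 A = measure leb01 B" and "indicator A \<in> carr X"
  shows "indicator B \<in> carr X" "nrm X (indicator B) = nrm X (indicator A)"
proof -
  have s: "A \<subseteq> {0..1}" "B \<subseteq> {0..1}"
    using sets.sets_into_space[OF A] sets.sets_into_space[OF B] by auto
  have m: "indicator B \<in> borel_measurable leb01" using B by measurable
  note e = equimeasurable[OF assms(4) m]
  show "indicator B \<in> carr X" "nrm X (indicator B) = nrm X (indicator A)"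
    by (rule e; simp only: measure_indicator_level[OF s(1)] measure_indicator_level[OF s(2)] eq)+
qed

lemma interval_sets: "0 \<le> a \<Longrightarrow> b \<le> 1 \<Longrightarrow> {a..b::real} \<in> sets leb01"
  by (subst sets_restrict_space_iff) auto

lemma measure_interval: "0 \<le> a \<Longrightarrow> a \<le> b \<Longrightarrow> b \<le> 1 \<Longrightarrow> measure leb01 {a..b} = b - a"
  by (subst measure_restrict_space) auto

text \<open>A nonzero element is bounded away from 0 on a set of positive measure, which puts the
  indicator of some small set into \<open>X\<close>. By symmetry the indicators of short intervals
  of the same measure belong to \<open>X\<close>, and finitely many of them cover the unit
  interval.\<close>

lemma carr_one: "(\<lambda>t. 1) \<in> carr X"
proof -
  obtain x where x: "x \<in> carr X" and nz: "\<not> (AE t in leb01. x t = 0)"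
    using symm by (auto simp: symmetric_space_def ae_eq_def)
  note [measurable] = carr_measurable[OF x]
  define A where "A n = {t\<in>{0..1}. \<bar>x t\<bar> > 1 / real (Suc n)}" for n
  have A[measurable]: "A n \<in> sets leb01" for n unfolding A_def by (intro sets_leb01_Collect) measurable
  obtain n where n: "measure leb01 (A n) \<noteq> 0"
  proof (rule ccontr)
    assume *: "\<not> thesis"
    have "AE t in leb01. t \<notin> A n" for n
    proof -
      have "measure leb01 (A n) = 0" using that * by blast
      then show ?thesis using A by (intro AE_not_in) (simp add: null_sets_def leb01.emeasure_eq_measure)
    qed
    then have "AE t in leb01. \<forall>n. t \<notin> A n" by (simp add: AE_all_countable)
    then have "AE t in leb01. x t = 0"
      using AE_leb01_mem
    proof eventually_elim
      case (elim t)
      show ?case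
      proof (rule ccontr)
        assume "x t \<noteq> 0"
        then obtain k where "inverse (real (Suc k)) < \<bar>x t\<bar>" using reals_Archimedean[of "\<bar>x t\<bar>"] by auto
        then show False using elim by (auto simp: A_def inverse_eq_divide)
      qed
    qed
    then show False using nz by simp
  qed
  define a where "a = measure leb01 (A n)"
  have "a > 0" using n by (simp add: a_def zero_less_measure_iff)
  have iA: "indicator (A n) \<in> carr X"
  proof (rule carr_dominated[OF _ carr_scale[OF x, of "real (Suc n)"]])
    show "AE t in leb01. \<bar>indicator (A n) t\<bar> \<le> \<bar>real (Suc n) * x t\<bar>"
      by (intro AE_I2) (auto simp: A_def indicator_def abs_mult field_simps)
  qed measurable
  \<comment> \<open>The length is the reciprocal of an integer so that \<open>Suc N\<close>
    intervals of this length fill the unit interval exactly.\<close>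
  obtain N where N: "inverse (real (Suc N)) < a" using reals_Archimedean[OF \<open>a > 0\<close>] by blast
  define r where "r = 1 / real (Suc N)"
  have r: "0 < r" "r \<le> a" "real (Suc N) * r = 1" using N by (auto simp: r_def inverse_eq_divide)
  obtain B where B: "B \<in> sets leb01" "B \<subseteq> A n" "measure leb01 B = r"
    using exists_subset_measure_eq[OF A, of r n] r by (auto simp: a_def)
  have iB: "indicator B \<in> carr X"
    by (rule carr_dominated[OF _ iA]) (use B in \<open>auto simp: indicator_def\<close>)
  define I where "I i = {real i * r .. real (Suc i) * r}" for i
  have I: "I i \<in> sets leb01" "measure leb01 (I i) = r" if "i \<le> N" for i
  proof -
    have b: "0 \<le> real i * r" "real i * r \<le> real (Suc i) * r" using r by auto
    have "real (Suc i) * r \<le> real (Suc N) * r" using that r by (intro mult_right_mono) auto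
    then have c: "real (Suc i) * r \<le> 1" unfolding r(3) .
    show "I i \<in> sets leb01" unfolding I_def by (rule interval_sets[OF b(1) c])
    show "measure leb01 (I i) = r" unfolding I_def
      using measure_interval[OF b c] by (simp add: algebra_simps)
  qed
  have S: "(\<lambda>t. \<Sum>i\<le>N. indicator (I i) t) \<in> carr X"
    by (intro carr_sum indicator_equimeasurable(1)[OF B(1) _ _ iB]) (use I B in auto)
  show ?thesis
  proof (rule carr_dominated[OF _ S])
    show "AE t in leb01. \<bar>1::real\<bar> \<le> \<bar>\<Sum>i\<le>N. indicator (I i) t\<bar>"
    proof (rule AE_I2)
      fix t assume "t \<in> space leb01"
      then have t: "0 \<le> t" "t \<le> 1" by auto
      \<comment> \<open>The cap at \<open>N\<close> serves the endpoint \<open>t = 1\<close>, where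
        \<open>t / r = N + 1\<close> points past the last interval.\<close>
      define i where "i = min N (nat \<lfloor>t / r\<rfloor>)"
      have "t \<in> I i"
      proof (cases "nat \<lfloor>t / r\<rfloor> \<le> N")
        case True
        then have i: "i = nat \<lfloor>t / r\<rfloor>" by (simp add: i_def)
        have "0 \<le> t / r" using t r by simp
        then have "real i \<le> t / r" "t / r \<le> real (Suc i)" unfolding i by linarith+
        then show ?thesis using r by (simp add: I_def field_simps)
      next
        case False
        then have "i = N" "real N + 1 \<le> t / r" by (auto simp: i_def) linarith
        then have "(real N + 1) * r \<le> t" using r by (simp add: field_simps)
        then have "t = real (Suc N) * r" using t r(3) by (simp add: algebra_simps)
        then show ?thesis using \<open>i = N\<close> r(1) by (simp add: I_def mult_right_mono)
      qed
      then have "1 = (indicator (I i) t :: real)" by simp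
      also have "\<dots> \<le> (\<Sum>i\<le>N. indicator (I i) t)"
        by (rule member_le_sum) (auto simp: i_def)
      finally show "\<bar>1::real\<bar> \<le> \<bar>\<Sum>i\<le>N. indicator (I i) t\<bar>" by linarith
    qed
  qed simp
qed

lemma carr_indicator: "A \<in> sets leb01 \<Longrightarrow> indicator A \<in> carr X"
  using carr_indicator_mult[OF carr_one] by simp

lemma nrm_indicator:
  assumes "A \<in> sets leb01"
  shows "nrm X (indicator A) = fundamental_function X (measure leb01 A)"
proof -
  have b: "0 \<le> measure leb01 A" "measure leb01 A \<le> 1" by (auto simp: leb01.prob_le_1)
  have "{0..measure leb01 A} \<in> sets leb01" by (rule interval_sets) (use b in auto)
  then show ?thesis unfolding fundamental_function_def
    using indicator_equimeasurable(2)[OF _ assms _ carr_indicator] measure_interval[OF _ b] by simp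
qed

end

section \<open>Level sets of a weight\<close>

locale weighted_symmetric_space = symmetric_fun_space +
  fixes w :: "real \<Rightarrow> real"
  assumes weight: "weight w"
begin

abbreviation lev :: "int \<Rightarrow> real set" where "lev \<equiv> level_set w"

definition proj :: "int \<Rightarrow> (real \<Rightarrow> real) \<Rightarrow> real \<Rightarrow> real" where
  "proj k x = (\<lambda>t. indicator (lev k) t * x t)"

text \<open>Vanishing is required at every point, not just almost everywhere, so that decompositions
  into levels are pointwise identities.\<close>

definition supported :: "int set \<Rightarrow> (real \<Rightarrow> real) set" where
  "supported F = {x \<in> carr X. \<forall>t. t \<notin> (\<Union>k\<in>F. lev k) \<longrightarrow> x t = 0}"

definition level_dominated :: "int set \<Rightarrow> (real \<Rightarrow> real) \<Rightarrow> (real \<Rightarrow> real) \<Rightarrow> bool" where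
  "level_dominated F x y \<longleftrightarrow> x \<in> supported F \<and> y \<in> supported F \<and>
     (\<forall>k\<in>F. nrm X (proj k y) \<le> nrm X (proj k x))"

text \<open>One estimate gives both directions, since the condition on the level norms is symmetric
  in \<open>x\<close> and \<open>y\<close>.\<close>

definition level_decomposable :: bool where
  "level_decomposable \<longleftrightarrow> (\<exists>C>0. \<forall>F x y. finite F \<longrightarrow> x \<in> supported F \<longrightarrow> y \<in> supported F \<longrightarrow>
     (\<forall>k\<in>F. nrm X (proj k y) = nrm X (proj k x)) \<longrightarrow> nrm X y \<le> C * nrm X x)"

lemma w_measurable [measurable]: "w \<in> borel_measurable leb01"
  using weight by (simp add: weight_def)

lemma w_pos: "AE t in leb01. 0 < w t"
  using weight by (simp add: weight_def)

lemma lev_sets [measurable]: "lev k \<in> sets leb01"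
  by (rule level_set_sets) measurable

lemma lev_subset: "lev k \<subseteq> {0..1}"
  by (auto simp: level_set_def)

lemma lev_disjoint: "t \<in> lev k \<Longrightarrow> t \<in> lev l \<Longrightarrow> k = l"
proof (rule ccontr)
  assume t: "t \<in> lev k" "t \<in> lev l" and "k \<noteq> l"
  have *: False if "a < b" "t \<in> lev a" "t \<in> lev b" for a b
  proof -
    have "(2::real) powi (a + 1) \<le> 2 powi b"
      using that by (intro power_int_increasing) auto
    then show False using that by (auto simp: level_set_def)
  qed
  show False using *[of k l] *[of l k] t \<open>k \<noteq> l\<close> by linarith
qed

lemma supported_carr: "x \<in> supported F \<Longrightarrow> x \<in> carr X"
  by (simp add: supported_def)

lemma proj_apply: "proj k x t = (if t \<in> lev k then x t else 0)"
  by (simp add: proj_def)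

lemma carr_proj: "x \<in> carr X \<Longrightarrow> proj k x \<in> carr X"
  unfolding proj_def by (intro carr_indicator_mult) auto

lemma nrm_proj: "x \<in> carr X \<Longrightarrow> nrm X (proj k x) \<le> nrm X x"
  unfolding proj_def by (intro nrm_indicator_mult) auto

lemma sum_proj: "finite F \<Longrightarrow> x \<in> supported F \<Longrightarrow> (\<Sum>k\<in>F. proj k x t) = x t"
proof (cases "t \<in> (\<Union>k\<in>F. lev k)")
  case True
  assume "finite F"
  obtain l where l: "l \<in> F" "t \<in> lev l" using True by blast
  have "proj k x t = (if k = l then x t else 0)" for k
    unfolding proj_apply using lev_disjoint l(2) by metis
  then have "(\<Sum>k\<in>F. proj k x t) = (\<Sum>k\<in>F. if k = l then x t else 0)" by (intro sum.cong) auto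
  then show ?thesis using \<open>finite F\<close> l(1) by simp
next
  case False
  assume "x \<in> supported F"
  have "proj k x t = 0" if "k \<in> F" for k
    using False that by (auto simp: proj_apply)
  then show ?thesis using False \<open>x \<in> supported F\<close> by (simp add: supported_def)
qed

lemma proj_supported: "x \<in> carr X \<Longrightarrow> k \<in> F \<Longrightarrow> proj k x \<in> supported F"
  by (auto simp: supported_def carr_proj proj_apply)

lemma nrm_le_sum_proj:
  assumes "finite F" "x \<in> supported F"
  shows "nrm X x \<le> (\<Sum>k\<in>F. nrm X (proj k x))"
proof -
  have "nrm X (\<lambda>t. \<Sum>k\<in>F. proj k x t) \<le> (\<Sum>k\<in>F. nrm X (proj k x))"
    using assms by (intro nrm_sum carr_proj) (auto simp: supported_carr)
  then show ?thesis using sum_proj[OF assms] by simp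
qed

definition restr :: "int set \<Rightarrow> (real \<Rightarrow> real) \<Rightarrow> real \<Rightarrow> real" where
  "restr G x = (\<lambda>t. indicator (\<Union>k\<in>G. lev k) t * x t)"

lemma Union_lev_sets [measurable]: "(\<Union>k\<in>G. lev k) \<in> sets leb01"
  by (rule sets.countable_UN') auto

lemma restr_supported: "x \<in> carr X \<Longrightarrow> restr G x \<in> supported G"
  using carr_indicator_mult[of x "\<Union>k\<in>G. lev k"] by (auto simp: supported_def restr_def)

lemma nrm_restr: "x \<in> carr X \<Longrightarrow> nrm X (restr G x) \<le> nrm X x"
  unfolding restr_def by (intro nrm_indicator_mult) auto

lemma proj_restr: "k \<in> G \<Longrightarrow> proj k (restr G x) = proj k x"
  by (auto simp: fun_eq_iff restr_def proj_def indicator_def)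

end

section \<open>Step functions with one set in each level\<close>

locale power_fundamental = weighted_symmetric_space +
  fixes p :: real
  assumes p: "1 < p"
    and phi: "\<forall>t\<in>{0..1}. fundamental_function X t = t powr (1 / p)"
    and dec: level_decomposable
begin

lemma nrm_indicator_powr: "A \<in> sets leb01 \<Longrightarrow> nrm X (indicator A) = measure leb01 A powr (1/p)"
  using nrm_indicator phi by (simp add: leb01.prob_le_1)

lemma nrm_scaled_indicator:
  "A \<in> sets leb01 \<Longrightarrow> nrm X (\<lambda>t. a * indicator A t) = \<bar>a\<bar> * measure leb01 A powr (1/p)"
  using nrm_scale[OF carr_indicator] nrm_indicator_powr by simp

text \<open>On each level the set \<open>B k\<close> is exchanged for a smaller set \<open>B' k\<close> carrying a larger constant,
  chosen so that the constant no longer depends on the level; the norm of the resulting multiple of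
  an indicator is read off the fundamental function.\<close>

lemma step_function_nrm_equiv:
  "\<exists>C>0. \<forall>F a B. finite F \<longrightarrow> (\<forall>k\<in>F. 0 \<le> a k \<and> B k \<in> sets leb01 \<and> B k \<subseteq> lev k) \<longrightarrow>
     nrm X (\<lambda>t. \<Sum>k\<in>F. a k * indicator (B k) t) \<le> C * (\<Sum>k\<in>F. a k powr p * measure leb01 (B k)) powr (1/p) \<and>
     (\<Sum>k\<in>F. a k powr p * measure leb01 (B k)) powr (1/p) \<le> C * nrm X (\<lambda>t. \<Sum>k\<in>F. a k * indicator (B k) t)"
proof -
  obtain C where C: "C > 0" and CD: "\<And>F x y. finite F \<Longrightarrow> x \<in> supported F \<Longrightarrow> y \<in> supported F \<Longrightarrow>
     (\<And>k. k \<in> F \<Longrightarrow> nrm X (proj k y) = nrm X (proj k x)) \<Longrightarrow> nrm X y \<le> C * nrm X x"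
    using dec unfolding level_decomposable_def by meson
  show ?thesis
  proof (intro exI[of _ C] conjI allI impI C)
    fix F :: "int set" and a :: "int \<Rightarrow> real" and B :: "int \<Rightarrow> real set"
    assume F: "finite F" and aB: "\<forall>k\<in>F. 0 \<le> a k \<and> B k \<in> sets leb01 \<and> B k \<subseteq> lev k"
    define S where "S = (\<Sum>k\<in>F. a k powr p * measure leb01 (B k))"
    define x where "x t = (\<Sum>k\<in>F. a k * indicator (B k) t)" for t
    \<comment> \<open>This is the common constant. It exceeds every coefficient, so that the smaller
      sets fit inside the given ones; the summand 1 keeps it positive when all coefficients
      vanish.\<close>
    define \<beta> where "\<beta> = 1 + (\<Sum>k\<in>F. a k)"
    have \<beta>: "0 < \<beta>" "a k \<le> \<beta>" if "k \<in> F" for k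
      using member_le_sum[of k F a] F aB that sum_nonneg[of F a] by (auto simp: \<beta>_def)
    have \<beta>0: "0 < \<beta>" using sum_nonneg[of F a] aB by (auto simp: \<beta>_def)
    \<comment> \<open>With the fundamental function \<open>t powr (1 / p)\<close> this measure gives
      \<beta> times the indicator of \<open>D\<close> the same norm as \<open>a k\<close> times the
      indicator of \<open>B k\<close>.\<close>
    have "\<exists>D. k \<in> F \<longrightarrow> D \<in> sets leb01 \<and> D \<subseteq> B k \<and> measure leb01 D = (a k / \<beta>) powr p * measure leb01 (B k)" for k
    proof (cases "k \<in> F")
      case True
      have "(a k / \<beta>) powr p \<le> 1 powr p"
        using \<beta>[OF True] aB True p by (intro powr_mono2) auto
      then have "(a k / \<beta>) powr p * measure leb01 (B k) \<le> 1 * measure leb01 (B k)"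
        by (intro mult_right_mono) auto
      then show ?thesis
        using exists_subset_measure_eq[of "B k" "(a k / \<beta>) powr p * measure leb01 (B k)"] aB True by auto
    qed auto
    then obtain B' where B': "\<And>k. k \<in> F \<Longrightarrow> B' k \<in> sets leb01 \<and> B' k \<subseteq> B k \<and>
        measure leb01 (B' k) = (a k / \<beta>) powr p * measure leb01 (B k)"
      by metis
    have single: "(\<Sum>k\<in>F. b k * indicator (D k) t) = b l * indicator (D l) t"
      if "l \<in> F" "t \<in> lev l" "\<And>k. k \<in> F \<Longrightarrow> D k \<subseteq> lev k" for b :: "int \<Rightarrow> real" and D l t
    proof -
      have "t \<notin> D k" if "k \<in> F" "k \<noteq> l" for k
        using that lev_disjoint[of t k l] \<open>t \<in> lev l\<close> \<open>\<And>k. k \<in> F \<Longrightarrow> D k \<subseteq> lev k\<close>[OF \<open>k \<in> F\<close>] by auto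
      then have "(\<Sum>k\<in>F. b k * indicator (D k) t) = (\<Sum>k\<in>F. if k = l then b l * indicator (D l) t else 0)"
        by (intro sum.cong) auto
      then show ?thesis using F that by simp
    qed
    have supp: "(\<lambda>t. \<Sum>k\<in>F. b k * indicator (D k) t) \<in> supported F"
      if "\<And>k. k \<in> F \<Longrightarrow> D k \<in> sets leb01 \<and> D k \<subseteq> lev k" for b :: "int \<Rightarrow> real" and D
    proof -
      have "(\<lambda>t. \<Sum>k\<in>F. b k * indicator (D k) t) \<in> carr X"
        by (intro carr_sum carr_scale carr_indicator) (use that in auto)
      moreover have "(\<Sum>k\<in>F. b k * indicator (D k) t) = 0" if "t \<notin> (\<Union>k\<in>F. lev k)" for t
      proof (rule sum.neutral, intro ballI)
        fix k assume "k \<in> F"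
        then have "t \<notin> D k"
          using \<open>t \<notin> (\<Union>k\<in>F. lev k)\<close> \<open>\<And>k. k \<in> F \<Longrightarrow> D k \<in> sets leb01 \<and> D k \<subseteq> lev k\<close>[of k] by blast
        then show "b k * indicator (D k) t = 0" by simp
      qed
      ultimately show ?thesis by (auto simp: supported_def)
    qed
    have prj: "proj l (\<lambda>t. \<Sum>k\<in>F. b k * indicator (D k) t) = (\<lambda>t. b l * indicator (D l) t)"
      if "l \<in> F" "\<And>k. k \<in> F \<Longrightarrow> D k \<subseteq> lev k" for b :: "int \<Rightarrow> real" and D l
    proof
      fix t
      show "proj l (\<lambda>t. \<Sum>k\<in>F. b k * indicator (D k) t) t = b l * indicator (D l) t"
        using single[of l t D b] that(1) that(2)[OF that(1)] that(2)
        by (cases "t \<in> lev l"; cases "t \<in> D l") (auto simp: proj_apply)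
    qed
    define y where "y t = (\<Sum>k\<in>F. \<beta> * indicator (B' k) t)" for t
    have x: "x \<in> supported F" unfolding x_def[abs_def] by (rule supp) (use aB in auto)
    have BL: "B' k \<subseteq> lev k" if "k \<in> F" for k using B'[OF that] aB that by blast
    have y: "y \<in> supported F" unfolding y_def[abs_def] by (rule supp) (use B' BL in auto)
    have eq: "nrm X (proj k y) = nrm X (proj k x)" if k: "k \<in> F" for k
    proof -
      have "proj k y = (\<lambda>t. \<beta> * indicator (B' k) t)" unfolding y_def[abs_def]
        using k BL by (rule prj)
      moreover have "proj k x = (\<lambda>t. a k * indicator (B k) t)" unfolding x_def[abs_def]
        using k aB by (intro prj) auto
      moreover have "measure leb01 (B' k) powr (1/p) = a k / \<beta> * measure leb01 (B k) powr (1/p)"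
        using B'[OF k] \<beta>0 aB k p by (simp add: powr_mult powr_powr)
      ultimately show ?thesis using B'[OF k] aB k \<beta>0 by (simp add: nrm_scaled_indicator)
    qed
    \<comment> \<open>Disjointness turns \<open>y\<close> into \<beta> times a single indicator,
      whose norm is explicit; in it \<beta> cancels.\<close>
    have disj: "disjoint_family_on B' F"
      unfolding disjoint_family_on_def using BL lev_disjoint by blast
    have "y = (\<lambda>t. \<beta> * indicator (\<Union>k\<in>F. B' k) t)"
      by (simp add: fun_eq_iff y_def indicator_UN_disjoint[OF F disj] sum_distrib_left)
    then have "nrm X y = \<beta> * measure leb01 (\<Union>k\<in>F. B' k) powr (1/p)"
      using B' \<beta>0 F by (simp add: nrm_scaled_indicator sets.finite_UN)
    also have "measure leb01 (\<Union>k\<in>F. B' k) = (\<Sum>k\<in>F. measure leb01 (B' k))"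
      by (rule leb01.finite_measure_finite_Union[OF F _ disj]) (use B' in auto)
    also have "\<dots> = (\<Sum>k\<in>F. a k powr p * measure leb01 (B k)) / \<beta> powr p"
      using B' aB \<beta>0 by (simp add: sum_divide_distrib powr_divide)
    also have "\<beta> * ((\<Sum>k\<in>F. a k powr p * measure leb01 (B k)) / \<beta> powr p) powr (1/p) = S powr (1/p)"
      using \<beta>0 p by (simp add: S_def[symmetric] powr_divide powr_powr sum_nonneg) 
    finally have ny: "nrm X y = S powr (1/p)" .
    have "nrm X y \<le> C * nrm X x" by (rule CD[OF F x y eq])
    moreover have "nrm X x \<le> C * nrm X y" by (rule CD[OF F y x]) (use eq in simp)
    ultimately show "nrm X (\<lambda>t. \<Sum>k\<in>F. a k * indicator (B k) t) \<le> C * (\<Sum>k\<in>F. a k powr p * measure leb01 (B k)) powr (1/p)"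
     "(\<Sum>k\<in>F. a k powr p * measure leb01 (B k)) powr (1/p) \<le> C * nrm X (\<lambda>t. \<Sum>k\<in>F. a k * indicator (B k) t)"
      by (simp_all add: ny S_def x_def[abs_def])
  qed
qed

end

section \<open>Dyadic step functions\<close>

lemma disjoint_indicator_sum_cases:
  fixes b :: "'i \<Rightarrow> real"
  assumes "finite J" "disjoint_family_on E J"
  obtains j where "j \<in> J" "t \<in> E j" "(\<Sum>j\<in>J. b j * indicator (E j) t) = b j"
  | "\<And>j. j \<in> J \<Longrightarrow> t \<notin> E j" "(\<Sum>j\<in>J. b j * indicator (E j) t) = 0"
proof (cases "\<exists>j\<in>J. t \<in> E j")
  case True
  then obtain j where j: "j \<in> J" "t \<in> E j" by blast
  have "t \<notin> E i" if "i \<in> J" "i \<noteq> j" for i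
    using assms(2) j that unfolding disjoint_family_on_def by blast
  then have "(\<Sum>j\<in>J. b j * indicator (E j) t) = (\<Sum>i\<in>J. if i = j then b j else 0)"
    using j by (intro sum.cong) auto
  then show ?thesis using that(1)[OF j] assms(1) j(1) by simp
next
  case False
  then show ?thesis using that(2) by simp
qed

text \<open>The distribution of such a step function depends on the sets only through their
  measures. This permits moving the sets elsewhere without changing the norm.\<close>

lemma measure_step_function_level:
  fixes b :: "'i \<Rightarrow> real"
  assumes J: "finite J" "disjoint_family_on E J" and E: "\<And>j. j \<in> J \<Longrightarrow> E j \<in> sets leb01 \<and> 0 < b j"
    and l: "0 \<le> l"
  shows "measure leb01 {t\<in>{0..1}. \<bar>\<Sum>j\<in>J. b j * indicator (E j) t\<bar> > l} =
    (\<Sum>j\<in>{j\<in>J. l < b j}. measure leb01 (E j))"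
proof -
  have sub: "E j \<subseteq> {0..1}" if "j \<in> J" for j using sets.sets_into_space[of "E j" leb01] E[OF that] by simp
  have "t \<in> {0..1} \<and> \<bar>\<Sum>j\<in>J. b j * indicator (E j) t\<bar> > l \<longleftrightarrow> (\<exists>j\<in>{j\<in>J. l < b j}. t \<in> E j)" for t
  proof (rule disjoint_indicator_sum_cases[OF J, of t b])
    fix j assume j: "j \<in> J" "t \<in> E j" and eq: "(\<Sum>j\<in>J. b j * indicator (E j) t) = b j"
    have "i = j" if "i \<in> J" "t \<in> E i" for i
      using J(2) j that unfolding disjoint_family_on_def by blast
    then have "(\<exists>i\<in>{i\<in>J. l < b i}. t \<in> E i) \<longleftrightarrow> l < b j" using j by blast
    moreover have "t \<in> {0..1}" "\<bar>b j\<bar> = b j" using j(2) sub[OF j(1)] E[OF j(1)] by auto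
    ultimately show ?thesis unfolding eq by simp
  next
    assume "\<And>j. j \<in> J \<Longrightarrow> t \<notin> E j" and eq: "(\<Sum>j\<in>J. b j * indicator (E j) t) = 0"
    then show ?thesis unfolding eq using l by auto
  qed
  then have "{t\<in>{0..1}. \<bar>\<Sum>j\<in>J. b j * indicator (E j) t\<bar> > l} = (\<Union>j\<in>{j\<in>J. l < b j}. E j)"
    by blast
  also have "measure leb01 \<dots> = (\<Sum>j\<in>{j\<in>J. l < b j}. measure leb01 (E j))"
    using E J by (intro leb01.finite_measure_finite_Union) (auto simp: disjoint_family_on_def)
  finally show ?thesis .
qed

text \<open>The index is a natural number, so values below 1 lie in no shell. Small values form a
  bounded part, which is estimated by a constant.\<close>

definition dyadic_shell :: "(real \<Rightarrow> real) \<Rightarrow> nat \<Rightarrow> real set" where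
  "dyadic_shell x j = {t\<in>{0..1}. 2 ^ j \<le> \<bar>x t\<bar> \<and> \<bar>x t\<bar> < 2 ^ Suc j}"

abbreviation dyadic_step :: "nat set \<Rightarrow> (real \<Rightarrow> real) \<Rightarrow> real \<Rightarrow> real" where
  "dyadic_step J x t \<equiv> \<Sum>j\<in>J. 2 ^ j * indicator (dyadic_shell x j) t"

lemma dyadic_shell_sets [measurable]:
  assumes [measurable]: "x \<in> borel_measurable leb01"
  shows "dyadic_shell x j \<in> sets leb01"
  unfolding dyadic_shell_def by (intro sets_leb01_Collect) measurable

lemma dyadic_shell_disjoint: "disjoint_family_on (dyadic_shell x) J"
proof -
  have False if "i < j" "t \<in> dyadic_shell x i" "t \<in> dyadic_shell x j" for i j t
  proof -
    have "(2::real) ^ Suc i \<le> 2 ^ j" using that by (intro power_increasing) auto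
    then show False using that by (auto simp: dyadic_shell_def)
  qed
  then show ?thesis unfolding disjoint_family_on_def
    by (metis disjoint_iff linorder_less_linear)
qed

lemma dyadic_shell_exists:
  assumes "t \<in> {0..1}" "2 ^ a \<le> \<bar>x t\<bar>" "\<bar>x t\<bar> < 2 ^ b"
  shows "\<exists>j\<in>{a..<b}. t \<in> dyadic_shell x j"
proof -
  define m where "m = (LEAST m. \<bar>x t\<bar> < 2 ^ m)"
  have m: "\<bar>x t\<bar> < 2 ^ m" "m \<le> b"
    unfolding m_def by (rule LeastI[of _ b], rule assms(3)) (rule Least_le, rule assms(3))
  have "a < m"
    using le_less_trans[OF assms(2) m(1)] by simp
  then obtain j where j: "m = Suc j" "a \<le> j" by (cases m) auto
  have "\<not> \<bar>x t\<bar> < 2 ^ j" using not_less_Least[of j "\<lambda>m. \<bar>x t\<bar> < 2 ^ m"] j by (simp add: m_def)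
  then show ?thesis using m j assms(1) by (intro bexI[of _ j]) (auto simp: dyadic_shell_def)
qed

lemma dyadic_sum_upper:
  assumes "t \<in> {0..1}" "2 ^ a \<le> \<bar>x t\<bar>" "\<bar>x t\<bar> < 2 ^ b"
  shows "\<bar>x t\<bar> \<le> 2 * dyadic_step {a..<b} x t"
proof -
  obtain i where i: "i \<in> {a..<b}" "t \<in> dyadic_shell x i" using dyadic_shell_exists[of t a x b] assms by blast
  have "\<bar>x t\<bar> \<le> 2 * (2 ^ i * indicator (dyadic_shell x i) t)" using i(2) by (simp add: dyadic_shell_def)
  also have "(2 ^ i * indicator (dyadic_shell x i) t :: real) \<le> dyadic_step {a..<b} x t"
    by (rule member_le_sum[OF i(1)]) auto
  finally show ?thesis by simp
qed

lemma dyadic_sum_lower: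
  assumes "finite J"
  shows "dyadic_step J x t \<le> \<bar>x t\<bar>"
  by (rule disjoint_indicator_sum_cases[OF assms dyadic_shell_disjoint, of t x "\<lambda>j. 2 ^ j"])
    (auto simp: dyadic_shell_def)

lemma dyadic_sum_powr_lower:
  fixes p :: real
  assumes "finite J" "0 < p"
  shows "(\<Sum>j\<in>J. 2 powr (j * p) * indicator (dyadic_shell x j) t) \<le> \<bar>x t\<bar> powr p"
proof (rule disjoint_indicator_sum_cases[OF assms(1) dyadic_shell_disjoint, of t x "\<lambda>j. 2 powr (j * p)"])
  fix j assume "t \<in> dyadic_shell x j"
    and eq: "(\<Sum>j\<in>J. 2 powr (j * p) * indicator (dyadic_shell x j) t) = 2 powr (j * p)"
  then have "(2 ^ j) powr p \<le> \<bar>x t\<bar> powr p"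
    using assms by (intro powr_mono2) (auto simp: dyadic_shell_def)
  then show ?thesis unfolding eq by (simp add: powr_powr flip: powr_realpow)
qed simp

lemma dyadic_sum_powr_upper:
  fixes p :: real
  assumes "t \<in> {0..1}" "\<bar>x t\<bar> < 2 ^ b" "0 < p"
  shows "\<bar>x t\<bar> powr p \<le> 2 powr (a * p) +
    2 powr p * (\<Sum>j\<in>{a..<b}. 2 powr (j * p) * indicator (dyadic_shell x j) t)"
proof (cases "2 ^ a \<le> \<bar>x t\<bar>")
  case True
  obtain i where i: "i \<in> {a..<b}" "t \<in> dyadic_shell x i" using dyadic_shell_exists[of t a x b] True assms by blast
  have "\<bar>x t\<bar> powr p \<le> (2 * 2 ^ i) powr p"
    using i(2) assms(3) by (intro powr_mono2) (auto simp: dyadic_shell_def)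
  also have "\<dots> = 2 powr p * (2 powr (i * p) * indicator (dyadic_shell x i) t)"
    using i(2) by (simp add: powr_mult powr_powr flip: powr_realpow)
  also have "\<dots> \<le> 2 powr p * (\<Sum>j\<in>{a..<b}. 2 powr (j * p) * indicator (dyadic_shell x j) t)"
    by (intro mult_left_mono member_le_sum[OF i(1)]) auto
  finally show ?thesis by (simp add: add_increasing)
next
  case False
  then have "\<bar>x t\<bar> powr p \<le> (2 ^ a) powr p" using assms(3) by (intro powr_mono2) auto
  also have "\<dots> = 2 powr (a * p)" by (simp add: powr_powr flip: powr_realpow)
  finally show ?thesis by (simp add: add_increasing2 sum_nonneg)
qed

text \<open>A greedy choice. If the \<open>k\<close>-th rearranged term exceeds \<open>s\<close>, at
  least \<open>k\<close> members of the family exceed \<open>s\<close>; for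
  \<open>k = k0 + n\<close> with \<open>k0 \<ge> 1\<close> these cannot all be among the
  \<open>n\<close> indices chosen before.\<close>

lemma rearrangement_levels:
  fixes a :: "int \<Rightarrow> real"
  assumes "0 < c0" and ge: "\<And>k. k0 \<le> k \<Longrightarrow> decreasing_rearrangement a k * 2 ^ k \<ge> c0" and "1 \<le> k0"
  shows "\<exists>\<kappa>. inj_on \<kappa> {k0..<k0+n} \<and> (\<forall>k\<in>{k0..<k0+n}. c0 / 2 / 2 ^ k < a (\<kappa> k))"
proof (induction n)
  case (Suc n)
  then obtain \<kappa> where \<kappa>: "inj_on \<kappa> {k0..<k0+n}" "\<And>k. k\<in>{k0..<k0+n} \<Longrightarrow> c0 / 2 / 2 ^ k < a (\<kappa> k)" by auto
  define k where "k = k0 + n"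
  define s where "s = c0 / 2 / 2 ^ k"
  have "s < c0 / 2 ^ k" using assms(1) by (simp add: s_def field_simps)
  \<comment> \<open>The halving of \<open>c0\<close> makes the inequality below strict, which the
    infimum in \<open>decreasing_rearrangement\<close> requires.\<close>
  also have "\<dots> \<le> decreasing_rearrangement a k" using ge[of k] by (simp add: k_def field_simps)
  finally have s: "s < decreasing_rearrangement a k" .
  have "\<not> (finite {j. s < a j} \<and> card {j. s < a j} < k)"
  proof
    assume *: "finite {j. s < a j} \<and> card {j. s < a j} < k"
    have "decreasing_rearrangement a k \<le> s" unfolding decreasing_rearrangement_def
      by (rule cInf_lower) (use * assms(1) in \<open>auto simp: s_def intro!: bdd_belowI[of _ 0]\<close>)
    then show False using s by simp
  qed
  moreover have "finite {j. s < a j} \<and> card {j. s < a j} < k" if "{j. s < a j} \<subseteq> \<kappa> ` {k0..<k0+n}"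
  proof
    show "finite {j. s < a j}" using that finite_subset by blast
    have "card {j. s < a j} \<le> card (\<kappa> ` {k0..<k0+n})" using that by (intro card_mono) auto
    also have "\<dots> \<le> n" using card_image_le[of "{k0..<k0+n}" \<kappa>] by simp
    finally show "card {j. s < a j} < k" using assms(3) by (simp add: k_def)
  qed
  ultimately obtain j where j: "s < a j" "j \<notin> \<kappa> ` {k0..<k0+n}" by blast
  have set: "{k0..<k0 + Suc n} = insert k {k0..<k0+n}" by (auto simp: k_def)
  have "k \<notin> {k0..<k0+n}" by (simp add: k_def)
  then have "inj_on (\<kappa>(k := j)) {k0..<k0 + Suc n}"
    unfolding set using \<kappa>(1) j(2) by (simp add: inj_on_def) (metis fun_upd_apply image_eqI atLeastLessThan_iff)
  moreover have "\<forall>i\<in>{k0..<k0 + Suc n}. c0 / 2 / 2 ^ i < a ((\<kappa>(k := j)) i)"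
    unfolding set using \<kappa>(2) j(1) by (auto simp: s_def)
  ultimately show ?case by blast
qed auto

context power_fundamental
begin

text \<open>The norm sees only the distribution, so the sets \<open>E j\<close>, wherever they lie,
  may be exchanged for sets of the same measure inside distinct levels; there
  \<open>step_function_nrm_equiv\<close> applies.\<close>

lemma dyadic_step_nrm_equiv:
  assumes "0 < c0" and "1 \<le> k0" and ge: "\<And>k. k0 \<le> k \<Longrightarrow> weight_seq w k * 2 ^ k \<ge> c0"
  obtains C J0 where "0 < C" and
    "\<And>(J::nat set) (E::nat \<Rightarrow> real set). finite J \<Longrightarrow> J \<subseteq> {J0..} \<Longrightarrow> disjoint_family_on E J \<Longrightarrow>
       (\<And>j. j \<in> J \<Longrightarrow> E j \<in> sets leb01 \<and> measure leb01 (E j) \<le> 2 powr (- (j * p))) \<Longrightarrow>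
       nrm X (\<lambda>t. \<Sum>j\<in>J. 2 ^ j * indicator (E j) t) \<le> C * (\<Sum>j\<in>J. 2 powr (j * p) * measure leb01 (E j)) powr (1/p) \<and>
       (\<Sum>j\<in>J. 2 powr (j * p) * measure leb01 (E j)) powr (1/p) \<le> C * nrm X (\<lambda>t. \<Sum>j\<in>J. 2 ^ j * indicator (E j) t)"
proof -
  obtain C where C: "C > 0" and CS: "\<And>F a B. finite F \<Longrightarrow> (\<And>k. k\<in>F \<Longrightarrow> 0 \<le> a k \<and> B k \<in> sets leb01 \<and> B k \<subseteq> lev k) \<Longrightarrow>
     nrm X (\<lambda>t. \<Sum>k\<in>F. a k * indicator (B k) t) \<le> C * (\<Sum>k\<in>F. a k powr p * measure leb01 (B k)) powr (1/p) \<and>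
     (\<Sum>k\<in>F. a k powr p * measure leb01 (B k)) powr (1/p) \<le> C * nrm X (\<lambda>t. \<Sum>k\<in>F. a k * indicator (B k) t)"
    using step_function_nrm_equiv by meson
  \<comment> \<open>From this index on \<open>j * (p - 1)\<close> is at least
    \<open>log 2 (2 / c0)\<close>, so the surplus of \<open>2 powr (- (j * p))\<close> over the
    decay \<open>2 powr (- j)\<close> absorbs the factor \<open>c0 / 2\<close>.\<close>
  obtain J1 :: nat where J1: "log 2 (2 / c0) / (p - 1) \<le> real J1" using real_arch_simple by blast
  define J0 where "J0 = max k0 J1"
  have small: "2 powr (- (real j * p)) \<le> c0 / 2 / 2 ^ j" if "J0 \<le> j" for j :: nat
  proof -
    have "log 2 (2 / c0) / (p - 1) \<le> real j" using J1 that by (simp add: J0_def)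
    then have "log 2 (2 / c0) \<le> real j * (p - 1)" using p by (simp add: field_simps)
    then have "2 powr (- (real j * (p - 1))) \<le> 2 powr (- log 2 (2 / c0))" by (intro powr_mono) auto
    also have "\<dots> = c0 / 2" using assms(1) by (simp add: powr_minus)
    finally have "2 powr (- (real j * (p - 1))) / 2 ^ j \<le> c0 / 2 / 2 ^ j" by (rule divide_right_mono) auto
    moreover have "2 powr (- (real j * (p - 1))) / 2 ^ j = 2 powr (- (real j * p))"
      by (simp add: powr_realpow[symmetric] powr_diff[symmetric] algebra_simps)
    ultimately show ?thesis by simp
  qed
  show ?thesis
  proof (rule that[OF C, of J0])
    fix J :: "nat set" and E :: "nat \<Rightarrow> real set"
    assume J: "finite J" "J \<subseteq> {J0..}" and disj: "disjoint_family_on E J"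
      and E: "\<And>j. j \<in> J \<Longrightarrow> E j \<in> sets leb01 \<and> measure leb01 (E j) \<le> 2 powr (- (j * p))"
    obtain n where n: "J \<subseteq> {..<n}" using J(1) finite_nat_iff_bounded by blast
    have J': "J \<subseteq> {k0..<k0+n}" using J(2) n by (force simp: J0_def)
    obtain \<kappa> where \<kappa>: "inj_on \<kappa> {k0..<k0+n}" "\<And>k. k\<in>{k0..<k0+n} \<Longrightarrow> c0 / 2 / 2 ^ k < measure leb01 (lev (\<kappa> k))"
      using rearrangement_levels[OF assms(1), of k0 "\<lambda>j. measure leb01 (lev j)" n] ge assms(2)
      unfolding weight_seq_def by blast
    have inj: "inj_on \<kappa> J" using \<kappa>(1) J' by (rule inj_on_subset)
    have "\<exists>B. j \<in> J \<longrightarrow> B \<in> sets leb01 \<and> B \<subseteq> lev (\<kappa> j) \<and> measure leb01 B = measure leb01 (E j)" for j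
    proof (cases "j \<in> J")
      case True
      have "measure leb01 (E j) \<le> c0 / 2 / 2 ^ j" using E[OF True] small[of j] True J(2) by auto
      also have "\<dots> \<le> measure leb01 (lev (\<kappa> j))" using \<kappa>(2)[of j] True J' by force
      finally show ?thesis using exists_subset_measure_eq[of "lev (\<kappa> j)" "measure leb01 (E j)"] by auto
    qed auto
    then obtain B where B: "\<And>j. j \<in> J \<Longrightarrow> B j \<in> sets leb01 \<and> B j \<subseteq> lev (\<kappa> j) \<and> measure leb01 (B j) = measure leb01 (E j)"
      by metis
    \<comment> \<open>The equivalence for step functions is indexed by levels; \<open>g\<close>
      carries the sums over \<open>J\<close> to sums over the levels chosen by \<kappa>.\<close>
    define g where "g = the_inv_into J \<kappa>"
    have g: "g (\<kappa> j) = j" if "j \<in> J" for j using the_inv_into_f_f[OF inj that] by (simp add: g_def)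
    have Bdisj: "disjoint_family_on B J"
      unfolding disjoint_family_on_def
    proof (intro ballI impI)
      fix i j assume ij: "i \<in> J" "j \<in> J" "i \<noteq> j"
      then have "\<kappa> i \<noteq> \<kappa> j" using inj by (auto simp: inj_on_def)
      then show "B i \<inter> B j = {}" using B[OF ij(1)] B[OF ij(2)] lev_disjoint by blast
    qed
    have reix: "(\<Sum>k\<in>\<kappa> ` J. h (g k)) = (\<Sum>j\<in>J. h j)" for h :: "nat \<Rightarrow> real"
      using inj g by (simp add: sum.reindex)
    have BC: "(\<lambda>t. \<Sum>j\<in>J. 2 ^ j * indicator (B j) t) \<in> carr X"
      by (intro carr_sum carr_scale carr_indicator) (use B in auto)
    have eqn: "nrm X (\<lambda>t. \<Sum>j\<in>J. 2 ^ j * indicator (E j) t) = nrm X (\<lambda>t. \<Sum>j\<in>J. 2 ^ j * indicator (B j) t)"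
    proof (rule nrm_equimeasurable[OF BC])
      show "(\<lambda>t. \<Sum>j\<in>J. 2 ^ j * indicator (E j) t :: real) \<in> borel_measurable leb01"
        by (intro carr_measurable carr_sum carr_scale carr_indicator) (use E in auto)
      fix l :: real assume l: "0 \<le> l"
      show "leb01.prob {t \<in> {0..1}. l < \<bar>\<Sum>j\<in>J. 2 ^ j * indicat_real (E j) t\<bar>} =
         leb01.prob {t \<in> {0..1}. l < \<bar>\<Sum>j\<in>J. 2 ^ j * indicat_real (B j) t\<bar>}"
        using E B by (subst (1 2) measure_step_function_level[OF J(1) _ _ l]) (auto simp: disj Bdisj intro!: sum.cong)
    qed
    have p2: "((2::real) ^ j) powr p = 2 powr (real j * p)" for j :: nat
      by (simp add: powr_powr flip: powr_realpow)
    have "nrm X (\<lambda>t. \<Sum>k\<in>\<kappa> ` J. 2 ^ g k * indicator (B (g k)) t) \<le>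
         C * (\<Sum>k\<in>\<kappa> ` J. (2 ^ g k) powr p * measure leb01 (B (g k))) powr (1/p) \<and>
       (\<Sum>k\<in>\<kappa> ` J. (2 ^ g k) powr p * measure leb01 (B (g k))) powr (1/p) \<le>
         C * nrm X (\<lambda>t. \<Sum>k\<in>\<kappa> ` J. 2 ^ g k * indicator (B (g k)) t)"
      by (rule CS) (use J(1) B g in fastforce)+
    moreover have "(\<Sum>k\<in>\<kappa> ` J. (2 ^ g k) powr p * measure leb01 (B (g k))) = (\<Sum>j\<in>J. 2 powr (j * p) * measure leb01 (E j))"
      using reix[of "\<lambda>j. (2 ^ j) powr p * measure leb01 (B j)"] B by (simp add: p2)
    moreover have "(\<Sum>k\<in>\<kappa> ` J. 2 ^ g k * indicator (B (g k)) t) = (\<Sum>j\<in>J. 2 ^ j * indicat_real (B j) t)" for t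
      by (rule reix[of "\<lambda>j. 2 ^ j * indicator (B j) t"])
    ultimately show "nrm X (\<lambda>t. \<Sum>j\<in>J. 2 ^ j * indicator (E j) t) \<le> C * (\<Sum>j\<in>J. 2 powr (j * p) * measure leb01 (E j)) powr (1/p) \<and>
       (\<Sum>j\<in>J. 2 powr (j * p) * measure leb01 (E j)) powr (1/p) \<le> C * nrm X (\<lambda>t. \<Sum>j\<in>J. 2 ^ j * indicator (E j) t)"
      unfolding eqn by simp
  qed
qed

end

section \<open>Comparison with the Lebesgue space\<close>

lemma dyadic_step_integral:
  fixes c :: "nat \<Rightarrow> real"
  assumes "x \<in> borel_measurable leb01"
  shows "integrable leb01 (\<lambda>t. \<Sum>j\<in>J. c j * indicator (dyadic_shell x j) t)"
    and "(\<integral>t. (\<Sum>j\<in>J. c j * indicator (dyadic_shell x j) t) \<partial>leb01) = (\<Sum>j\<in>J. c j * measure leb01 (dyadic_shell x j))"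
proof -
  have i: "integrable leb01 (\<lambda>t. c j * indicator (dyadic_shell x j) t)" for j
    using dyadic_shell_sets[OF assms] by (intro integrable_mult_right integrable_real_indicator) (auto simp: leb01.emeasure_eq_measure)
  then show "integrable leb01 (\<lambda>t. \<Sum>j\<in>J. c j * indicator (dyadic_shell x j) t)"
    by (rule Bochner_Integration.integrable_sum)
  have sh: "dyadic_shell x j \<inter> {0..1} = dyadic_shell x j" for j by (auto simp: dyadic_shell_def)
  have "(\<integral>t. c j * indicator (dyadic_shell x j) t \<partial>leb01) = c j * measure leb01 (dyadic_shell x j)" for j
    using i[of j] by (simp add: sh)
  then show "(\<integral>t. (\<Sum>j\<in>J. c j * indicator (dyadic_shell x j) t) \<partial>leb01) = (\<Sum>j\<in>J. c j * measure leb01 (dyadic_shell x j))"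
    using i by (subst Bochner_Integration.integral_sum) (auto simp: sh simp del: sum_mult_indicator)
qed

context power_fundamental
begin

text \<open>Both inclusions are first shown on unit balls, where the shells are small enough for
  \<open>dyadic_step_nrm_equiv\<close>, and then extended by homogeneity. For the inclusion of
  \<open>L_p\<close> in \<open>X\<close> bounded truncations are not enough: they have to be Cauchy,
  which follows from the convergence of the series of the \<open>b x j\<close>.\<close>

theorem equal_Lp:
  assumes "0 < c0" and "1 \<le> k0" and "\<And>k. k0 \<le> k \<Longrightarrow> weight_seq w k * 2 ^ k \<ge> c0"
  shows "equal_up_to_equivalent_norms X (Lp_space p)"
proof -
  obtain C J0 where C: "0 < C" and CS:
    "\<And>(J::nat set) (E::nat \<Rightarrow> real set). finite J \<Longrightarrow> J \<subseteq> {J0..} \<Longrightarrow> disjoint_family_on E J \<Longrightarrow>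
       (\<And>j. j \<in> J \<Longrightarrow> E j \<in> sets leb01 \<and> measure leb01 (E j) \<le> 2 powr (- (j * p))) \<Longrightarrow>
       nrm X (\<lambda>t. \<Sum>j\<in>J. 2 ^ j * indicator (E j) t) \<le> C * (\<Sum>j\<in>J. 2 powr (j * p) * measure leb01 (E j)) powr (1/p) \<and>
       (\<Sum>j\<in>J. 2 powr (j * p) * measure leb01 (E j)) powr (1/p) \<le> C * nrm X (\<lambda>t. \<Sum>j\<in>J. 2 ^ j * indicator (E j) t)"
    using dyadic_step_nrm_equiv[OF assms] by blast
  define b where "b x j = 2 powr (real j * p) * measure leb01 (dyadic_shell x j)" for x j
  have b_nonneg: "0 \<le> b x j" for x j by (simp add: b_def)
  have small: "measure leb01 (dyadic_shell x j) \<le> 2 powr (- (real j * p))" if "b x j \<le> 1" for x j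
    using that by (simp add: b_def powr_minus field_simps)
  have S_carr: "(dyadic_step J x) \<in> carr X"
    if "x \<in> borel_measurable leb01" for x and J :: "nat set"
    by (intro carr_sum carr_scale carr_indicator dyadic_shell_sets that)
  have CS': "nrm X (dyadic_step J x) \<le> C * (\<Sum>j\<in>J. b x j) powr (1/p)"
    "(\<Sum>j\<in>J. b x j) powr (1/p) \<le> C * nrm X (dyadic_step J x)"
    if "x \<in> borel_measurable leb01" "finite J" "J \<subseteq> {J0..}" "\<And>j. j \<in> J \<Longrightarrow> b x j \<le> 1" for x J
    using CS[OF that(2,3) dyadic_shell_disjoint] small[OF that(4)] dyadic_shell_sets[OF that(1)]
    unfolding b_def by blast+
  \<comment> \<open>The first summand pays for the values below \<open>2 ^ J0\<close>. In the
    second, \<open>2 powr p\<close> is the loss in rounding \<open>x\<close> down to powers of 2 and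
    \<open>C powr p\<close> bounds the sum over the shells.\<close>
  define R where "R = 2 powr (J0 * p) + 2 powr p * C powr p"
  have R: "0 < R" by (simp add: R_def add_pos_nonneg)
  have XL: "integrable leb01 (\<lambda>t. \<bar>x t\<bar> powr p) \<and> (\<integral>t. \<bar>x t\<bar> powr p \<partial>leb01) \<le> R"
    if x: "x \<in> carr X" and x1: "nrm X x \<le> 1" for x
  proof -
    note xm[measurable] = carr_measurable[OF x]
    \<comment> \<open>This is the smallness that \<open>CS'\<close> asks for. A single shell is
      compared with \<open>x\<close> itself, and its norm is read off the fundamental
      function.\<close>
    have b1: "b x j \<le> 1" for j
    proof -
      have "nrm X (\<lambda>t. 2 ^ j * indicator (dyadic_shell x j) t) \<le> nrm X x"
      proof (rule nrm_dominated[OF _ x])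
        show "AE t in leb01. \<bar>2 ^ j * indicator (dyadic_shell x j) t\<bar> \<le> \<bar>x t\<bar>"
          by (intro AE_I2) (auto simp: dyadic_shell_def split: split_indicator)
      qed measurable
      then have "2 ^ j * measure leb01 (dyadic_shell x j) powr (1/p) \<le> 1"
        using x1 by (simp add: nrm_scaled_indicator)
      then have "(2 ^ j * measure leb01 (dyadic_shell x j) powr (1/p)) powr p \<le> 1 powr p"
        using p by (intro powr_mono2) auto
      then show ?thesis using p by (simp add: b_def powr_mult powr_powr flip: powr_realpow)
    qed
    have bsum: "(\<Sum>j\<in>{J0..<n}. b x j) \<le> C powr p" for n
    proof -
      have "(\<Sum>j\<in>{J0..<n}. b x j) powr (1/p) \<le> C * nrm X (dyadic_step {J0..<n} x)"
        by (rule CS'(2)) (auto simp: b1 xm)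
      also have "\<dots> \<le> C * nrm X x"
        using C dyadic_sum_lower[of "{J0..<n}" x]
        by (intro mult_left_mono nrm_dominated[OF _ x] AE_I2 carr_measurable[OF S_carr[OF xm]]) (auto simp: sum_nonneg)
      also have "\<dots> \<le> C * 1" using C x1 by (intro mult_left_mono) auto
      finally have "((\<Sum>j\<in>{J0..<n}. b x j) powr (1/p)) powr p \<le> (C * 1) powr p"
        using p by (intro powr_mono2) auto
      then show ?thesis using p b_nonneg by (simp add: powr_powr sum_nonneg)
    qed
    \<comment> \<open>Integrability of the power of \<open>x\<close> is not yet known, so the bounds
      on truncations pass to the limit by monotone convergence in \<open>ennreal\<close>.\<close>
    define f where "f n t = ennreal (indicator {t\<in>{0..1}. \<bar>x t\<bar> < 2 ^ n} t * \<bar>x t\<bar> powr p)" for n t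
    have [measurable]: "{t\<in>{0..1}. \<bar>x t\<bar> < 2 ^ n} \<in> sets leb01" for n
      by (intro sets_leb01_Collect) measurable
    have fm: "f n \<in> borel_measurable leb01" for n unfolding f_def[abs_def] by measurable
    have inc: "incseq f"
    proof (rule incseq_SucI, rule le_funI)
      fix n t
      have "\<bar>x t\<bar> < 2 ^ n \<Longrightarrow> \<bar>x t\<bar> < 2 ^ Suc n" by (simp add: less_le_trans)
      then show "f n t \<le> f (Suc n) t" unfolding f_def by (intro ennreal_leI) (auto simp: indicator_def)
    qed
    have sup: "(SUP n. f n t) = ennreal (\<bar>x t\<bar> powr p)" if "t \<in> {0..1}" for t
    proof (rule antisym)
      show "(SUP n. f n t) \<le> ennreal (\<bar>x t\<bar> powr p)"
        by (intro SUP_least) (auto simp: f_def indicator_def intro!: ennreal_leI)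
      obtain n where "\<bar>x t\<bar> < 2 ^ n" using real_arch_pow[of 2 "\<bar>x t\<bar>"] by auto
      then have "ennreal (\<bar>x t\<bar> powr p) = f n t" using that by (simp add: f_def)
      then show "ennreal (\<bar>x t\<bar> powr p) \<le> (SUP n. f n t)" by (metis SUP_upper UNIV_I)
    qed
    have fR: "(\<integral>\<^sup>+t. f n t \<partial>leb01) \<le> ennreal R" for n
    proof -
      define h where "h t = 2 powr (J0 * p) + 2 powr p * (\<Sum>j\<in>{J0..<n}. 2 powr (j * p) * indicator (dyadic_shell x j) t)" for t
      have ih: "integrable leb01 h" unfolding h_def[abs_def]
        by (intro Bochner_Integration.integrable_add integrable_mult_right dyadic_step_integral(1)[OF xm]) simp
      have "(\<integral>\<^sup>+t. f n t \<partial>leb01) \<le> (\<integral>\<^sup>+t. ennreal (h t) \<partial>leb01)"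
      proof (rule nn_integral_mono)
        fix t assume "t \<in> space leb01"
        then have "indicator {t\<in>{0..1}. \<bar>x t\<bar> < 2 ^ n} t * \<bar>x t\<bar> powr p \<le> h t"
          using dyadic_sum_powr_upper[of t x n p J0] p unfolding h_def
          by (auto simp: indicator_def sum_nonneg)
        then show "f n t \<le> ennreal (h t)" unfolding f_def by (rule ennreal_leI)
      qed
      also have "\<dots> = ennreal (\<integral>t. h t \<partial>leb01)"
        by (rule nn_integral_eq_integral[OF ih]) (auto simp: h_def sum_nonneg)
      also have "(\<integral>t. h t \<partial>leb01) = 2 powr (J0 * p) + 2 powr p * (\<Sum>j\<in>{J0..<n}. b x j)"
        unfolding h_def[abs_def] b_def
        using dyadic_step_integral[OF xm, of "\<lambda>j. 2 powr (real j * p)" "{J0..<n}"] leb01.prob_space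
        by (subst Bochner_Integration.integral_add) (auto simp del: sum_mult_indicator)
      also have "\<dots> \<le> R" unfolding R_def using bsum by (intro add_left_mono mult_left_mono) auto
      finally show ?thesis by (simp add: ennreal_leI)
    qed
    have "(\<integral>\<^sup>+t. ennreal (\<bar>x t\<bar> powr p) \<partial>leb01) = (\<integral>\<^sup>+t. (SUP n. f n t) \<partial>leb01)"
      by (rule nn_integral_cong) (simp add: sup)
    also have "\<dots> = (SUP n. \<integral>\<^sup>+t. f n t \<partial>leb01)"
      by (rule nn_integral_monotone_convergence_SUP[OF inc fm])
    also have "\<dots> \<le> ennreal R" using fR by (intro SUP_least)
    finally have le: "(\<integral>\<^sup>+t. ennreal (\<bar>x t\<bar> powr p) \<partial>leb01) \<le> ennreal R" .
    have int: "integrable leb01 (\<lambda>t. \<bar>x t\<bar> powr p)"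
      by (rule integrableI_nonneg) (use le in \<open>auto intro: le_less_trans\<close>)
    then show ?thesis using le R by (simp add: nn_integral_eq_integral)
  qed
  \<comment> \<open>The values below \<open>2 ^ J0\<close> cost a constant function; the higher
    shells cost \<open>C\<close>, doubled because \<open>x\<close> is at most twice its dyadic step
    function.\<close>
  define D where "D = 2 ^ J0 * nrm X (\<lambda>t. 1) + 2 * C"
  have D: "0 < D" using C nrm_nonneg[OF carr_one] by (simp add: D_def add_nonneg_pos)
  have LX: "x \<in> carr X \<and> nrm X x \<le> D"
    if xm: "x \<in> borel_measurable leb01" and int: "integrable leb01 (\<lambda>t. \<bar>x t\<bar> powr p)"
      and x1: "(\<integral>t. \<bar>x t\<bar> powr p \<partial>leb01) \<le> 1" for x
  proof -
    note [measurable] = xm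
    have bsum: "(\<Sum>j\<in>J. b x j) \<le> 1" if J: "finite J" for J
    proof -
      have "(\<Sum>j\<in>J. b x j) = (\<integral>t. (\<Sum>j\<in>J. 2 powr (j * p) * indicator (dyadic_shell x j) t) \<partial>leb01)"
        unfolding b_def by (rule dyadic_step_integral(2)[OF xm, symmetric])
      also have "\<dots> \<le> (\<integral>t. \<bar>x t\<bar> powr p \<partial>leb01)"
        using dyadic_sum_powr_lower[OF J, of p x] p
        by (intro integral_mono int dyadic_step_integral(1)[OF xm]) auto
      finally show ?thesis using x1 by simp
    qed
    have b1: "b x j \<le> 1" for j using bsum[of "{j}"] by simp
    have summ: "summable (b x)"
      using bsum b_nonneg by (intro summableI_nonneg_bounded[where x=1]) auto
    \<comment> \<open>Truncating at powers of 2 makes the difference of two truncations live on the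
      shells from \<open>J0 + n\<close> to \<open>J0 + m\<close>, whose contribution is a section of
      a convergent series.\<close>
    define A where "A n = {t\<in>{0..1}. \<bar>x t\<bar> < 2 ^ (J0 + n)}" for n
    have A: "A n \<in> sets leb01" for n unfolding A_def by (intro sets_leb01_Collect) measurable
    have Amono: "incseq A"
    proof (rule incseq_SucI)
      fix n
      show "A n \<subseteq> A (Suc n)" unfolding A_def
        using power_strict_increasing[of "J0 + n" "J0 + Suc n" "2::real"] by force
    qed
    have Aall: "AE t in leb01. \<exists>n. t \<in> A n"
    proof (rule AE_I2)
      fix t assume t: "t \<in> space leb01"
      obtain n where "\<bar>x t\<bar> < 2 ^ n" using real_arch_pow[of 2 "\<bar>x t\<bar>"] by auto
      also have "(2::real) ^ n \<le> 2 ^ (J0 + n)" by (intro power_increasing) auto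
      finally show "\<exists>n. t \<in> A n" using t by (auto simp: A_def)
    qed
    have up: "nrm X (\<lambda>t. 2 * dyadic_step {J0+n..<J0+m} x t)
        \<le> 2 * (C * (\<Sum>j\<in>{J0+n..<J0+m}. b x j) powr (1/p))" for n m
      unfolding nrm_scale[OF S_carr[OF xm]] abs_numeral
      by (rule mult_left_mono, rule CS'(1)[OF xm]) (auto simp: b1)
    have bnd: "(\<lambda>t. indicator (A n) t * x t) \<in> carr X \<and> nrm X (\<lambda>t. indicator (A n) t * x t) \<le> D" for n
    proof -
      define h :: "real \<Rightarrow> real" where "h t = 2 ^ J0 * 1 + 2 * dyadic_step {J0+0..<J0+n} x t" for t :: real
      have h: "h \<in> carr X" unfolding h_def[abs_def]
        by (intro carr_add carr_scale S_carr[OF xm] carr_one)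
      have le: "AE t in leb01. \<bar>indicator (A n) t * x t\<bar> \<le> \<bar>h t\<bar>"
      proof (rule AE_I2)
        fix t assume t: "t \<in> space leb01"
        have s: "0 \<le> dyadic_step {J0+0..<J0+n} x t" by (intro sum_nonneg) auto
        show "\<bar>indicator (A n) t * x t\<bar> \<le> \<bar>h t\<bar>"
        proof (cases "t \<in> A n \<and> 2 ^ J0 \<le> \<bar>x t\<bar>")
          case True
          then have "\<bar>x t\<bar> \<le> 2 * dyadic_step {J0+0..<J0+n} x t"
            by (intro dyadic_sum_upper) (auto simp: A_def)
          also have "\<dots> \<le> h t" unfolding h_def by simp
          finally show ?thesis using True by simp
        next
          case False
          then have "\<bar>indicator (A n) t * x t\<bar> \<le> 2 ^ J0" by (auto simp: indicator_def)
          then show ?thesis using s unfolding h_def by simp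
        qed
      qed
      have m: "(\<lambda>t. indicator (A n) t * x t) \<in> borel_measurable leb01" using A by measurable
      have "nrm X (\<lambda>t. indicator (A n) t * x t) \<le> nrm X h" by (rule nrm_dominated[OF m h le])
      also have "\<dots> \<le> nrm X (\<lambda>t. 2 ^ J0 * 1) + nrm X (\<lambda>t. 2 * dyadic_step {J0+0..<J0+n} x t)"
        unfolding h_def[abs_def] by (intro nrm_add carr_scale S_carr[OF xm] carr_one)
      also have "nrm X (\<lambda>t. 2 ^ J0 * 1) = 2 ^ J0 * nrm X (\<lambda>t. 1)" by (subst nrm_scale[OF carr_one]) simp
      also have "nrm X (\<lambda>t. 2 * dyadic_step {J0+0..<J0+n} x t)
          \<le> 2 * (C * (\<Sum>j\<in>{J0+0..<J0+n}. b x j) powr (1/p))" by (rule up)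
      also have "\<dots> \<le> 2 * (C * 1 powr (1/p))"
        using C bsum p b_nonneg by (intro mult_left_mono powr_mono2) (auto simp: sum_nonneg)
      finally show ?thesis using carr_dominated[OF m h le] by (simp add: D_def)
    qed
    have diff: "nrm X (\<lambda>t. indicator (A m) t * x t - indicator (A n) t * x t)
       \<le> 2 * (C * (\<Sum>j\<in>{J0+n..<J0+m}. b x j) powr (1/p))" if "n \<le> m" for m n
    proof (rule order_trans[OF nrm_dominated up])
      show "(\<lambda>t. indicator (A m) t * x t - indicator (A n) t * x t) \<in> borel_measurable leb01" using A by measurable
      show "(\<lambda>t. 2 * dyadic_step {J0+n..<J0+m} x t) \<in> carr X"
        by (intro carr_scale S_carr[OF xm])
      show "AE t in leb01. \<bar>indicator (A m) t * x t - indicator (A n) t * x t\<bar>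
          \<le> \<bar>2 * dyadic_step {J0+n..<J0+m} x t\<bar>"
      proof (rule AE_I2)
        fix t assume t: "t \<in> space leb01"
        show "\<bar>indicator (A m) t * x t - indicator (A n) t * x t\<bar>
          \<le> \<bar>2 * dyadic_step {J0+n..<J0+m} x t\<bar>"
        proof (cases "t \<in> A m \<and> t \<notin> A n")
          case True
          then have "\<bar>x t\<bar> \<le> 2 * dyadic_step {J0+n..<J0+m} x t"
            by (intro dyadic_sum_upper) (auto simp: A_def)
          then show ?thesis using True by simp
        next
          case False
          then have "t \<in> A m \<longleftrightarrow> t \<in> A n" using incseqD[OF Amono that] by auto
          then have "\<bar>indicator (A m) t * x t - indicator (A n) t * x t\<bar> = 0" by (simp add: indicator_def)
          then show ?thesis by linarith
        qed
      qed
    qed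
    have Cau: "\<exists>N. \<forall>m\<ge>N. \<forall>n\<ge>N. nrm X (\<lambda>t. indicator (A m) t * x t - indicator (A n) t * x t) < e"
      if e: "0 < e" for e
    proof -
      \<comment> \<open>Solves \<open>2 * C * r powr (1 / p) = e\<close>.\<close>
      define r where "r = (e / (2 * C)) powr p"
      have r: "0 < r" using e C by (simp add: r_def)
      obtain N where N: "\<And>m n. m \<ge> N \<Longrightarrow> norm (sum (b x) {m..<n}) < r"
        using summ r unfolding summable_Cauchy by blast
      have lt: "nrm X (\<lambda>t. indicator (A m) t * x t - indicator (A n) t * x t) < e" if "N \<le> n" "n \<le> m" for m n
      proof -
        have "(\<Sum>j\<in>{J0+n..<J0+m}. b x j) < r" using N[of "J0+n" "J0+m"] that by simp
        then have "(\<Sum>j\<in>{J0+n..<J0+m}. b x j) powr (1/p) < r powr (1/p)"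
          using p b_nonneg by (intro powr_less_mono2) (auto simp: sum_nonneg)
        also have "r powr (1/p) = e / (2 * C)" using p e C by (simp add: r_def powr_powr)
        finally have "2 * (C * (\<Sum>j\<in>{J0+n..<J0+m}. b x j) powr (1/p)) < e" using C by (simp add: field_simps)
        then show ?thesis using diff[OF that(2)] by simp
      qed
      show ?thesis
      proof (intro exI[of _ N] allI impI)
        fix m n assume "N \<le> m" "N \<le> n"
        then show "nrm X (\<lambda>t. indicator (A m) t * x t - indicator (A n) t * x t) < e"
          using lt[of n m] lt[of m n] nrm_minus_commute[of "\<lambda>t. indicator (A m) t * x t" "\<lambda>t. indicator (A n) t * x t"] bnd
          by (cases "n \<le> m") auto
      qed
    qed
    show ?thesis
      using truncations_Cauchy[OF xm A Amono Aall _ Cau, of D] bnd by blast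
  qed
  define Lp where "Lp x = (\<integral>t. \<bar>x t\<bar> powr p \<partial>leb01) powr (1/p)" for x
  have scale_int: "(\<integral>t. \<bar>a * x t\<bar> powr p \<partial>leb01) = \<bar>a\<bar> powr p * (\<integral>t. \<bar>x t\<bar> powr p \<partial>leb01)" for a x
    by (simp add: abs_mult powr_mult)
  have XL': "integrable leb01 (\<lambda>t. \<bar>x t\<bar> powr p) \<and> Lp x \<le> R powr (1/p) * nrm X x" if x: "x \<in> carr X" for x
  proof (cases "nrm X x = 0")
    case True
    then have ae: "AE t in leb01. x t = 0" using nrm_eq_0_iff[OF x] by simp
    have m[measurable]: "x \<in> borel_measurable leb01" by (rule carr_measurable[OF x])
    have ae': "AE t in leb01. \<bar>x t\<bar> powr p = 0" using ae by eventually_elim simp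
    have "integrable leb01 (\<lambda>t. \<bar>x t\<bar> powr p) \<longleftrightarrow> integrable leb01 (\<lambda>t. 0::real)"
      by (rule integrable_cong_AE) (use ae' in auto)
    moreover have "(\<integral>t. \<bar>x t\<bar> powr p \<partial>leb01) = 0" using ae' by (rule integral_eq_zero_AE)
    ultimately show ?thesis using True by (simp add: Lp_def)
  next
    case False
    define a where "a = 1 / nrm X x"
    have a: "0 < a" using False nrm_nonneg[OF x] by (simp add: a_def)
    have ax: "(\<lambda>t. a * x t) \<in> carr X" "nrm X (\<lambda>t. a * x t) \<le> 1"
      using x a False by (auto simp: carr_scale nrm_scale) (simp add: a_def)
    have 1: "integrable leb01 (\<lambda>t. a powr p * \<bar>x t\<bar> powr p)" "a powr p * (\<integral>t. \<bar>x t\<bar> powr p \<partial>leb01) \<le> R"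
      using XL[OF ax] a by (auto simp: abs_mult powr_mult)
    have "(a powr p * (\<integral>t. \<bar>x t\<bar> powr p \<partial>leb01)) powr (1/p) \<le> R powr (1/p)"
      using 1(2) p by (intro powr_mono2) auto
    then have "a * Lp x \<le> R powr (1/p)"
      using p a by (simp add: powr_mult powr_powr Lp_def)
    then have "Lp x \<le> R powr (1/p) * nrm X x" using a by (simp add: a_def field_simps split: if_splits)
    moreover have "integrable leb01 (\<lambda>t. \<bar>x t\<bar> powr p)" using 1(1) a by simp
    ultimately show ?thesis by simp
  qed
  have LX': "x \<in> carr X \<and> nrm X x \<le> D * Lp x"
    if xm: "x \<in> borel_measurable leb01" and int: "integrable leb01 (\<lambda>t. \<bar>x t\<bar> powr p)" for x
  proof (cases "(\<integral>t. \<bar>x t\<bar> powr p \<partial>leb01) = 0")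
    case True
    note [measurable] = xm
    have "AE t in leb01. \<bar>x t\<bar> powr p = 0"
      using True integral_nonneg_eq_0_iff_AE[OF int] by simp
    then have ae: "AE t in leb01. x t = 0" by eventually_elim simp
    then show ?thesis using carr_AE_cong[OF carr_zero xm] nrm_AE_cong[OF carr_zero xm] nrm_zero by (simp add: Lp_def True)
  next
    case False
    have Lpos: "0 < Lp x" using False unfolding Lp_def by simp
    define a where "a = 1 / Lp x"
    have a: "0 < a" using Lpos by (simp add: a_def)
    have "Lp x powr p = (\<integral>t. \<bar>x t\<bar> powr p \<partial>leb01)" using p by (simp add: Lp_def powr_powr)
    then have "(\<integral>t. \<bar>a * x t\<bar> powr p \<partial>leb01) \<le> 1"
      unfolding scale_int using Lpos by (simp add: a_def powr_divide False)
    moreover have "integrable leb01 (\<lambda>t. \<bar>a * x t\<bar> powr p)" using int by (simp add: abs_mult powr_mult)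
    ultimately have ax: "(\<lambda>t. a * x t) \<in> carr X" "nrm X (\<lambda>t. a * x t) \<le> D"
      using LX[of "\<lambda>t. a * x t"] xm by auto
    have "(\<lambda>t. Lp x * (a * x t)) \<in> carr X" by (rule carr_scale[OF ax(1)])
    then have x: "x \<in> carr X" using Lpos by (simp add: a_def)
    have "a * nrm X x \<le> D" using ax(2) a by (simp add: nrm_scale[OF x])
    then show ?thesis using x Lpos by (simp add: a_def field_simps)
  qed
  show ?thesis unfolding equal_up_to_equivalent_norms_def
  proof (intro conjI exI[of _ "max D (R powr (1/p))"] ballI)
    show "carr X = carr (Lp_space p)"
    proof (intro equalityI subsetI)
      fix x assume "x \<in> carr X"
      then show "x \<in> carr (Lp_space p)" using XL'[of x] carr_measurable[of x] by (simp add: Lp_space_def)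
    next
      fix x assume "x \<in> carr (Lp_space p)"
      then show "x \<in> carr X" using LX'[of x] by (simp add: Lp_space_def)
    qed
    show "0 < max D (R powr (1/p))" using D by simp
    fix x assume x: "x \<in> carr X"
    have nL: "nrm (Lp_space p) x = Lp x" by (simp add: Lp_space_def Lp_def)
    have L0: "0 \<le> Lp x" by (simp add: Lp_def)
    have "nrm X x \<le> D * Lp x" using LX'[OF carr_measurable[OF x]] XL'[OF x] by blast
    also have "\<dots> \<le> max D (R powr (1/p)) * Lp x" using L0 by (intro mult_right_mono) auto
    finally show "nrm X x \<le> max D (R powr (1/p)) * nrm (Lp_space p) x" by (simp add: nL)
    have "Lp x \<le> R powr (1/p) * nrm X x" using XL'[OF x] by simp
    also have "\<dots> \<le> max D (R powr (1/p)) * nrm X x" using nrm_nonneg[OF x] by (intro mult_right_mono) auto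
    finally show "nrm (Lp_space p) x \<le> max D (R powr (1/p)) * nrm X x" by (simp add: nL)
  qed
qed

end

section \<open>Decomposable spaces\<close>

context weighted_symmetric_space
begin

text \<open>The cover may overlap, so the parts need not add up to \<open>x\<close>; their absolute
  values still dominate it.\<close>

lemma nrm_le_sum_cover:
  assumes "finite I" and x: "x \<in> supported F" and F: "F \<subseteq> (\<Union>i\<in>I. G i)"
  shows "nrm X x \<le> (\<Sum>i\<in>I. nrm X (restr (G i) x))"
proof -
  have xc: "x \<in> carr X" using x by (rule supported_carr)
  note rc = supported_carr[OF restr_supported[OF xc]]
  have abs: "(\<lambda>t. \<bar>restr (G i) x t\<bar>) \<in> carr X" "nrm X (\<lambda>t. \<bar>restr (G i) x t\<bar>) \<le> nrm X (restr (G i) x)" for i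
    using carr_measurable[OF rc[of "G i"]] by (intro carr_dominated[OF _ rc] nrm_dominated[OF _ rc]; auto)+
  have "nrm X x \<le> nrm X (\<lambda>t. \<Sum>i\<in>I. \<bar>restr (G i) x t\<bar>)"
  proof (rule nrm_dominated[OF carr_measurable[OF xc] carr_sum[OF abs(1)]], rule AE_I2)
    fix t
    show "\<bar>x t\<bar> \<le> \<bar>\<Sum>i\<in>I. \<bar>restr (G i) x t\<bar>\<bar>"
    proof (cases "t \<in> (\<Union>k\<in>F. lev k)")
      case True
      then obtain i k where i: "i \<in> I" "k \<in> G i" "t \<in> lev k" using F by blast
      then have "\<bar>x t\<bar> = \<bar>restr (G i) x t\<bar>" by (auto simp: restr_def indicator_def)
      also have "\<dots> \<le> (\<Sum>i\<in>I. \<bar>restr (G i) x t\<bar>)"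
        by (rule member_le_sum[OF i(1)]) (auto simp: assms(1))
      finally show ?thesis by linarith
    next
      case False
      then have "x t = 0" using x by (simp add: supported_def)
      then show ?thesis by simp
    qed
  qed
  also have "\<dots> \<le> (\<Sum>i\<in>I. nrm X (\<lambda>t. \<bar>restr (G i) x t\<bar>))"
    by (rule nrm_sum) (rule abs)
  also have "\<dots> \<le> (\<Sum>i\<in>I. nrm X (restr (G i) x))"
    by (intro sum_mono abs)
  finally show ?thesis .
qed

lemma ess_sup_level:
  assumes "A \<subseteq> lev k"
  shows "ess_sup_on A w \<le> ereal (2 powi (k + 1))"
  unfolding ess_sup_on_def
proof (rule esssup_I)
  have "w \<in> borel_measurable (lebesgue_on A)"
    by (rule measurable_restrict_mono[OF w_measurable]) (use assms lev_subset[of k] in blast)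
  then show "(\<lambda>t. ereal (w t)) \<in> borel_measurable (lebesgue_on A)" by measurable
  show "AE t in lebesgue_on A. ereal (w t) \<le> ereal (2 powi (k + 1))"
    using assms by (intro AE_I2) (auto simp: level_set_def)
qed

lemma ess_inf_level:
  assumes "A \<subseteq> lev k"
  shows "ereal (2 powi k) \<le> ess_inf_on A w"
proof -
  have "esssup (lebesgue_on A) (\<lambda>t. - ereal (w t)) \<le> - ereal (2 powi k)"
  proof (rule esssup_I)
    have "w \<in> borel_measurable (lebesgue_on A)"
      by (rule measurable_restrict_mono[OF w_measurable]) (use assms lev_subset[of k] in blast)
    then show "(\<lambda>t. - ereal (w t)) \<in> borel_measurable (lebesgue_on A)" by measurable
    show "AE t in lebesgue_on A. - ereal (w t) \<le> - ereal (2 powi k)"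
      using assms by (intro AE_I2) (auto simp: level_set_def)
  qed
  then show ?thesis unfolding ess_inf_on_def by (metis ereal_minus_le_minus ereal_uminus_uminus)
qed

lemma fsupp_proj: "fsupp (proj k x) \<subseteq> lev k"
  by (auto simp: fsupp_def proj_apply split: if_splits)

text \<open>Neighbouring levels touch and lack the gap by a factor 2 that decomposability demands,
  but levels whose indices differ by at least 2 have it. Each parity class therefore qualifies, and
  the two classes account for the constant \<open>2 * C\<close>.\<close>

lemma decomposable_imp_level_decomposable:
  assumes "decomposable w X"
  shows level_decomposable
proof -
  obtain C where C: "C > 0" and dec: "\<forall>n\<ge>1. \<forall>x y :: nat \<Rightarrow> real \<Rightarrow> real.
        (\<forall>i\<in>{1..n}. x i \<in> carr X \<and> y i \<in> carr X \<and>
           \<not> ae_eq (x i) (\<lambda>t. 0) \<and> \<not> ae_eq (y i) (\<lambda>t. 0) \<and> nrm X (x i) = nrm X (y i)) \<and>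
        (\<forall>i\<in>{1..<n}. ess_inf_on (fsupp (x i) \<union> fsupp (y i)) w
           \<ge> 2 * ess_sup_on (fsupp (x (i + 1)) \<union> fsupp (y (i + 1))) w) \<longrightarrow>
        inverse C * nrm X (\<lambda>t. \<Sum>i=1..n. x i t) \<le> nrm X (\<lambda>t. \<Sum>i=1..n. y i t) \<and>
        nrm X (\<lambda>t. \<Sum>i=1..n. y i t) \<le> C * nrm X (\<lambda>t. \<Sum>i=1..n. x i t)"
    using assms[unfolded decomposable_def] by (elim exE conjE) (rule that)
  have par: "nrm X y \<le> C * nrm X x"
    if F: "finite F" and r: "\<And>k. k \<in> F \<Longrightarrow> k mod 2 = r" and x: "x \<in> supported F" and y: "y \<in> supported F"
      and eq: "\<And>k. k \<in> F \<Longrightarrow> nrm X (proj k y) = nrm X (proj k x) \<and> nrm X (proj k x) \<noteq> 0" for F r x y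
  proof (cases "F = {}")
    case True
    then have "x = (\<lambda>t. 0)" "y = (\<lambda>t. 0)" using x y by (auto simp: supported_def)
    then show ?thesis by (simp add: nrm_zero)
  next
    case False
    define xs where "xs = sorted_list_of_set F"
    define n where "n = length xs"
    \<comment> \<open>Decomposability counts from 1 and lists the blocks by decreasing weight, so
      the increasing list of levels is read backwards.\<close>
    define k where "k i = xs ! (n - i)" for i
    have xs: "set xs = F" "sorted_wrt (<) xs" "distinct xs" using F by (auto simp: xs_def)
    have n: "1 \<le> n" using False xs(1) by (cases xs) (auto simp: n_def)
    have "bij_betw ((!) xs) {..<n} F" using bij_betw_nth[OF xs(3)] xs(1) by (simp add: n_def)
    moreover have "bij_betw (\<lambda>i. n - i) {1..n} {..<n}"
      by (rule bij_betw_byWitness[where f'="\<lambda>i. n - i"]) auto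
    ultimately have bij: "bij_betw k {1..n} F"
      unfolding k_def[abs_def] using bij_betw_trans[of "\<lambda>i. n - i" "{1..n}" "{..<n}" "(!) xs" F] by (simp add: comp_def)
    have kF: "k i \<in> F" if "i \<in> {1..n}" for i using bij that by (auto simp: bij_betw_def)
    have sep: "k (i + 1) + 2 \<le> k i" if i: "i \<in> {1..<n}" for i
    proof -
      have "k (i + 1) < k i" unfolding k_def
        by (rule sorted_wrt_nth_less[OF xs(2)]) (use i in \<open>auto simp: n_def\<close>)
      moreover have "k (i + 1) mod 2 = k i mod 2" using r kF[of i] kF[of "i + 1"] i by auto
      ultimately show ?thesis by presburger
    qed
    have sum: "(\<Sum>i=1..n. proj (k i) z t) = z t" if "z \<in> supported F" for z t
      using sum.reindex_bij_betw[OF bij, of "\<lambda>k. proj k z t"] sum_proj[OF F that] by simp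
    have "nrm X (\<lambda>t. \<Sum>i=1..n. proj (k i) y t) \<le> C * nrm X (\<lambda>t. \<Sum>i=1..n. proj (k i) x t)"
    proof (rule dec[THEN spec, THEN mp, OF n, THEN spec[where x="\<lambda>i. proj (k i) x"],
        THEN spec[where x="\<lambda>i. proj (k i) y"], THEN mp, THEN conjunct2], rule conjI; intro ballI)
      fix i assume i: "i \<in> {1..n}"
      have c: "proj (k i) x \<in> carr X" "proj (k i) y \<in> carr X"
        using x y by (auto intro: carr_proj supported_carr)
      then show "proj (k i) x \<in> carr X \<and> proj (k i) y \<in> carr X \<and> \<not> ae_eq (proj (k i) x) (\<lambda>t. 0) \<and>
         \<not> ae_eq (proj (k i) y) (\<lambda>t. 0) \<and> nrm X (proj (k i) x) = nrm X (proj (k i) y)"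
        using eq[OF kF[OF i]] nrm_eq_0_iff[OF c(1)] nrm_eq_0_iff[OF c(2)] by (simp add: ae_eq_def)
    next
      fix i assume i: "i \<in> {1..<n}"
      have sub: "fsupp (proj (k j) x) \<union> fsupp (proj (k j) y) \<subseteq> lev (k j)" for j
        using fsupp_proj by auto
      have "2 * ess_sup_on (fsupp (proj (k (i + 1)) x) \<union> fsupp (proj (k (i + 1)) y)) w \<le> 2 * ereal (2 powi (k (i + 1) + 1))"
        by (intro ereal_mult_left_mono ess_sup_level sub) auto
      also have "\<dots> = ereal (2 powi (k (i + 1) + 2))"
        by (simp add: power_int_add)
      also have "\<dots> \<le> ereal (2 powi k i)" using sep[OF i] by (auto intro: power_int_increasing)
      also have "\<dots> \<le> ess_inf_on (fsupp (proj (k i) x) \<union> fsupp (proj (k i) y)) w"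
        by (intro ess_inf_level sub)
      finally show "2 * ess_sup_on (fsupp (proj (k (i + 1)) x) \<union> fsupp (proj (k (i + 1)) y)) w
         \<le> ess_inf_on (fsupp (proj (k i) x) \<union> fsupp (proj (k i) y)) w" .
    qed
    then show ?thesis using sum[OF x] sum[OF y] by simp
  qed
  show ?thesis unfolding level_decomposable_def
  proof (intro exI[of _ "2 * C"] conjI allI impI)
    show "0 < 2 * C" using C by simp
    fix F x y
    assume F: "finite F" and x: "x \<in> supported F" and y: "y \<in> supported F"
      and eq: "\<forall>k\<in>F. nrm X (proj k y) = nrm X (proj k x)"
    \<comment> \<open>Class 2 collects the levels where \<open>x\<close>, and with it
      \<open>y\<close>, vanishes almost everywhere, since decomposability speaks of nonzero blocks
      only. Classes 0 and 1 are the parities.\<close>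
    define G :: "int \<Rightarrow> int set" where
      "G i = (if i = 2 then {k\<in>F. nrm X (proj k x) = 0} else {k\<in>F. nrm X (proj k x) \<noteq> 0 \<and> k mod 2 = i})" for i
    have GF: "G i \<subseteq> F" for i by (auto simp: G_def)
    have xc: "x \<in> carr X" and yc: "y \<in> carr X" using x y by (auto intro: supported_carr)
    have cov: "F \<subseteq> (\<Union>i\<in>{0,1,2}. G i)" by (auto simp: G_def)
    have part: "nrm X (restr (G i) y) \<le> C * nrm X x" if "i \<in> {0,1}" for i
    proof -
      have "nrm X (restr (G i) y) \<le> C * nrm X (restr (G i) x)"
      proof (rule par[of "G i" i])
        show "finite (G i)" using F GF finite_subset by blast
        show "k mod 2 = i" if "k \<in> G i" for k using that \<open>i \<in> {0,1}\<close> by (auto simp: G_def)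
        show "restr (G i) x \<in> supported (G i)" "restr (G i) y \<in> supported (G i)"
          using xc yc by (auto intro: restr_supported)
        show "nrm X (proj k (restr (G i) y)) = nrm X (proj k (restr (G i) x)) \<and> nrm X (proj k (restr (G i) x)) \<noteq> 0"
          if "k \<in> G i" for k
          unfolding proj_restr[OF that] using eq that \<open>i \<in> {0,1}\<close> by (auto simp: G_def)
      qed
      also have "\<dots> \<le> C * nrm X x" using C nrm_restr[OF xc] by (intro mult_left_mono) auto
      finally show ?thesis .
    qed
    have "nrm X (restr (G 2) y) \<le> (\<Sum>k\<in>G 2. nrm X (proj k (restr (G 2) y)))"
      using F GF finite_subset by (intro nrm_le_sum_proj restr_supported yc) blast
    also have "\<dots> = 0"
    proof (rule sum.neutral, intro ballI)
      fix k assume k: "k \<in> G 2"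
      show "nrm X (proj k (restr (G 2) y)) = 0"
        unfolding proj_restr[OF k] using eq k by (auto simp: G_def)
    qed
    finally have Z: "nrm X (restr (G 2) y) \<le> 0" .
    have "nrm X y \<le> (\<Sum>i\<in>{0,1,2}. nrm X (restr (G i) y))"
      by (rule nrm_le_sum_cover[OF _ y cov]) simp
    also have "\<dots> \<le> 2 * C * nrm X x"
      using part[of 0] part[of 1] Z by simp
    finally show "nrm X y \<le> 2 * C * nrm X x" .
  qed
qed

end

section \<open>The sum of the couple and its operators\<close>

context weighted_symmetric_space
begin

abbreviation Xw :: fun_space where "Xw \<equiv> weighted_space X w"

abbreviation XS :: "(real \<Rightarrow> real) set" where "XS \<equiv> sum_carr X Xw"

text \<open>Equivalent to the usual norm of the sum: the K-functional at 1 lies between this norm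
  and twice it.\<close>

definition snrm :: "(real \<Rightarrow> real) \<Rightarrow> real" where
  "snrm z = nrm X (\<lambda>t. min 1 (w t) * z t)"

lemma Xw_iff: "x \<in> carr Xw \<longleftrightarrow> x \<in> borel_measurable leb01 \<and> (\<lambda>t. w t * x t) \<in> carr X"
  by (simp add: weighted_space_def mult.commute)

lemma nrm_Xw: "nrm Xw x = nrm X (\<lambda>t. w t * x t)"
  by (simp add: weighted_space_def mult.commute)

lemma nrm_Xw_nonneg: "x \<in> carr Xw \<Longrightarrow> 0 \<le> nrm Xw x"
  by (simp add: Xw_iff nrm_Xw nrm_nonneg)

lemma XS_measurable: "z \<in> XS \<Longrightarrow> z \<in> borel_measurable leb01"
  by (simp add: sum_carr_def)

text \<open>Cutting at \<open>{w \<ge> 1}\<close> identifies the sum \<open>X + X(w)\<close> with the weighted space \<open>X(min 1 w)\<close>.\<close>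

lemma XS_split:
  assumes z: "z \<in> borel_measurable leb01" "(\<lambda>t. min 1 (w t) * z t) \<in> carr X"
  defines "z0 \<equiv> \<lambda>t. (if w t \<ge> 1 then z t else 0)" and "z1 \<equiv> \<lambda>t. (if w t \<ge> 1 then 0 else z t)"
  shows "z0 \<in> carr X" "z1 \<in> carr Xw" "nrm X z0 \<le> snrm z" "nrm Xw z1 \<le> snrm z" "z = (\<lambda>t. z0 t + z1 t)"
proof -
  note [measurable] = z(1)
  have m: "z0 \<in> borel_measurable leb01" "(\<lambda>t. w t * z1 t) \<in> borel_measurable leb01" "z1 \<in> borel_measurable leb01"
    unfolding z0_def z1_def by measurable
  have 0: "AE t in leb01. \<bar>z0 t\<bar> \<le> \<bar>min 1 (w t) * z t\<bar>"
    by (intro AE_I2) (auto simp: z0_def)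
  have 1: "AE t in leb01. \<bar>w t * z1 t\<bar> \<le> \<bar>min 1 (w t) * z t\<bar>"
    by (intro AE_I2) (auto simp: z1_def)
  show "z0 \<in> carr X" by (rule carr_dominated[OF m(1) z(2) 0])
  show "nrm X z0 \<le> snrm z" unfolding snrm_def by (rule nrm_dominated[OF m(1) z(2) 0])
  show "z1 \<in> carr Xw" unfolding Xw_iff using carr_dominated[OF m(2) z(2) 1] m(3) by simp
  show "nrm Xw z1 \<le> snrm z" unfolding snrm_def nrm_Xw by (rule nrm_dominated[OF m(2) z(2) 1])
  show "z = (\<lambda>t. z0 t + z1 t)" by (auto simp: z0_def z1_def)
qed

text \<open>The multiplier \<open>min 1 (s * w t)\<close> is at most 1, which handles
  \<open>x0\<close>, and at most \<open>s * w t\<close>, which handles \<open>x1\<close>. This is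
  the lower estimate of the K-functional.\<close>

lemma min_weight_mult:
  assumes x0: "x0 \<in> carr X" and x1: "x1 \<in> carr Xw" and z: "z \<in> borel_measurable leb01"
    and eq: "AE t in leb01. z t = x0 t + x1 t" and s: "0 < s"
  shows "(\<lambda>t. min 1 (s * w t) * z t) \<in> carr X"
    and "nrm X (\<lambda>t. min 1 (s * w t) * z t) \<le> nrm X x0 + s * nrm Xw x1"
proof -
  have x1': "(\<lambda>t. w t * x1 t) \<in> carr X" using x1 by (simp add: Xw_iff)
  note [measurable] = z carr_measurable[OF x0] carr_measurable[OF x1']
  define g where "g t = \<bar>x0 t\<bar> + s * \<bar>w t * x1 t\<bar>" for t
  have a0: "(\<lambda>t. \<bar>x0 t\<bar>) \<in> carr X" "nrm X (\<lambda>t. \<bar>x0 t\<bar>) \<le> nrm X x0"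
    by (intro carr_dominated[OF _ x0] nrm_dominated[OF _ x0]; auto)+
  have a1: "(\<lambda>t. \<bar>w t * x1 t\<bar>) \<in> carr X" "nrm X (\<lambda>t. \<bar>w t * x1 t\<bar>) \<le> nrm Xw x1"
    unfolding nrm_Xw by (intro carr_dominated[OF _ x1'] nrm_dominated[OF _ x1']; simp)+
  have g: "g \<in> carr X" unfolding g_def[abs_def] by (intro carr_add carr_scale a0 a1)
  have le: "AE t in leb01. \<bar>min 1 (s * w t) * z t\<bar> \<le> \<bar>g t\<bar>"
    using eq w_pos
  proof eventually_elim
    case (elim t)
    have p: "0 \<le> min 1 (s * w t)" "min 1 (s * w t) \<le> 1" "min 1 (s * w t) \<le> s * w t" using s elim by auto
    have "\<bar>min 1 (s * w t) * z t\<bar> \<le> min 1 (s * w t) * (\<bar>x0 t\<bar> + \<bar>x1 t\<bar>)"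
      unfolding abs_mult abs_of_nonneg[OF p(1)] elim(1) by (intro mult_left_mono p abs_triangle_ineq)
    also have "\<dots> = min 1 (s * w t) * \<bar>x0 t\<bar> + min 1 (s * w t) * \<bar>x1 t\<bar>" by (rule distrib_left)
    also have "\<dots> \<le> 1 * \<bar>x0 t\<bar> + s * w t * \<bar>x1 t\<bar>" by (intro add_mono mult_right_mono p) auto
    also have "\<dots> = g t" using elim(2) by (simp add: g_def abs_mult)
    finally show ?case by linarith
  qed
  have m: "(\<lambda>t. min 1 (s * w t) * z t) \<in> borel_measurable leb01" by measurable
  show "(\<lambda>t. min 1 (s * w t) * z t) \<in> carr X" by (rule carr_dominated[OF m g le])
  have "nrm X (\<lambda>t. min 1 (s * w t) * z t) \<le> nrm X g" by (rule nrm_dominated[OF m g le])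
  also have "\<dots> \<le> nrm X (\<lambda>t. \<bar>x0 t\<bar>) + nrm X (\<lambda>t. s * \<bar>w t * x1 t\<bar>)"
    unfolding g_def[abs_def] by (intro nrm_add carr_scale a0 a1)
  also have "nrm X (\<lambda>t. s * \<bar>w t * x1 t\<bar>) = s * nrm X (\<lambda>t. \<bar>w t * x1 t\<bar>)"
    using nrm_scale[OF a1(1), of s] s by simp
  also have "nrm X (\<lambda>t. \<bar>x0 t\<bar>) + s * nrm X (\<lambda>t. \<bar>w t * x1 t\<bar>) \<le> nrm X x0 + s * nrm Xw x1"
    using s by (intro add_mono mult_left_mono a0 a1) auto
  finally show "nrm X (\<lambda>t. min 1 (s * w t) * z t) \<le> nrm X x0 + s * nrm Xw x1" .
qed

lemma XS_iff: "z \<in> XS \<longleftrightarrow> z \<in> borel_measurable leb01 \<and> (\<lambda>t. min 1 (w t) * z t) \<in> carr X"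
proof
  assume "z \<in> XS"
  then show "z \<in> borel_measurable leb01 \<and> (\<lambda>t. min 1 (w t) * z t) \<in> carr X"
    using min_weight_mult(1)[of _ _ z 1] by (auto simp: sum_carr_def ae_eq_def)
next
  assume z: "z \<in> borel_measurable leb01 \<and> (\<lambda>t. min 1 (w t) * z t) \<in> carr X"
  note s = XS_split[of z]
  have "ae_eq z (\<lambda>t. (if w t \<ge> 1 then z t else 0) + (if w t \<ge> 1 then 0 else z t))"
    by (simp add: ae_eq_def)
  moreover have "(\<lambda>t. if w t \<ge> 1 then z t else 0) \<in> carr X" "(\<lambda>t. if w t \<ge> 1 then 0 else z t) \<in> carr Xw"
    using s(1,2) z by auto
  ultimately show "z \<in> XS" unfolding sum_carr_def using z by fastforce
qed

lemma K_le:
  assumes "0 < s" "x0 \<in> carr X" "x1 \<in> carr Xw" "AE t in leb01. z t = x0 t + x1 t"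
  shows "K_functional s z X Xw \<le> nrm X x0 + s * nrm Xw x1"
  unfolding K_functional_def
  by (rule cInf_lower) (use assms in \<open>auto simp: ae_eq_def nrm_nonneg nrm_Xw_nonneg intro!: bdd_belowI[of _ 0]\<close>)

lemma K_ge:
  assumes "0 < s" "z \<in> XS"
  shows "nrm X (\<lambda>t. min 1 (s * w t) * z t) \<le> K_functional s z X Xw"
  unfolding K_functional_def
proof (rule cInf_greatest)
  show "{nrm X x0 + s * nrm Xw x1 | x0 x1. x0 \<in> carr X \<and> x1 \<in> carr Xw \<and> ae_eq z (\<lambda>t. x0 t + x1 t)} \<noteq> {}"
    using assms(2) by (auto simp: sum_carr_def)
  fix r assume "r \<in> {nrm X x0 + s * nrm Xw x1 | x0 x1. x0 \<in> carr X \<and> x1 \<in> carr Xw \<and> ae_eq z (\<lambda>t. x0 t + x1 t)}"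
  then show "nrm X (\<lambda>t. min 1 (s * w t) * z t) \<le> r"
    using min_weight_mult(2)[OF _ _ XS_measurable[OF assms(2)] _ assms(1)] by (auto simp: ae_eq_def)
qed

lemma min_weight_bound: "AE t in leb01. \<bar>min 1 (w t)\<bar> \<le> 1"
  using w_pos by eventually_elim auto

lemma XS_X: "x \<in> carr X \<Longrightarrow> x \<in> XS"
  unfolding XS_iff using carr_bounded_mult[OF _ _ min_weight_bound, of x] carr_measurable by auto

lemma XS_Xw: "x \<in> carr Xw \<Longrightarrow> x \<in> XS"
  unfolding XS_iff using min_weight_mult(1)[OF carr_zero, of x x 1] by (auto simp: Xw_iff)

lemma XS_add: "y \<in> XS \<Longrightarrow> z \<in> XS \<Longrightarrow> (\<lambda>t. y t + z t) \<in> XS"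
  unfolding XS_iff using carr_add[of "\<lambda>t. min 1 (w t) * y t" "\<lambda>t. min 1 (w t) * z t"]
  by (auto simp: distrib_left)

lemma XS_scale: "z \<in> XS \<Longrightarrow> (\<lambda>t. a * z t) \<in> XS"
  unfolding XS_iff using carr_scale[of "\<lambda>t. min 1 (w t) * z t" a]
  by (auto simp: mult.left_commute)

lemma XS_zero: "(\<lambda>t. 0) \<in> XS"
  by (intro XS_X carr_zero)

lemma XS_sum: "(\<And>i. i \<in> I \<Longrightarrow> z i \<in> XS) \<Longrightarrow> (\<lambda>t. \<Sum>i\<in>I. z i t) \<in> XS"
  by (induction I rule: infinite_finite_induct) (auto simp: XS_zero intro: XS_add)

lemma snrm_add: "y \<in> XS \<Longrightarrow> z \<in> XS \<Longrightarrow> snrm (\<lambda>t. y t + z t) \<le> snrm y + snrm z"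
  unfolding XS_iff snrm_def using nrm_add[of "\<lambda>t. min 1 (w t) * y t" "\<lambda>t. min 1 (w t) * z t"]
  by (auto simp: distrib_left)

lemma snrm_scale: "z \<in> XS \<Longrightarrow> snrm (\<lambda>t. a * z t) = \<bar>a\<bar> * snrm z"
  unfolding XS_iff snrm_def using nrm_scale[of "\<lambda>t. min 1 (w t) * z t" a]
  by (auto simp: mult.left_commute)

lemma snrm_nonneg: "z \<in> XS \<Longrightarrow> 0 \<le> snrm z"
  by (simp add: XS_iff snrm_def nrm_nonneg)

lemma XS_AE_cong: "z \<in> XS \<Longrightarrow> y \<in> borel_measurable leb01 \<Longrightarrow> AE t in leb01. y t = z t \<Longrightarrow> y \<in> XS \<and> snrm y = snrm z"
  unfolding XS_iff snrm_def
  by (auto intro!: carr_AE_cong[of "\<lambda>t. min 1 (w t) * z t"] nrm_AE_cong[of "\<lambda>t. min 1 (w t) * z t"])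

lemma snrm_le_X: "x \<in> carr X \<Longrightarrow> snrm x \<le> nrm X x"
  unfolding snrm_def using nrm_bounded_mult[OF _ _ min_weight_bound, of x] by auto

lemma snrm_le_Xw: "x \<in> carr Xw \<Longrightarrow> snrm x \<le> nrm Xw x"
  unfolding snrm_def using min_weight_mult(2)[OF carr_zero, of x x 1] nrm_zero by (auto simp: Xw_iff)

text \<open>For \<open>c = 1\<close> these are the contractions of the couple, over which the norm
  of the coorbit space takes its supremum.\<close>

definition op_bound :: "real \<Rightarrow> ((real \<Rightarrow> real) \<Rightarrow> real \<Rightarrow> real) \<Rightarrow> bool" where
  "op_bound c T \<longleftrightarrow> linear_operator_on XS T \<and>
     (\<forall>x\<in>carr X. T x \<in> carr X \<and> nrm X (T x) \<le> c * nrm X x) \<and>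
     (\<forall>x\<in>carr Xw. T x \<in> carr Xw \<and> nrm Xw (T x) \<le> c * nrm Xw x)"

lemma op_XS: "op_bound c T \<Longrightarrow> z \<in> XS \<Longrightarrow> T z \<in> XS"
  by (auto simp: op_bound_def linear_operator_on_def)

lemma op_cong: "op_bound c T \<Longrightarrow> y \<in> XS \<Longrightarrow> z \<in> XS \<Longrightarrow> AE t in leb01. y t = z t \<Longrightarrow> AE t in leb01. T y t = T z t"
  by (auto simp: op_bound_def linear_operator_on_def ae_eq_def)

lemma op_add: "op_bound c T \<Longrightarrow> y \<in> XS \<Longrightarrow> z \<in> XS \<Longrightarrow> AE t in leb01. T (\<lambda>t. y t + z t) t = T y t + T z t"
  by (auto simp: op_bound_def linear_operator_on_def ae_eq_def)

lemma op_scale: "op_bound c T \<Longrightarrow> z \<in> XS \<Longrightarrow> AE t in leb01. T (\<lambda>t. a * z t) t = a * T z t"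
  by (auto simp: op_bound_def linear_operator_on_def ae_eq_def)

lemma op_X: "op_bound c T \<Longrightarrow> x \<in> carr X \<Longrightarrow> T x \<in> carr X \<and> nrm X (T x) \<le> c * nrm X x"
  by (auto simp: op_bound_def)

lemma op_Xw: "op_bound c T \<Longrightarrow> x \<in> carr Xw \<Longrightarrow> T x \<in> carr Xw \<and> nrm Xw (T x) \<le> c * nrm Xw x"
  by (auto simp: op_bound_def)

lemma op_zero: "op_bound c T \<Longrightarrow> AE t in leb01. T (\<lambda>t. 0) t = 0"
  using op_scale[of c T "\<lambda>t. 0" 0] XS_zero by simp

lemma op_sum:
  assumes T: "op_bound c T" and "\<And>i. i \<in> I \<Longrightarrow> z i \<in> XS"
  shows "AE t in leb01. T (\<lambda>t. \<Sum>i\<in>I. z i t) t = (\<Sum>i\<in>I. T (z i) t)"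
  using assms(2)
proof (induction I rule: infinite_finite_induct)
  case (insert i I)
  then have "AE t in leb01. T (\<lambda>t. z i t + (\<Sum>i\<in>I. z i t)) t = T (z i) t + T (\<lambda>t. \<Sum>i\<in>I. z i t) t"
    by (intro op_add[OF T] XS_sum) auto
  moreover have "AE t in leb01. T (\<lambda>t. \<Sum>i\<in>I. z i t) t = (\<Sum>i\<in>I. T (z i) t)" using insert by auto
  ultimately have "AE t in leb01. T (\<lambda>t. z i t + (\<Sum>i\<in>I. z i t)) t = T (z i) t + (\<Sum>i\<in>I. T (z i) t)"
    by eventually_elim simp
  then show ?case using insert(1,2) by simp
qed (auto simp: op_zero[OF T])

lemma op_id: "op_bound 1 (\<lambda>z. z)"
  by (auto simp: op_bound_def linear_operator_on_def ae_eq_def)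

lemma op_rescale:
  assumes T: "op_bound c T" and c: "0 < c"
  shows "op_bound 1 (\<lambda>z t. inverse c * T z t)"
proof -
  have x: "(\<lambda>t. inverse c * T x t) \<in> carr X \<and> nrm X (\<lambda>t. inverse c * T x t) \<le> 1 * nrm X x" if "x \<in> carr X" for x
  proof -
    have "inverse c * nrm X (T x) \<le> nrm X x"
      using op_X[OF T that] c by (simp add: field_simps)
    then show ?thesis using op_X[OF T that] c carr_scale[of "T x" "inverse c"] nrm_scale[of "T x" "inverse c"] by auto
  qed
  have xw: "(\<lambda>t. inverse c * T x t) \<in> carr Xw \<and> nrm Xw (\<lambda>t. inverse c * T x t) \<le> 1 * nrm Xw x" if "x \<in> carr Xw" for x
  proof -
    have 1: "(\<lambda>t. w t * T x t) \<in> carr X" "T x \<in> borel_measurable leb01" "nrm X (\<lambda>t. w t * T x t) \<le> c * nrm Xw x"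
      using op_Xw[OF T that] by (auto simp: Xw_iff nrm_Xw)
    have 2: "inverse c * nrm X (\<lambda>t. w t * T x t) \<le> nrm Xw x"
      using 1(3) c by (simp add: field_simps)
    have e: "(\<lambda>t. w t * (inverse c * T x t)) = (\<lambda>t. inverse c * (w t * T x t))" by (auto simp: algebra_simps)
    show ?thesis unfolding Xw_iff nrm_Xw[of "\<lambda>t. inverse c * T x t"] e
      using 1(2) 2 c carr_scale[OF 1(1), of "inverse c"] nrm_scale[OF 1(1), of "inverse c"] by auto
  qed
  have "linear_operator_on XS (\<lambda>z t. inverse c * T z t)"
    unfolding linear_operator_on_def
  proof (intro conjI ballI allI impI)
    fix y assume y: "y \<in> XS"
    show "(\<lambda>t. inverse c * T y t) \<in> XS" by (intro XS_scale op_XS[OF T y])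
    show "ae_eq (\<lambda>t. inverse c * T (\<lambda>t. a * y t) t) (\<lambda>t. a * (inverse c * T y t))" for a
      unfolding ae_eq_def using op_scale[OF T y, of a] by eventually_elim simp
    fix z assume z: "z \<in> XS"
    show "ae_eq (\<lambda>t. inverse c * T y t) (\<lambda>t. inverse c * T z t)" if "ae_eq y z"
      using op_cong[OF T y z] that by (auto simp: ae_eq_def)
    show "ae_eq (\<lambda>t. inverse c * T (\<lambda>t. y t + z t) t) (\<lambda>t. inverse c * T y t + inverse c * T z t)"
      unfolding ae_eq_def using op_add[OF T y z] by eventually_elim (simp add: distrib_left)
  qed
  then show ?thesis unfolding op_bound_def using x xw by blast
qed

text \<open>Stability of the contractions under composition is what makes the supremum over them
  define an interpolation space.\<close>

lemma op_comp:
  assumes S: "op_bound 1 S" and T: "op_bound 1 T"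
  shows "op_bound 1 (\<lambda>z. S (T z))"
proof -
  have "linear_operator_on XS (\<lambda>z. S (T z))"
    unfolding linear_operator_on_def
  proof (intro conjI ballI allI impI)
    fix z assume z: "z \<in> XS"
    show "S (T z) \<in> XS" by (intro op_XS[OF S] op_XS[OF T] z)
    show "ae_eq (S (T (\<lambda>t. a * z t))) (\<lambda>t. a * S (T z) t)" for a
    proof -
      have "AE t in leb01. S (T (\<lambda>t. a * z t)) t = S (\<lambda>t. a * T z t) t"
        by (rule op_cong[OF S _ _ op_scale[OF T z]]) (intro op_XS[OF T] XS_scale z)+
      then show ?thesis unfolding ae_eq_def using op_scale[OF S op_XS[OF T z], of a] by eventually_elim simp
    qed
    fix y assume y: "y \<in> XS"
    show "ae_eq (S (T z)) (S (T y))" if "ae_eq z y"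
      unfolding ae_eq_def using that by (intro op_cong[OF S] op_cong[OF T] op_XS[OF T] y z) (simp add: ae_eq_def)
    have "AE t in leb01. S (T (\<lambda>t. z t + y t)) t = S (\<lambda>t. T z t + T y t) t"
      by (rule op_cong[OF S _ _ op_add[OF T z y]]) (intro op_XS[OF T] XS_add y z)+
    then show "ae_eq (S (T (\<lambda>t. z t + y t))) (\<lambda>t. S (T z) t + S (T y) t)"
      unfolding ae_eq_def using op_add[OF S op_XS[OF T z] op_XS[OF T y]] by eventually_elim simp
  qed
  moreover have "S (T x) \<in> carr X \<and> nrm X (S (T x)) \<le> 1 * nrm X x" if "x \<in> carr X" for x
    using op_X[OF T that] op_X[OF S, of "T x"] by auto
  moreover have "S (T x) \<in> carr Xw \<and> nrm Xw (S (T x)) \<le> 1 * nrm Xw x" if "x \<in> carr Xw" for x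
    using op_Xw[OF T that] op_Xw[OF S, of "T x"] by auto
  ultimately show ?thesis unfolding op_bound_def by blast
qed

text \<open>The factor 2 counts the two parts into which \<open>z\<close> is cut at
  \<open>w = 1\<close>.\<close>

lemma op_snrm:
  assumes T: "op_bound c T" and c: "0 \<le> c" and z: "z \<in> XS"
  shows "snrm (T z) \<le> 2 * c * snrm z"
proof -
  define z0 where "z0 = (\<lambda>t. if w t \<ge> 1 then z t else 0)"
  define z1 where "z1 = (\<lambda>t. if w t \<ge> 1 then 0 else z t)"
  have s: "z0 \<in> carr X" "z1 \<in> carr Xw" "nrm X z0 \<le> snrm z" "nrm Xw z1 \<le> snrm z" "z = (\<lambda>t. z0 t + z1 t)"
    using z XS_split[of z] unfolding XS_iff z0_def z1_def by blast+
  have "AE t in leb01. T z t = T z0 t + T z1 t"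
    using op_add[OF T XS_X[OF s(1)] XS_Xw[OF s(2)]] s(5) by simp
  then have "snrm (T z) \<le> nrm X (T z0) + 1 * nrm Xw (T z1)"
    using op_X[OF T s(1)] op_Xw[OF T s(2)] XS_measurable[OF op_XS[OF T z]]
      min_weight_mult(2)[of "T z0" "T z1" "T z" 1] by (simp add: snrm_def)
  also have "\<dots> \<le> c * nrm X z0 + 1 * (c * nrm Xw z1)" using op_X[OF T s(1)] op_Xw[OF T s(2)] by simp
  also have "\<dots> \<le> c * snrm z + 1 * (c * snrm z)" using c s by (intro add_mono mult_left_mono) auto
  finally show ?thesis by simp
qed

end

section \<open>Coorbit spaces\<close>

context weighted_symmetric_space
begin

lemma XS_diff: "y \<in> XS \<Longrightarrow> z \<in> XS \<Longrightarrow> (\<lambda>t. y t - z t) \<in> XS"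
  using XS_add[of y "\<lambda>t. -1 * z t"] XS_scale[of z "-1"] by simp

lemma snrm_zero_iff: "z \<in> XS \<Longrightarrow> snrm z = 0 \<longleftrightarrow> (AE t in leb01. z t = 0)"
proof -
  assume "z \<in> XS"
  then have "snrm z = 0 \<longleftrightarrow> (AE t in leb01. min 1 (w t) * z t = 0)"
    unfolding snrm_def XS_iff by (intro nrm_eq_0_iff) auto
  also have "\<dots> \<longleftrightarrow> (AE t in leb01. z t = 0)"
  proof
    assume "AE t in leb01. min 1 (w t) * z t = 0"
    then show "AE t in leb01. z t = 0" using w_pos by eventually_elim (auto simp: min_def split: if_splits)
  next
    assume "AE t in leb01. z t = 0"
    then show "AE t in leb01. min 1 (w t) * z t = 0" by eventually_elim simp
  qed
  finally show ?thesis .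
qed

text \<open>Multiplication by \<open>min 1 (w t)\<close>, which is positive almost everywhere,
  carries the sum isometrically onto \<open>X\<close>.\<close>

lemma snrm_complete:
  assumes u: "\<And>n. u n \<in> XS" and Cau: "\<And>e. 0 < e \<Longrightarrow> \<exists>N. \<forall>m\<ge>N. \<forall>n\<ge>N. snrm (\<lambda>t. u m t - u n t) < e"
  shows "\<exists>z\<in>XS. (\<lambda>n. snrm (\<lambda>t. u n t - z t)) \<longlonglongrightarrow> 0"
proof -
  define f where "f n = (\<lambda>t. min 1 (w t) * u n t)" for n
  have f: "f n \<in> carr X" for n using u by (simp add: f_def XS_iff)
  obtain g where g: "g \<in> carr X" and lim: "(\<lambda>n. nrm X (\<lambda>t. f n t - g t)) \<longlonglongrightarrow> 0"
    using complete[of f] f Cau unfolding f_def snrm_def right_diff_distrib by blast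
  define z where "z t = g t / min 1 (w t)" for t
  note [measurable] = carr_measurable[OF g]
  have zm: "z \<in> borel_measurable leb01" unfolding z_def[abs_def] by measurable
  have ae: "AE t in leb01. min 1 (w t) * z t = g t"
    using w_pos by eventually_elim (auto simp: z_def min_def)
  have z: "z \<in> XS" unfolding XS_iff using zm by (auto intro!: carr_AE_cong[OF g _ ae])
  have "snrm (\<lambda>t. u n t - z t) = nrm X (\<lambda>t. f n t - g t)" for n
    unfolding snrm_def
  proof (rule nrm_AE_cong[OF carr_diff[OF f g]])
    show "(\<lambda>t. min 1 (w t) * (u n t - z t)) \<in> borel_measurable leb01"
      using XS_measurable[OF u[of n]] zm by measurable
    show "AE t in leb01. min 1 (w t) * (u n t - z t) = f n t - g t"
      using ae by eventually_elim (simp add: f_def right_diff_distrib)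
  qed
  then show ?thesis using lim by (intro bexI[OF _ z]) simp
qed

end

text \<open>The largest interpolation space on which all the seminorms \<open>z \<mapsto> \<parallel>v m z\<parallel>\<close> are bounded.\<close>

locale coorbit = weighted_symmetric_space +
  fixes v :: "nat \<Rightarrow> real \<Rightarrow> real" and A :: "nat \<Rightarrow> real" and B :: real
  assumes v_measurable [measurable]: "\<And>m. v m \<in> borel_measurable leb01"
    and v_le: "\<And>m. AE t in leb01. \<bar>v m t\<bar> \<le> A m * min 1 (w t)"
    and v_J: "\<And>m z. z \<in> carr X \<Longrightarrow> z \<in> carr Xw \<Longrightarrow> nrm X (\<lambda>t. v m t * z t) \<le> B * max (nrm X z) (nrm Xw z)"
begin

definition V :: "nat \<Rightarrow> ((real \<Rightarrow> real) \<Rightarrow> real \<Rightarrow> real) \<Rightarrow> (real \<Rightarrow> real) \<Rightarrow> real" where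
  "V m T z = nrm X (\<lambda>t. v m t * T z t)"

text \<open>A supremum of reals, meaningful on the carrier of \<open>E\<close>, where the family is
  bounded above.\<close>

definition G :: "(real \<Rightarrow> real) \<Rightarrow> real" where
  "G z = (SUP i\<in>UNIV \<times> Collect (op_bound 1). V (fst i) (snd i) z)"

text \<open>The summand \<open>snrm z\<close> makes the norm definite and the embedding into the sum
  bounded; the seminorms in \<open>G\<close> alone may vanish on nonzero functions.\<close>

definition E :: fun_space where
  "E = \<lparr>carr = {z\<in>XS. \<exists>b. \<forall>m T. op_bound 1 T \<longrightarrow> V m T z \<le> b}, nrm = (\<lambda>z. snrm z + G z)\<rparr>"

lemma E_XS: "z \<in> carr E \<Longrightarrow> z \<in> XS"
  by (simp add: E_def)

lemma E_I: "z \<in> XS \<Longrightarrow> (\<And>m T. op_bound 1 T \<Longrightarrow> V m T z \<le> b) \<Longrightarrow> z \<in> carr E"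
  by (auto simp: E_def)

lemma nrm_E: "nrm E z = snrm z + G z"
  by (simp add: E_def)

lemma G_upper: "z \<in> carr E \<Longrightarrow> op_bound 1 T \<Longrightarrow> V m T z \<le> G z"
  unfolding G_def by (rule cSUP_upper2[of _ _ "(m, T)"]) (auto simp: E_def bdd_above_def)

lemma G_least:
  assumes "\<And>m T. op_bound 1 T \<Longrightarrow> V m T z \<le> b"
  shows "G z \<le> b"
  unfolding G_def
proof (rule cSUP_least)
  show "UNIV \<times> Collect (op_bound 1) \<noteq> {}" using op_id by blast
  show "V (fst i) (snd i) z \<le> b" if "i \<in> UNIV \<times> Collect (op_bound 1)" for i
    using assms[of "snd i" "fst i"] that by auto
qed

lemma v_mult:
  assumes "z \<in> XS"
  shows "(\<lambda>t. v m t * z t) \<in> carr X" "nrm X (\<lambda>t. v m t * z t) \<le> \<bar>A m\<bar> * snrm z"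
proof -
  have uz: "(\<lambda>t. min 1 (w t) * z t) \<in> carr X" using assms by (simp add: XS_iff)
  have le: "AE t in leb01. \<bar>v m t * z t\<bar> \<le> \<bar>A m * (min 1 (w t) * z t)\<bar>"
    using v_le[of m]
  proof eventually_elim
    case (elim t)
    then have "\<bar>v m t\<bar> * \<bar>z t\<bar> \<le> \<bar>A m * min 1 (w t)\<bar> * \<bar>z t\<bar>" by (intro mult_right_mono) auto
    then show ?case by (simp add: abs_mult)
  qed
  have m: "(\<lambda>t. v m t * z t) \<in> borel_measurable leb01" using XS_measurable[OF assms] by measurable
  show "(\<lambda>t. v m t * z t) \<in> carr X" by (rule carr_dominated[OF m carr_scale[OF uz] le])
  show "nrm X (\<lambda>t. v m t * z t) \<le> \<bar>A m\<bar> * snrm z"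
    using nrm_dominated[OF m carr_scale[OF uz] le] nrm_scale[OF uz, of "A m"] by (simp add: snrm_def)
qed

lemma V_nonneg: "op_bound 1 T \<Longrightarrow> z \<in> XS \<Longrightarrow> 0 \<le> V m T z"
  unfolding V_def by (rule nrm_nonneg[OF v_mult(1)[OF op_XS]])

lemma G_nonneg: "z \<in> carr E \<Longrightarrow> 0 \<le> G z"
  by (rule order_trans[OF V_nonneg[OF op_id E_XS, of z 0] G_upper[OF _ op_id]])

lemma V_cong:
  assumes "op_bound 1 T" "y \<in> XS" "z \<in> XS" "AE t in leb01. y t = z t"
  shows "V m T y = V m T z"
  unfolding V_def
proof (rule nrm_AE_cong[OF v_mult(1)])
  show "T z \<in> XS" by (intro op_XS[OF assms(1)] assms)
  show "(\<lambda>t. v m t * T y t) \<in> borel_measurable leb01"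
    using XS_measurable[OF op_XS[OF assms(1,2)]] by measurable
  show "AE t in leb01. v m t * T y t = v m t * T z t" using op_cong[OF assms] by eventually_elim simp
qed

lemma V_add:
  assumes T: "op_bound 1 T" and y: "y \<in> XS" and z: "z \<in> XS"
  shows "V m T (\<lambda>t. y t + z t) \<le> V m T y + V m T z"
proof -
  have "V m T (\<lambda>t. y t + z t) = nrm X (\<lambda>t. v m t * T y t + v m t * T z t)"
    unfolding V_def
  proof (rule nrm_AE_cong[OF carr_add])
    show "(\<lambda>t. v m t * T y t) \<in> carr X" "(\<lambda>t. v m t * T z t) \<in> carr X" by (intro v_mult op_XS[OF T] y z)+
    show "(\<lambda>t. v m t * T (\<lambda>t. y t + z t) t) \<in> borel_measurable leb01"
      using XS_measurable[OF op_XS[OF T XS_add[OF y z]]] by measurable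
    show "AE t in leb01. v m t * T (\<lambda>t. y t + z t) t = v m t * T y t + v m t * T z t"
      using op_add[OF T y z] by eventually_elim (simp add: distrib_left)
  qed
  also have "\<dots> \<le> V m T y + V m T z" unfolding V_def by (intro nrm_add v_mult op_XS[OF T] y z)
  finally show ?thesis .
qed

lemma V_scale:
  assumes T: "op_bound 1 T" and z: "z \<in> XS"
  shows "V m T (\<lambda>t. a * z t) = \<bar>a\<bar> * V m T z"
proof -
  have c: "(\<lambda>t. v m t * T z t) \<in> carr X" by (intro v_mult op_XS[OF T] z)
  have "V m T (\<lambda>t. a * z t) = nrm X (\<lambda>t. a * (v m t * T z t))"
    unfolding V_def
  proof (rule nrm_AE_cong[OF carr_scale[OF c]])
    show "(\<lambda>t. v m t * T (\<lambda>t. a * z t) t) \<in> borel_measurable leb01"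
      using XS_measurable[OF op_XS[OF T XS_scale[OF z]]] by measurable
    show "AE t in leb01. v m t * T (\<lambda>t. a * z t) t = a * (v m t * T z t)"
      using op_scale[OF T z, of a] by eventually_elim simp
  qed
  then show ?thesis using nrm_scale[OF c] by (simp add: V_def)
qed

text \<open>The constant may grow with \<open>m\<close>: this gives continuity of each single
  seminorm on the sum, as needed for completeness, whereas uniformity in \<open>m\<close> comes from
  \<open>B\<close> on the intersection.\<close>

lemma V_le_snrm:
  assumes T: "op_bound 1 T" and z: "z \<in> XS"
  shows "V m T z \<le> \<bar>A m\<bar> * (2 * snrm z)"
proof -
  have "V m T z \<le> \<bar>A m\<bar> * snrm (T z)" unfolding V_def by (intro v_mult op_XS[OF T] z)
  also have "\<dots> \<le> \<bar>A m\<bar> * (2 * snrm z)" using op_snrm[OF T _ z] by (intro mult_left_mono) auto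
  finally show ?thesis .
qed

lemma E_add:
  assumes y: "y \<in> carr E" and z: "z \<in> carr E"
  shows "(\<lambda>t. y t + z t) \<in> carr E" "nrm E (\<lambda>t. y t + z t) \<le> nrm E y + nrm E z"
proof -
  have le: "V m T (\<lambda>t. y t + z t) \<le> G y + G z" if "op_bound 1 T" for m T
    using V_add[OF that E_XS[OF y] E_XS[OF z], of m] G_upper[OF y that, of m] G_upper[OF z that, of m] by linarith
  show "(\<lambda>t. y t + z t) \<in> carr E" by (rule E_I[OF XS_add[OF E_XS[OF y] E_XS[OF z]] le])
  show "nrm E (\<lambda>t. y t + z t) \<le> nrm E y + nrm E z"
    unfolding nrm_E using snrm_add[OF E_XS[OF y] E_XS[OF z]] G_least[OF le] by simp
qed

lemma E_scale_le:
  assumes z: "z \<in> carr E"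
  shows "(\<lambda>t. a * z t) \<in> carr E" "nrm E (\<lambda>t. a * z t) \<le> \<bar>a\<bar> * nrm E z"
proof -
  have le: "V m T (\<lambda>t. a * z t) \<le> \<bar>a\<bar> * G z" if "op_bound 1 T" for m T
    unfolding V_scale[OF that E_XS[OF z]] using G_upper[OF z that] by (intro mult_left_mono) auto
  show "(\<lambda>t. a * z t) \<in> carr E" by (rule E_I[OF XS_scale[OF E_XS[OF z]] le])
  show "nrm E (\<lambda>t. a * z t) \<le> \<bar>a\<bar> * nrm E z"
    unfolding nrm_E using snrm_scale[OF E_XS[OF z]] G_least[OF le] by (simp add: distrib_left)
qed

lemma E_nonneg: "z \<in> carr E \<Longrightarrow> 0 \<le> nrm E z"
  unfolding nrm_E using G_nonneg snrm_nonneg[OF E_XS] by simp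

lemma E_zero: "(\<lambda>t. 0) \<in> carr E"
proof (rule E_I[OF XS_zero])
  show "V m T (\<lambda>t. 0) \<le> 0" if "op_bound 1 T" for m T
    using V_scale[OF that XS_zero, of m 0] by simp
qed

lemma E_scale:
  assumes z: "z \<in> carr E"
  shows "nrm E (\<lambda>t. a * z t) = \<bar>a\<bar> * nrm E z"
proof (cases "a = 0")
  case True
  then show ?thesis using E_scale_le(2)[OF z, of a] E_nonneg[OF E_scale_le(1)[OF z, of a]] by simp
next
  case False
  have "nrm E (\<lambda>t. inverse a * (a * z t)) \<le> \<bar>inverse a\<bar> * nrm E (\<lambda>t. a * z t)"
    by (intro E_scale_le z)
  moreover have "(\<lambda>t. inverse a * (a * z t)) = z" using False by auto
  ultimately have "\<bar>a\<bar> * nrm E z \<le> nrm E (\<lambda>t. a * z t)"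
    using False by (simp add: field_simps)
  then show ?thesis using E_scale_le(2)[OF z, of a] by simp
qed

lemma E_AE_cong:
  assumes z: "z \<in> carr E" and y: "y \<in> borel_measurable leb01" and eq: "AE t in leb01. y t = z t"
  shows "y \<in> carr E" "nrm E y = nrm E z"
proof -
  have yX: "y \<in> XS" "snrm y = snrm z" using XS_AE_cong[OF E_XS[OF z] y eq] by auto
  have V: "V m T y = V m T z" if "op_bound 1 T" for m T
    by (rule V_cong[OF that yX(1) E_XS[OF z] eq])
  show "y \<in> carr E" by (rule E_I[OF yX(1), of "G z"]) (simp add: V G_upper[OF z])
  have "G y = G z" unfolding G_def by (rule SUP_cong) (auto simp: V)
  then show "nrm E y = nrm E z" by (simp add: nrm_E yX)
qed

text \<open>The limit is taken in the sum, and the Cauchy estimate then passes to the limit in each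
  seminorm separately.\<close>

lemma E_complete:
  assumes u: "\<And>n. u n \<in> carr E"
    and Cau: "\<And>e. 0 < e \<Longrightarrow> \<exists>N. \<forall>m\<ge>N. \<forall>n\<ge>N. nrm E (\<lambda>t. u m t - u n t) < e"
  shows "\<exists>z\<in>carr E. (\<lambda>n. nrm E (\<lambda>t. u n t - z t)) \<longlonglongrightarrow> 0"
proof -
  have d: "(\<lambda>t. u m t - u n t) \<in> carr E" for m n
    using E_add(1)[OF u[of m] E_scale_le(1)[OF u[of n], of "-1"]] by simp
  have "\<exists>N. \<forall>m\<ge>N. \<forall>n\<ge>N. snrm (\<lambda>t. u m t - u n t) < e" if "0 < e" for e
    using Cau[OF that] G_nonneg[OF d] unfolding nrm_E by (meson add_increasing2 le_less_trans order_refl)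
  then obtain z where z: "z \<in> XS" and lim: "(\<lambda>n. snrm (\<lambda>t. u n t - z t)) \<longlonglongrightarrow> 0"
    using snrm_complete[of u] E_XS[OF u] by blast
  have dz: "(\<lambda>t. u n t - z t) \<in> XS" for n by (intro XS_diff E_XS u z)
  have bound: "\<exists>N. \<forall>i\<ge>N. \<forall>m T. op_bound 1 T \<longrightarrow> V m T (\<lambda>t. u i t - z t) \<le> e" if e: "0 < e" for e
  proof -
    obtain N where N: "\<And>i j. i \<ge> N \<Longrightarrow> j \<ge> N \<Longrightarrow> nrm E (\<lambda>t. u i t - u j t) < e" using Cau[OF e] by blast
    have "V m T (\<lambda>t. u i t - z t) \<le> e" if i: "i \<ge> N" and T: "op_bound 1 T" for i m T
    proof -
      \<comment> \<open>Here \<open>j\<close> tends to infinity with \<open>m\<close> and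
        \<open>T\<close> fixed, so the size of \<open>A m\<close> is harmless and \<open>N\<close>
        stays uniform in both.\<close>
      have "V m T (\<lambda>t. u i t - z t) \<le> e + \<bar>A m\<bar> * (2 * snrm (\<lambda>t. u j t - z t))" if j: "j \<ge> N" for j
      proof -
        have "V m T (\<lambda>t. (u i t - u j t) + (u j t - z t)) \<le> V m T (\<lambda>t. u i t - u j t) + V m T (\<lambda>t. u j t - z t)"
          by (intro V_add T E_XS d dz)
        moreover have "V m T (\<lambda>t. u i t - u j t) \<le> nrm E (\<lambda>t. u i t - u j t)"
          unfolding nrm_E using G_upper[OF d T, of m i j] snrm_nonneg[OF E_XS[OF d, of i j]] by linarith
        moreover have "V m T (\<lambda>t. u j t - z t) \<le> \<bar>A m\<bar> * (2 * snrm (\<lambda>t. u j t - z t))"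
          by (intro V_le_snrm T dz)
        ultimately show ?thesis using N[OF i j] by simp
      qed
      then have "\<exists>N. \<forall>j\<ge>N. V m T (\<lambda>t. u i t - z t) \<le> e + \<bar>A m\<bar> * (2 * snrm (\<lambda>t. u j t - z t))" by blast
      moreover have "(\<lambda>j. e + \<bar>A m\<bar> * (2 * snrm (\<lambda>t. u j t - z t))) \<longlonglongrightarrow> e + \<bar>A m\<bar> * (2 * 0)"
        by (intro tendsto_intros lim)
      ultimately show ?thesis using LIMSEQ_le_const by fastforce
    qed
    then show ?thesis by blast
  qed
  obtain N where N: "\<And>i m T. i \<ge> N \<Longrightarrow> op_bound 1 T \<Longrightarrow> V m T (\<lambda>t. u i t - z t) \<le> 1" using bound[of 1] by auto
  have dE: "(\<lambda>t. u N t - z t) \<in> carr E" by (rule E_I[OF dz N[OF order_refl]])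
  have zE: "z \<in> carr E"
    using E_add(1)[OF u[of N] E_scale_le(1)[OF dE, of "-1"]] by simp
  have dE': "(\<lambda>t. u n t - z t) \<in> carr E" for n
    using E_add(1)[OF u[of n] E_scale_le(1)[OF zE, of "-1"]] by simp
  have "(\<lambda>n. G (\<lambda>t. u n t - z t)) \<longlonglongrightarrow> 0"
  proof (rule LIMSEQ_I)
    fix r :: real assume r: "0 < r"
    obtain N where N: "\<And>i m T. i \<ge> N \<Longrightarrow> op_bound 1 T \<Longrightarrow> V m T (\<lambda>t. u i t - z t) \<le> r / 2"
      using bound[of "r/2"] r by auto
    have "G (\<lambda>t. u i t - z t) \<le> r / 2" if "i \<ge> N" for i by (rule G_least[OF N[OF that]])
    then show "\<exists>N. \<forall>n\<ge>N. norm (G (\<lambda>t. u n t - z t) - 0) < r"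
      using r G_nonneg[OF dE'] by (intro exI[of _ N]) (fastforce intro: le_less_trans)
  qed
  then have "(\<lambda>n. nrm E (\<lambda>t. u n t - z t)) \<longlonglongrightarrow> 0 + 0" unfolding nrm_E by (intro tendsto_add lim)
  then show ?thesis using zE by auto
qed

lemma E_banach: "banach_fun_space E"
  unfolding banach_fun_space_def
proof (intro conjI ballI allI impI)
  show "carr E \<subseteq> borel_measurable leb01" using E_XS XS_measurable by blast
  show "(\<lambda>t. 0) \<in> carr E" by (rule E_zero)
next
  fix x y assume "x \<in> carr E" "y \<in> borel_measurable leb01" "ae_eq x y"
  then show "y \<in> carr E" using E_AE_cong(1)[of x y] by (auto simp: ae_eq_def eq_commute)
next
  fix x assume x: "x \<in> carr E"
  show "0 \<le> nrm E x" by (rule E_nonneg[OF x])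
  show "nrm E x = 0 \<longleftrightarrow> ae_eq x (\<lambda>t. 0)"
  proof
    assume "nrm E x = 0"
    then have "snrm x = 0" using G_nonneg[OF x] snrm_nonneg[OF E_XS[OF x]] by (simp add: nrm_E)
    then show "ae_eq x (\<lambda>t. 0)" using snrm_zero_iff[OF E_XS[OF x]] by (simp add: ae_eq_def)
  next
    assume "ae_eq x (\<lambda>t. 0)"
    then have "nrm E x = nrm E (\<lambda>t. 0)"
      using E_AE_cong(2)[OF E_zero XS_measurable[OF E_XS[OF x]]] by (simp add: ae_eq_def)
    also have "\<dots> = 0" using E_scale[OF E_zero, of 0] by simp
    finally show "nrm E x = 0" .
  qed
  show "(\<lambda>t. a * x t) \<in> carr E" for a by (rule E_scale_le(1)[OF x])
  show "nrm E (\<lambda>t. a * x t) = \<bar>a\<bar> * nrm E x" for a by (rule E_scale[OF x])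
  fix y assume y: "y \<in> carr E"
  show "(\<lambda>t. x t + y t) \<in> carr E" "nrm E (\<lambda>t. x t + y t) \<le> nrm E x + nrm E y" by (rule E_add[OF x y])+
next
  fix u :: "nat \<Rightarrow> real \<Rightarrow> real"
  assume "(\<forall>n. u n \<in> carr E) \<and> (\<forall>e>0. \<exists>N. \<forall>m\<ge>N. \<forall>n\<ge>N. nrm E (\<lambda>t. u m t - u n t) < e)"
  then show "\<exists>x\<in>carr E. (\<lambda>n. nrm E (\<lambda>t. u n t - x t)) \<longlonglongrightarrow> 0" using E_complete[of u] by blast
qed

lemma E_intermediate: "intermediate_space X Xw E"
  unfolding intermediate_space_def
proof (intro conjI)
  show "banach_fun_space E" by (rule E_banach)
  show "carr E \<subseteq> XS" using E_XS by blast
  \<comment> \<open>A contraction preserves the intersection and its norm bound, so the single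
    constant \<open>B\<close> serves all \<open>m\<close> and \<open>T\<close>.\<close>
  have B0: "V m T z \<le> \<bar>B\<bar> * max (nrm X z) (nrm Xw z)" if z: "z \<in> carr X" "z \<in> carr Xw" and T: "op_bound 1 T" for m T z
  proof -
    have "V m T z \<le> B * max (nrm X (T z)) (nrm Xw (T z))"
      unfolding V_def using op_X[OF T z(1)] op_Xw[OF T z(2)] by (intro v_J) auto
    also have "\<dots> \<le> \<bar>B\<bar> * max (nrm X (T z)) (nrm Xw (T z))"
      using op_X[OF T z(1)] nrm_nonneg[of "T z"] by (intro mult_right_mono) (auto simp: le_max_iff_disj)
    also have "\<dots> \<le> \<bar>B\<bar> * max (nrm X z) (nrm Xw z)"
      using op_X[OF T z(1)] op_Xw[OF T z(2)] by (intro mult_left_mono max.mono) auto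
    finally show ?thesis .
  qed
  show "carr X \<inter> carr Xw \<subseteq> carr E"
  proof
    fix z assume "z \<in> carr X \<inter> carr Xw"
    then show "z \<in> carr E" using B0[of z] by (intro E_I[OF XS_X]) auto
  qed
  show "\<exists>C. \<forall>z\<in>carr X \<inter> carr Xw. nrm E z \<le> C * max (nrm X z) (nrm Xw z)"
  proof (intro exI[of _ "1 + \<bar>B\<bar>"] ballI)
    fix z assume z: "z \<in> carr X \<inter> carr Xw"
    have "G z \<le> \<bar>B\<bar> * max (nrm X z) (nrm Xw z)" by (rule G_least) (use z B0 in auto)
    moreover have "snrm z \<le> max (nrm X z) (nrm Xw z)" using snrm_le_X[of z] z by auto
    ultimately show "nrm E z \<le> (1 + \<bar>B\<bar>) * max (nrm X z) (nrm Xw z)" by (simp add: nrm_E distrib_right)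
  qed
  show "\<exists>C. \<forall>z\<in>carr E. K_functional 1 z X Xw \<le> C * nrm E z"
  proof (intro exI[of _ 2] ballI)
    fix z assume z: "z \<in> carr E"
    define z0 where "z0 = (\<lambda>t. if w t \<ge> 1 then z t else 0)"
    define z1 where "z1 = (\<lambda>t. if w t \<ge> 1 then 0 else z t)"
    have s: "z0 \<in> carr X" "z1 \<in> carr Xw" "nrm X z0 \<le> snrm z" "nrm Xw z1 \<le> snrm z" "z = (\<lambda>t. z0 t + z1 t)"
      using E_XS[OF z] XS_split[of z] unfolding XS_iff z0_def z1_def by blast+
    have "K_functional 1 z X Xw \<le> nrm X z0 + 1 * nrm Xw z1"
      by (rule K_le) (use s in \<open>auto simp: fun_eq_iff\<close>)
    then show "K_functional 1 z X Xw \<le> 2 * nrm E z"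
      using s G_nonneg[OF z] by (simp add: nrm_E)
  qed
qed

text \<open>After division by its bound \<open>c\<close> an operator is a contraction, and composing
  it with any contraction \<open>S\<close> gives another member of the family in the
  supremum.\<close>

lemma E_interpolation: "interpolation_space X Xw E"
  unfolding interpolation_space_def
proof (intro conjI allI impI)
  show "intermediate_space X Xw E" by (rule E_intermediate)
  fix T assume T: "linear_operator_on XS T \<and> maps_boundedly T X \<and> maps_boundedly T Xw"
  then obtain C0 C1 where C: "\<And>x. x \<in> carr X \<Longrightarrow> nrm X (T x) \<le> C0 * nrm X x" "\<And>x. x \<in> carr Xw \<Longrightarrow> nrm Xw (T x) \<le> C1 * nrm Xw x"
    unfolding maps_boundedly_def by blast
  \<comment> \<open>The 1 guarantees a positive bound to divide by.\<close>
  define c where "c = max 1 (max C0 C1)"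
  have c: "1 \<le> c" "C0 \<le> c" "C1 \<le> c" by (auto simp: c_def)
  have op: "op_bound c T" unfolding op_bound_def
  proof (intro conjI ballI)
    fix x assume x: "x \<in> carr X"
    show "T x \<in> carr X" using T x by (auto simp: maps_boundedly_def)
    show "nrm X (T x) \<le> c * nrm X x" using C(1)[OF x] mult_right_mono[OF c(2) nrm_nonneg[OF x]] by simp
  next
    fix x assume x: "x \<in> carr Xw"
    show "T x \<in> carr Xw" using T x by (auto simp: maps_boundedly_def)
    show "nrm Xw (T x) \<le> c * nrm Xw x" using C(2)[OF x] mult_right_mono[OF c(3) nrm_Xw_nonneg[OF x]] by simp
  qed (use T in simp)
  have op1: "op_bound 1 (\<lambda>z t. inverse c * T z t)" using c by (intro op_rescale[OF op]) auto
  have V: "V m S (T z) \<le> c * G z" if z: "z \<in> carr E" and S: "op_bound 1 S" for z m S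
  proof -
    have Tz: "T z \<in> XS" by (rule op_XS[OF op E_XS[OF z]])
    have "V m S (T z) = c * V m S (\<lambda>t. inverse c * T z t)"
      unfolding V_scale[OF S Tz] using c by (simp add: field_simps)
    also have "V m S (\<lambda>t. inverse c * T z t) = V m (\<lambda>z. S (\<lambda>t. inverse c * T z t)) z" by (simp add: V_def)
    also have "c * \<dots> \<le> c * G z" using c by (intro mult_left_mono G_upper[OF z op_comp[OF S op1]]) auto
    finally show ?thesis .
  qed
  show "maps_boundedly T E"
    unfolding maps_boundedly_def
  proof (intro conjI ballI exI[of _ "2 * c"])
    fix z assume z: "z \<in> carr E"
    show "T z \<in> carr E" by (rule E_I[OF op_XS[OF op E_XS[OF z]] V[OF z]])
    have "G (T z) \<le> c * G z" by (rule G_least[OF V[OF z]])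
    moreover have "snrm (T z) \<le> 2 * c * snrm z" using op_snrm[OF op _ E_XS[OF z]] c by simp
    moreover have "0 \<le> c * G z" using c G_nonneg[OF z] by simp
    ultimately show "nrm E (T z) \<le> 2 * c * nrm E z" by (simp add: nrm_E algebra_simps)
  qed
qed

end

section \<open>Operators and levels\<close>

lemma geometric_tail_sum:
  fixes q :: real
  assumes q: "0 < q" "q < 1" and A: "finite A" "\<And>j. j \<in> A \<Longrightarrow> n \<le> j"
  shows "(\<Sum>j\<in>A. q ^ j) \<le> q ^ n / (1 - q)"
proof -
  have "(\<Sum>j\<in>A. q ^ j) = (\<Sum>j\<in>A. q ^ n * q ^ (j - n))"
    using A(2) by (intro sum.cong) (auto simp flip: power_add)
  also have "\<dots> = q ^ n * (\<Sum>i\<in>(\<lambda>j. j - n) ` A. q ^ i)"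
    using A(2) by (subst sum.reindex) (auto simp: inj_on_def sum_distrib_left eq_diff_iff)
  also have "\<dots> \<le> q ^ n * (\<Sum>i. q ^ i)"
    using q A(1) by (intro mult_left_mono sum_le_suminf summable_geometric) auto
  also have "(\<Sum>i. q ^ i) = 1 / (1 - q)" using q by (intro suminf_geometric) auto
  finally show ?thesis by simp
qed

abbreviation pow2 :: "int \<Rightarrow> real" where "pow2 k \<equiv> 2 powr (real_of_int k)"

abbreviation half_pow :: "int \<Rightarrow> real" where "half_pow k \<equiv> 2 powr (- real_of_int k / 2)"

abbreviation root_pow :: "int \<Rightarrow> real" where "root_pow k \<equiv> 2 powr (real_of_int k / 2)"

abbreviation decay :: "int \<Rightarrow> real" where "decay i \<equiv> 2 powr (- \<bar>real_of_int i\<bar> / 2)"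

text \<open>Two geometric series with ratio \<open>2 powr (- (1/2))\<close>, one for each sign of
  the index.\<close>

definition geo_const :: real where "geo_const = 2 / (1 - 2 powr (- (1/2)))"

lemma geo_const_pos: "0 < geo_const"
  unfolding geo_const_def by (intro divide_pos_pos) (simp_all add: powr_minus field_simps)

lemma two_sided_tail_sum:
  fixes I :: "int set"
  assumes I: "finite I" "\<And>i. i \<in> I \<Longrightarrow> int n \<le> \<bar>i\<bar>"
  shows "(\<Sum>i\<in>I. decay i) \<le> geo_const * 2 powr (- real n / 2)"
proof -
  define q :: real where "q = 2 powr (- (1/2))"
  have q: "0 < q" "q < 1" by (auto simp: q_def powr_minus field_simps)
  have qp: "q ^ j = 2 powr (- real j / 2)" for j :: nat
    by (simp add: q_def powr_realpow[symmetric] powr_powr)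
  have part: "(\<Sum>i\<in>J. decay i) \<le> q ^ n / (1 - q)"
    if "J \<subseteq> I" "inj_on (\<lambda>i. nat \<bar>i\<bar>) J" for J
  proof -
    have "(\<Sum>i\<in>J. decay i) = (\<Sum>i\<in>J. q ^ nat \<bar>i\<bar>)"
      by (intro sum.cong) (auto simp: qp)
    also have "\<dots> = (\<Sum>j\<in>(\<lambda>i. nat \<bar>i\<bar>) ` J. q ^ j)"
      using that(2) by (simp add: sum.reindex)
    also have "\<dots> \<le> q ^ n / (1 - q)"
      using that(1) I finite_subset[OF that(1) I(1)] by (intro geometric_tail_sum[OF q]) force+
    finally show ?thesis .
  qed
  have "I = {i\<in>I. 0 \<le> i} \<union> {i\<in>I. i < 0}" by auto
  then have "(\<Sum>i\<in>I. decay i) =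
      (\<Sum>i\<in>{i\<in>I. 0 \<le> i}. decay i) + (\<Sum>i\<in>{i\<in>I. i < 0}. decay i)"
    using I(1) by (subst sum.union_disjoint[symmetric]) auto
  also have "\<dots> \<le> q ^ n / (1 - q) + q ^ n / (1 - q)"
    by (intro add_mono part) (auto simp: inj_on_def)
  also have "\<dots> = geo_const * 2 powr (- real n / 2)"
    by (simp add: geo_const_def qp q_def[symmetric])
  finally show ?thesis .
qed

lemma shifted_tail_sum:
  fixes I :: "int set"
  assumes I: "finite I" "\<And>i. i \<in> I \<Longrightarrow> int n \<le> \<bar>k - i\<bar>"
  shows "(\<Sum>i\<in>I. decay (k - i)) \<le> geo_const * 2 powr (- real n / 2)"
proof -
  have inj: "inj_on (\<lambda>i. k - i) I" by (auto simp: inj_on_def)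
  have "(\<Sum>i\<in>(\<lambda>i. k - i) ` I. decay i) \<le> geo_const * 2 powr (- real n / 2)"
    by (rule two_sided_tail_sum) (use I in auto)
  then show ?thesis by (simp only: sum.reindex[OF inj] comp_def)
qed

section \<open>Level blocks of functions and of operators\<close>

context weighted_symmetric_space
begin

lemma lev_bounds:
  assumes "t \<in> lev k"
  shows "pow2 k \<le> w t" "w t < 2 * pow2 k"
proof -
  have "2 powi k = pow2 k" by (subst powr_real_of_int') auto
  moreover have "(2::real) powi (k + 1) = 2 * 2 powi k" by (simp add: power_int_add)
  ultimately show "pow2 k \<le> w t" "w t < 2 * pow2 k"
    using assms by (auto simp: level_set_def)
qed

lemma supported_single_Xw:
  assumes g: "g \<in> supported {l}"
  shows "g \<in> carr Xw" "nrm Xw g \<le> 2 * pow2 l * nrm X g"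
proof -
  have gX: "g \<in> carr X" by (rule supported_carr[OF g])
  note [measurable] = carr_measurable[OF gX]
  have le: "AE t in leb01. \<bar>w t * g t\<bar> \<le> \<bar>2 * pow2 l * g t\<bar>"
  proof (rule AE_I2)
    fix t
    show "\<bar>w t * g t\<bar> \<le> \<bar>2 * pow2 l * g t\<bar>"
    proof (cases "t \<in> lev l")
      case True
      have "0 < pow2 l" by simp
      then have "\<bar>w t\<bar> \<le> 2 * pow2 l" using lev_bounds[OF True] by linarith
      then have "\<bar>w t\<bar> * \<bar>g t\<bar> \<le> 2 * pow2 l * \<bar>g t\<bar>" by (intro mult_right_mono) auto
      then show ?thesis by (simp add: abs_mult)
    next
      case False
      then show ?thesis using g by (simp add: supported_def)
    qed
  qed
  have m: "(\<lambda>t. w t * g t) \<in> borel_measurable leb01" by measurable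
  show "g \<in> carr Xw" unfolding Xw_iff using carr_dominated[OF m carr_scale[OF gX] le] by simp
  show "nrm Xw g \<le> 2 * pow2 l * nrm X g"
    unfolding nrm_Xw using nrm_dominated[OF m carr_scale[OF gX] le] by (simp add: nrm_scale[OF gX])
qed

text \<open>On a single level the weight \<open>min 1 (w t)\<close> is bounded away from 0, so the
  sum and \<open>X\<close> have the same functions there.\<close>

lemma proj_XS:
  assumes z: "z \<in> XS"
  shows "proj k z \<in> carr X"
proof (rule carr_dominated)
  have "(\<lambda>t. min 1 (w t) * z t) \<in> carr X" using z by (simp add: XS_iff)
  then show "(\<lambda>t. (1 / min 1 (pow2 k)) * (min 1 (w t) * z t)) \<in> carr X" by (rule carr_scale)
  show "proj k z \<in> borel_measurable leb01" unfolding proj_def using XS_measurable[OF z] by measurable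
  show "AE t in leb01. \<bar>proj k z t\<bar> \<le> \<bar>(1 / min 1 (pow2 k)) * (min 1 (w t) * z t)\<bar>"
  proof (rule AE_I2)
    fix t
    define r where "r = min 1 (pow2 k)"
    have r: "0 < r" by (simp add: r_def)
    show "\<bar>proj k z t\<bar> \<le> \<bar>(1 / min 1 (pow2 k)) * (min 1 (w t) * z t)\<bar>"
    proof (cases "t \<in> lev k")
      case True
      have "r \<le> \<bar>min 1 (w t)\<bar>" using lev_bounds[OF True] by (auto simp: r_def)
      then have "r * \<bar>z t\<bar> \<le> \<bar>min 1 (w t)\<bar> * \<bar>z t\<bar>" by (intro mult_right_mono) auto
      then have "\<bar>z t\<bar> \<le> 1 / r * (\<bar>min 1 (w t)\<bar> * \<bar>z t\<bar>)" using r by (simp add: field_simps)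
      then show ?thesis using True r by (simp add: proj_apply abs_mult r_def[symmetric])
    qed (simp add: proj_apply)
  qed
qed

lemma nrm_proj_Xw:
  assumes z: "z \<in> carr Xw"
  shows "nrm X (proj k z) \<le> 2 powr (- real_of_int k) * nrm Xw z"
proof -
  have wz: "(\<lambda>t. w t * z t) \<in> carr X" "z \<in> borel_measurable leb01" using z by (auto simp: Xw_iff)
  have "nrm X (proj k z) \<le> nrm X (\<lambda>t. 2 powr (- real_of_int k) * (w t * z t))"
  proof (rule nrm_dominated[OF _ carr_scale[OF wz(1)]])
    show "proj k z \<in> borel_measurable leb01" unfolding proj_def using wz(2) by measurable
    show "AE t in leb01. \<bar>proj k z t\<bar> \<le> \<bar>2 powr (- real_of_int k) * (w t * z t)\<bar>"
    proof (rule AE_I2)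
      fix t
      show "\<bar>proj k z t\<bar> \<le> \<bar>2 powr (- real_of_int k) * (w t * z t)\<bar>"
      proof (cases "t \<in> lev k")
        case True
        have "0 < pow2 k" by simp
        then have "pow2 k * \<bar>z t\<bar> \<le> \<bar>w t\<bar> * \<bar>z t\<bar>"
          using lev_bounds(1)[OF True] by (intro mult_right_mono) auto
        then show ?thesis using True by (simp add: proj_apply abs_mult powr_minus field_simps)
      qed (simp add: proj_apply)
    qed
  qed
  then show ?thesis using nrm_scale[OF wz(1), of "2 powr (- real_of_int k)"] by (simp add: nrm_Xw)
qed

text \<open>Interpolating the bounds on \<open>X\<close> and on \<open>X(w)\<close>, the matrix of an operator with respect to the
  levels decays exponentially off the diagonal after conjugation by \<open>2 powr (k / 2)\<close>.\<close>

lemma op_matrix_decay: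
  assumes T: "op_bound 1 T" and g: "g \<in> supported {l}"
  shows "nrm X (proj k (T g)) \<le> 2 * 2 powr (real_of_int (l - k) / 2) * decay (k - l) * nrm X g"
\<comment> \<open>For \<open>k \<le> l\<close> the two powers on the right cancel and the bound in
  \<open>X\<close> suffices. For \<open>k > l\<close> their product is
  \<open>2 powr (l - k)\<close>, which is what the bound in \<open>X(w)\<close> provides.\<close>
proof (cases "k \<le> l")
  case True
  have gX: "g \<in> carr X" by (rule supported_carr[OF g])
  have "nrm X (proj k (T g)) \<le> nrm X g"
    using nrm_proj[of "T g" k] op_X[OF T gX] by auto
  also have "\<dots> \<le> 2 * nrm X g" using nrm_nonneg[OF gX] by simp
  also have "2 = 2 * 2 powr (real_of_int (l - k) / 2) * decay (k - l)"
    using True by (simp add: mult.assoc powr_add[symmetric] add_divide_distrib[symmetric])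
  finally show ?thesis .
next
  case False
  have "nrm X (proj k (T g)) \<le> 2 powr (- real_of_int k) * nrm Xw (T g)"
    using op_Xw[OF T supported_single_Xw(1)[OF g]] by (intro nrm_proj_Xw) auto
  also have "\<dots> \<le> 2 powr (- real_of_int k) * (2 * pow2 l * nrm X g)"
    using op_Xw[OF T supported_single_Xw(1)[OF g]] supported_single_Xw(2)[OF g] by (intro mult_left_mono) auto
  also have "\<dots> = 2 * (2 powr (- real_of_int k) * pow2 l) * nrm X g" by simp
  also have "2 powr (- real_of_int k) * pow2 l = 2 powr (real_of_int (l - k) / 2) * decay (k - l)"
  proof -
    have "- real_of_int k + real_of_int l = real_of_int (l - k) / 2 + - \<bar>real_of_int (k - l)\<bar> / 2"
      using False by (simp add: abs_if)
    then show ?thesis unfolding powr_add[symmetric] by presburger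
  qed
  finally show ?thesis by (simp add: mult.assoc)
qed

lemma supported_single_proj: "x \<in> carr X \<Longrightarrow> proj l x \<in> supported {l}"
  by (rule proj_supported) auto

definition level_mult :: "int set \<Rightarrow> (int \<Rightarrow> real) \<Rightarrow> (real \<Rightarrow> real) \<Rightarrow> real \<Rightarrow> real" where
  "level_mult F a z t = (\<Sum>k\<in>F. a k * proj k z t)"

lemma level_mult_on_level:
  assumes "finite F" "l \<in> F" "t \<in> lev l"
  shows "level_mult F a z t = a l * z t"
proof -
  have "a k * proj k z t = (if k = l then a l * z t else 0)" for k
    unfolding proj_apply using lev_disjoint assms(3) by (metis mult_zero_right)
  then show ?thesis unfolding level_mult_def using assms by simp
qed

lemma level_mult_off_levels: "t \<notin> (\<Union>k\<in>F. lev k) \<Longrightarrow> level_mult F a z t = 0"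
  unfolding level_mult_def by (intro sum.neutral) (auto simp: proj_apply)

lemma level_mult_supported: "z \<in> XS \<Longrightarrow> level_mult F a z \<in> supported F"
  using carr_sum[of F "\<lambda>k t. a k * proj k z t"] carr_scale[OF proj_XS[of z]] level_mult_off_levels
  by (auto simp: supported_def level_mult_def[abs_def])

lemma level_mult_X: "z \<in> XS \<Longrightarrow> level_mult F a z \<in> carr X"
  by (rule supported_carr[OF level_mult_supported])

lemma abs_level_mult_le:
  assumes "finite F" "\<And>k. \<bar>a k\<bar> \<le> 1"
  shows "\<bar>level_mult F a z t\<bar> \<le> \<bar>z t\<bar>"
proof (cases "t \<in> (\<Union>k\<in>F. lev k)")
  case True
  then obtain k where "k \<in> F" "t \<in> lev k" by blast
  then have "\<bar>level_mult F a z t\<bar> = \<bar>a k\<bar> * \<bar>z t\<bar>"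
    by (simp add: level_mult_on_level[OF assms(1)] abs_mult)
  also have "\<dots> \<le> 1 * \<bar>z t\<bar>" by (intro mult_right_mono assms(2)) simp
  finally show ?thesis by simp
qed (simp add: level_mult_off_levels)

lemma nrm_level_mult_le:
  assumes "z \<in> XS"
  shows "nrm X (level_mult F a z) \<le> (\<Sum>k\<in>F. \<bar>a k\<bar> * nrm X (proj k z))"
proof -
  have "nrm X (\<lambda>t. \<Sum>k\<in>F. a k * proj k z t) \<le> (\<Sum>k\<in>F. nrm X (\<lambda>t. a k * proj k z t))"
    by (intro nrm_sum carr_scale proj_XS assms)
  then show ?thesis unfolding level_mult_def[abs_def] by (simp add: nrm_scale[OF proj_XS[OF assms]])
qed

text \<open>Averaging over changes of sign on the levels removes the off-diagonal part of an operator
  without increasing its norm.\<close>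

lemma nrm_diagonal_le:
  assumes T: "op_bound 1 T" and F: "finite F" and x: "x \<in> supported F"
  shows "nrm X (\<lambda>t. \<Sum>k\<in>F. proj k (T (proj k x)) t) \<le> nrm X x"
proof -
  define a where "a k l = proj k (T (proj l x))" for k l
  have xX: "x \<in> carr X" by (rule supported_carr[OF x])
  have aX: "a k l \<in> carr X" for k l unfolding a_def using op_X[OF T carr_proj[OF xX]] by (intro carr_proj) auto
  \<comment> \<open>\<open>K\<close> holds the levels whose signs have been averaged out: an
    off-diagonal block survives only if both its indices lie outside \<open>K\<close>. For empty
    \<open>K\<close> this is the operator with the signs applied before and after it, for
    \<open>K = F\<close> its diagonal.\<close>
  define S where "S K \<sigma> t = (\<Sum>k\<in>F. \<Sum>l\<in>F. (if k = l \<or> (k \<notin> K \<and> l \<notin> K) then \<sigma> k * \<sigma> l else 0) * a k l t)"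
    for K :: "int set" and \<sigma> :: "int \<Rightarrow> real" and t
  have SX: "S K \<sigma> \<in> carr X" for K \<sigma>
    unfolding S_def[abs_def] by (intro carr_sum carr_scale aX)
  have base: "nrm X (S {} \<sigma>) \<le> nrm X x" if \<sigma>: "\<And>k. \<bar>\<sigma> k\<bar> = 1" for \<sigma>
  proof -
    have \<sigma>1: "\<bar>\<sigma> k\<bar> \<le> 1" for k using \<sigma> by simp
    define y where "y = level_mult F \<sigma> x"
    have yX: "y \<in> carr X" unfolding y_def by (intro level_mult_X XS_X xX)
    have ny: "nrm X y \<le> nrm X x"
      unfolding y_def using abs_level_mult_le[OF F \<sigma>1]
      by (intro nrm_dominated[OF carr_measurable[OF level_mult_X[OF XS_X[OF xX]]] xX] AE_I2)
    have Ty: "T y \<in> carr X" "nrm X (T y) \<le> nrm X y" using op_X[OF T yX] by auto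
    have "AE t in leb01. T y t = (\<Sum>l\<in>F. T (\<lambda>t. \<sigma> l * proj l x t) t)"
      unfolding y_def level_mult_def[abs_def] by (rule op_sum[OF T]) (intro XS_scale XS_X carr_proj xX)
    moreover have "AE t in leb01. \<forall>l\<in>F. T (\<lambda>t. \<sigma> l * proj l x t) t = \<sigma> l * T (proj l x) t"
      using F by (intro AE_finite_allI op_scale[OF T] XS_X carr_proj xX)
    ultimately have "AE t in leb01. \<bar>S {} \<sigma> t\<bar> \<le> \<bar>T y t\<bar>"
    proof eventually_elim
      case (elim t)
      have Ty_t: "T y t = (\<Sum>l\<in>F. \<sigma> l * T (proj l x) t)" using elim by simp
      have "S {} \<sigma> t = level_mult F \<sigma> (T y) t"
        unfolding S_def a_def level_mult_def proj_def Ty_t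
        by (intro sum.cong refl) (simp add: sum_distrib_left mult_ac)
      then show ?case using abs_level_mult_le[OF F \<sigma>1] by simp
    qed
    then have "nrm X (S {} \<sigma>) \<le> nrm X (T y)" by (rule nrm_dominated[OF carr_measurable[OF SX] Ty(1)])
    then show ?thesis using Ty(2) ny by simp
  qed
  have step: "nrm X (S K \<sigma>) \<le> nrm X x" if "finite K" "\<And>k. \<bar>\<sigma> k\<bar> = 1" for K \<sigma>
    using that
  proof (induction K arbitrary: \<sigma> rule: finite_induct)
    case empty
    then show ?case using base by simp
  next
    case (insert j K)
    define \<tau> where "\<tau> = \<sigma>(j := - \<sigma> j)"
    have \<tau>: "\<bar>\<tau> k\<bar> = 1" for k using insert.prems by (simp add: \<tau>_def)
    \<comment> \<open>Flipping the sign at \<open>j\<close> negates exactly the remaining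
      off-diagonal blocks in row or column \<open>j\<close>, so the mean deletes them; the block at
      \<open>(j, j)\<close> carries the square of the sign.\<close>
    have "S (insert j K) \<sigma> t = (1/2) * (S K \<sigma> t + S K \<tau> t)" for t
      unfolding S_def sum.distrib[symmetric] sum_distrib_left
      by (intro sum.cong refl) (auto simp: \<tau>_def algebra_simps)
    then have "nrm X (S (insert j K) \<sigma>) = nrm X (\<lambda>t. (1/2) * (S K \<sigma> t + S K \<tau> t))" by presburger
    also have "\<dots> = (1/2) * nrm X (\<lambda>t. S K \<sigma> t + S K \<tau> t)"
      by (subst nrm_scale) (auto intro: carr_add SX)
    also have "\<dots> \<le> (1/2) * (nrm X (S K \<sigma>) + nrm X (S K \<tau>))" by (intro mult_left_mono nrm_add SX) auto
    also have "\<dots> \<le> (1/2) * (nrm X x + nrm X x)"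
      using insert.IH[of \<sigma>] insert.IH[of \<tau>] insert.prems \<tau> by (intro mult_left_mono add_mono) auto
    finally show ?case by simp
  qed
  have "S F (\<lambda>_. 1) t = (\<Sum>k\<in>F. proj k (T (proj k x)) t)" for t
  proof -
    have "S F (\<lambda>_. 1) t = (\<Sum>k\<in>F. \<Sum>l\<in>F. if k = l then a k l t else 0)"
      unfolding S_def by (intro sum.cong refl) auto
    then show ?thesis using F by (simp add: a_def)
  qed
  then have "S F (\<lambda>_. 1) = (\<lambda>t. \<Sum>k\<in>F. proj k (T (proj k x)) t)" by (rule ext)
  then show ?thesis using step[OF F, of "\<lambda>_. 1"] by simp
qed

end

section \<open>Sequences violating level decomposability\<close>

lemma powr_half_split:
  fixes k m :: int
  shows "m \<le> k \<Longrightarrow> half_pow k = half_pow m * decay (m - k)"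
    and "k \<le> m \<Longrightarrow> root_pow k = root_pow m * decay (m - k)"
proof -
  assume "m \<le> k"
  then have a: "\<bar>real_of_int (m - k)\<bar> = real_of_int k - real_of_int m" by simp
  have e: "- real_of_int k / 2 = - real_of_int m / 2 + - \<bar>real_of_int (m - k)\<bar> / 2" unfolding a by (simp add: field_simps)
  show "half_pow k = half_pow m * decay (m - k)"
    by (subst e) (rule powr_add)
next
  assume "k \<le> m"
  then have a: "\<bar>real_of_int (m - k)\<bar> = real_of_int m - real_of_int k" by simp
  have e: "real_of_int k / 2 = real_of_int m / 2 + - \<bar>real_of_int (m - k)\<bar> / 2" unfolding a by (simp add: field_simps)
  show "root_pow k = root_pow m * decay (m - k)"
    by (subst e) (rule powr_add)
qed

section \<open>K-functionals of sums of level blocks\<close>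

context weighted_symmetric_space
begin

text \<open>Crude, but for a fixed finite \<open>F\<close> it makes the norms of all functions
  dominated by \<open>x\<close> bounded.\<close>

lemma level_dominated_bound:
  assumes "finite F" "level_dominated F x y"
  shows "nrm X y \<le> (\<Sum>k\<in>F. nrm X (proj k x))"
proof -
  have "nrm X y \<le> (\<Sum>k\<in>F. nrm X (proj k y))"
    using assms by (intro nrm_le_sum_proj) (auto simp: level_dominated_def)
  also have "\<dots> \<le> (\<Sum>k\<in>F. nrm X (proj k x))"
    using assms by (intro sum_mono) (auto simp: level_dominated_def)
  finally show ?thesis .
qed

text \<open>Levels with \<open>s * pow2 k > 1\<close> go to \<open>X\<close>, the others to
  \<open>X(w)\<close>. The first sum is geometric and dominated by its lowest level, the second by
  its highest, and each of these two levels is covered by \<mu>. The constant 3 is 1 for the part in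
  \<open>X\<close> plus 2 for the part in \<open>X(w)\<close>, as \<open>w\<close> stays below
  \<open>2 * pow2 k\<close> on level \<open>k\<close>.\<close>

lemma level_sum_K_le:
  assumes F: "finite F" and y: "y \<in> carr X" and s: "0 < s"
    and \<mu>: "\<And>k. k \<in> F \<Longrightarrow> b k \<noteq> 0 \<Longrightarrow> min 1 (s * pow2 k) * half_pow k \<le> \<mu>"
    and b: "\<And>k. k \<in> F \<Longrightarrow> \<bar>b k\<bar> * nrm X (proj k y) \<le> half_pow k" and "0 \<le> \<mu>"
  shows "K_functional s (level_mult F b y) X Xw \<le> 3 * geo_const * \<mu>"
proof -
  define P where "P = {k\<in>F. b k \<noteq> 0 \<and> s * pow2 k > 1}"
  define Q where "Q = {k\<in>F. b k \<noteq> 0 \<and> s * pow2 k \<le> 1}"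
  have fin: "finite P" "finite Q" using F by (auto simp: P_def Q_def)
  have yS: "y \<in> XS" by (rule XS_X[OF y])
  have split: "level_mult F b y t = level_mult P b y t + level_mult Q b y t" for t
  proof -
    have "level_mult F b y t = (\<Sum>k\<in>P \<union> Q. b k * proj k y t)"
      unfolding level_mult_def by (rule sum.mono_neutral_right) (auto simp: F P_def Q_def)
    also have "\<dots> = level_mult P b y t + level_mult Q b y t"
      unfolding level_mult_def by (rule sum.union_disjoint) (use fin in \<open>auto simp: P_def Q_def\<close>)
    finally show ?thesis .
  qed
  have sP: "(\<Sum>k\<in>P. half_pow k) \<le> geo_const * \<mu>"
  proof (cases "P = {}")
    case False
    define m where "m = Min P"
    have m: "m \<in> P" "\<And>k. k \<in> P \<Longrightarrow> m \<le> k" using fin False by (auto simp: m_def)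
    have "(\<Sum>k\<in>P. half_pow k) = half_pow m * (\<Sum>k\<in>P. decay (m - k))"
      unfolding sum_distrib_left by (intro sum.cong refl powr_half_split m(2))
    also have "\<dots> \<le> half_pow m * (geo_const * 2 powr (- real 0 / 2))"
      by (intro mult_left_mono shifted_tail_sum fin) auto
    also have "\<dots> = geo_const * half_pow m" by simp
    also have "\<dots> \<le> geo_const * \<mu>"
      using \<mu>[of m] m(1) geo_const_pos by (intro mult_left_mono) (auto simp: P_def)
    finally show ?thesis .
  qed (use geo_const_pos \<open>0 \<le> \<mu>\<close> in simp)
  have sQ: "s * (\<Sum>k\<in>Q. root_pow k) \<le> geo_const * \<mu>"
  proof (cases "Q = {}")
    case False
    define m where "m = Max Q"
    have m: "m \<in> Q" "\<And>k. k \<in> Q \<Longrightarrow> k \<le> m" using fin False by (auto simp: m_def)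
    have "(\<Sum>k\<in>Q. root_pow k) = root_pow m * (\<Sum>k\<in>Q. decay (m - k))"
      unfolding sum_distrib_left by (intro sum.cong refl powr_half_split m(2))
    also have "\<dots> \<le> root_pow m * (geo_const * 2 powr (- real 0 / 2))"
      by (intro mult_left_mono shifted_tail_sum fin) auto
    finally have "s * (\<Sum>k\<in>Q. root_pow k) \<le> s * (root_pow m * (geo_const * 2 powr (- real 0 / 2)))"
      using s by (intro mult_left_mono) auto
    also have "\<dots> = geo_const * (s * pow2 m * half_pow m)"
      by (simp add: mult.assoc powr_add[symmetric])
    also have "\<dots> \<le> geo_const * \<mu>"
      using \<mu>[of m] m(1) geo_const_pos by (intro mult_left_mono) (auto simp: Q_def min_def split: if_splits)
    finally show ?thesis .
  qed (use geo_const_pos \<open>0 \<le> \<mu>\<close> in simp)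
  have nP: "nrm X (level_mult P b y) \<le> (\<Sum>k\<in>P. half_pow k)"
    using nrm_level_mult_le[OF yS, of P b] b
    by (rule order_trans[OF _ sum_mono]) (auto simp: P_def)
  have pw: "proj k y \<in> carr Xw" "nrm Xw (proj k y) \<le> 2 * pow2 k * nrm X (proj k y)" for k
    using supported_single_Xw[OF supported_single_proj[OF y]] by auto
  have wX: "(\<lambda>t. w t * proj k y t) \<in> carr X" for k using pw by (simp add: Xw_iff)
  have eqw: "(\<lambda>t. w t * level_mult Q b y t) = (\<lambda>t. \<Sum>k\<in>Q. b k * (w t * proj k y t))"
    unfolding level_mult_def by (auto simp: sum_distrib_left mult_ac)
  have Qw: "level_mult Q b y \<in> carr Xw"
    unfolding Xw_iff eqw using carr_measurable[OF level_mult_X[OF yS]] by (auto intro!: carr_sum carr_scale wX)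
  have "nrm Xw (level_mult Q b y) \<le> (\<Sum>k\<in>Q. nrm X (\<lambda>t. b k * (w t * proj k y t)))"
    unfolding nrm_Xw eqw by (intro nrm_sum carr_scale wX)
  also have "\<dots> \<le> (\<Sum>k\<in>Q. 2 * root_pow k)"
  proof (rule sum_mono)
    fix k assume k: "k \<in> Q"
    have "nrm X (\<lambda>t. b k * (w t * proj k y t)) = \<bar>b k\<bar> * nrm Xw (proj k y)"
      by (simp add: nrm_scale[OF wX] nrm_Xw)
    also have "\<dots> \<le> \<bar>b k\<bar> * (2 * pow2 k * nrm X (proj k y))"
      by (intro mult_left_mono pw) auto
    also have "\<dots> = 2 * pow2 k * (\<bar>b k\<bar> * nrm X (proj k y))" by simp
    also have "\<dots> \<le> 2 * pow2 k * half_pow k"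
      using b[of k] k by (intro mult_left_mono) (auto simp: Q_def)
    also have "\<dots> = 2 * root_pow k" by (simp add: mult.assoc powr_add[symmetric])
    finally show "nrm X (\<lambda>t. b k * (w t * proj k y t)) \<le> 2 * root_pow k" .
  qed
  finally have nQ: "nrm Xw (level_mult Q b y) \<le> 2 * (\<Sum>k\<in>Q. root_pow k)"
    by (simp add: sum_distrib_left)
  have "K_functional s (level_mult F b y) X Xw \<le> nrm X (level_mult P b y) + s * nrm Xw (level_mult Q b y)"
    by (rule K_le[OF s level_mult_X[OF yS] Qw]) (simp add: split)
  also have "\<dots> \<le> geo_const * \<mu> + s * (2 * (\<Sum>k\<in>Q. root_pow k))"
    using nP sP nQ s by (intro add_mono mult_left_mono) auto
  also have "\<dots> \<le> geo_const * \<mu> + 2 * (geo_const * \<mu>)" using sQ by simp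
  finally show ?thesis by simp
qed

end

text \<open>Read with \<open>m\<close> and \<open>n\<close> exchanged, \<open>sep\<close> gives a
  gap of at least the larger of the two indices. Only the functions \<open>x n\<close> are fixed
  here; their competitors enter through a supremum.\<close>

locale bad_sequence = weighted_symmetric_space +
  fixes F :: "nat \<Rightarrow> int set" and x :: "nat \<Rightarrow> real \<Rightarrow> real"
  assumes fin: "\<And>n. finite (F n)"
    and disj: "\<And>m n. m \<noteq> n \<Longrightarrow> F m \<inter> F n = {}"
    and sep: "\<And>m n k l. k \<in> F m \<Longrightarrow> l \<in> F n \<Longrightarrow> k \<noteq> l \<Longrightarrow> int m \<le> \<bar>k - l\<bar>"
    and x_supp: "\<And>n. x n \<in> supported (F n)"
    and x_nrm: "\<And>n. nrm X (x n) = 1"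
begin

definition \<alpha> :: "nat \<Rightarrow> int \<Rightarrow> real" where "\<alpha> n k = nrm X (proj k (x n))"

text \<open>The failure of level decomposability at \<open>x n\<close>: finite for every
  \<open>n\<close>, with no uniform bound known beforehand.\<close>

definition \<Lambda> :: "nat \<Rightarrow> real" where
  "\<Lambda> n = Sup (nrm X ` Collect (level_dominated (F n) (x n)))"

text \<open>The bound of \<open>shifted_tail_sum\<close> for indices at distance at least
  \<open>n\<close>.\<close>

definition \<delta> :: "nat \<Rightarrow> real" where "\<delta> n = geo_const * 2 powr (- real n / 2)"

text \<open>The diagonal part of a contraction will contribute at most 1 and the off-diagonal part
  at most \<open>2 * \<delta> n * \<Lambda> n\<close>; this factor brings their sum down to
  1.\<close>

definition \<epsilon> :: "nat \<Rightarrow> real" where "\<epsilon> n = 1 / (1 + 2 * \<delta> n * \<Lambda> n)"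

definition up :: "nat \<Rightarrow> int \<Rightarrow> real" where "up n k = \<alpha> n k * root_pow k"

text \<open>On a level where \<open>x n\<close> vanishes the division by zero makes \<open>down n k = 0\<close>.\<close>

definition down :: "nat \<Rightarrow> int \<Rightarrow> real" where "down n k = half_pow k / \<alpha> n k"

text \<open>Multiplication by this function undoes \<open>down n\<close> on the levels where
  \<open>x n\<close> does not vanish, up to the factor \<epsilon> n. It is obtained by applying the
  level multiplier to the constant 1.\<close>

definition v :: "nat \<Rightarrow> real \<Rightarrow> real" where "v n t = \<epsilon> n * level_mult (F n) (up n) (\<lambda>_. 1) t"

definition xh :: "nat \<Rightarrow> real \<Rightarrow> real" where "xh n = level_mult (F n) (down n) (x n)"

lemma xX: "x n \<in> carr X"
  by (rule supported_carr[OF x_supp])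

lemma \<alpha>_bounds: "0 \<le> \<alpha> n k" "\<alpha> n k \<le> 1"
  unfolding \<alpha>_def using nrm_nonneg[OF carr_proj[OF xX]] nrm_proj[OF xX, of k n] by (auto simp: x_nrm)

lemma \<delta>_pos: "0 < \<delta> n"
  unfolding \<delta>_def using geo_const_pos by simp

lemma \<Lambda>_upper: "level_dominated (F n) (x n) y \<Longrightarrow> nrm X y \<le> \<Lambda> n"
  unfolding \<Lambda>_def using level_dominated_bound[OF fin]
  by (intro cSup_upper) (auto intro!: bdd_aboveI2)

lemma \<Lambda>_ge_1: "1 \<le> \<Lambda> n"
  using \<Lambda>_upper[of n "x n"] x_supp by (simp add: level_dominated_def x_nrm)

lemma \<epsilon>_bounds: "0 < \<epsilon> n" "\<epsilon> n \<le> 1"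
proof -
  have "0 < 2 * \<delta> n * \<Lambda> n" using \<delta>_pos[of n] \<Lambda>_ge_1[of n] by simp
  then show "0 < \<epsilon> n" "\<epsilon> n \<le> 1" unfolding \<epsilon>_def by (auto simp: field_simps)
qed

lemma down_\<alpha>: "\<bar>down n k\<bar> * \<alpha> n k \<le> half_pow k"
  using \<alpha>_bounds[of n k] by (cases "\<alpha> n k = 0") (auto simp: down_def)

lemma v_mult_eq: "v n t * z t = \<epsilon> n * level_mult (F n) (up n) z t"
  by (simp add: v_def level_mult_def proj_def sum_distrib_left sum_distrib_right mult_ac)

text \<open>The first constant is crude: on level \<open>k\<close> the weight
  \<open>min 1 (w t)\<close> is at least \<open>min 1 (pow2 k)\<close>. The second has to be
  independent of \<open>m\<close>: for \<open>z\<close> in the intersection the norm on level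
  \<open>k\<close> is at most \<open>min 1 (2 powr (- k))\<close> times the norm of
  \<open>z\<close>, and the factor \<open>root_pow k\<close> leaves the summable sequence
  \<open>decay k\<close>.\<close>

sublocale coorbit X w v "\<lambda>n. \<Sum>k\<in>F n. up n k / min 1 (pow2 k)" geo_const
proof
  fix m
  have one: "(\<lambda>_. 1) \<in> XS" by (rule XS_X[OF carr_one])
  show "v m \<in> borel_measurable leb01"
    unfolding v_def[abs_def] using carr_measurable[OF carr_scale[OF level_mult_X[OF one]]] .
  have up0: "0 \<le> up m k" for k using \<alpha>_bounds(1)[of m k] by (simp add: up_def)
  have term0: "0 \<le> up m k / min 1 (pow2 k)" for k using up0[of k] by (intro divide_nonneg_pos) auto
  show "AE t in leb01. \<bar>v m t\<bar> \<le> (\<Sum>k\<in>F m. up m k / min 1 (pow2 k)) * min 1 (w t)"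
    using w_pos
  proof eventually_elim
    case (elim t)
    have S0: "0 \<le> (\<Sum>k\<in>F m. up m k / min 1 (pow2 k))" using term0 by (intro sum_nonneg) auto
    show ?case
    proof (cases "\<exists>k\<in>F m. t \<in> lev k")
      case True
      then obtain k where k: "k \<in> F m" "t \<in> lev k" by blast
      define r where "r = min 1 (pow2 k)"
      have r: "0 < r" "r \<le> min 1 (w t)" using lev_bounds[OF k(2)] by (auto simp: r_def)
      have "\<bar>v m t\<bar> = \<epsilon> m * up m k"
        using level_mult_on_level[OF fin k] \<epsilon>_bounds(1)[of m] up0[of k] by (simp add: v_def abs_mult)
      also have "\<dots> \<le> 1 * up m k" using \<epsilon>_bounds(2) up0 by (intro mult_right_mono) auto
      also have "\<dots> = up m k / r * r" using r by simp
      also have "\<dots> \<le> up m k / r * min 1 (w t)" using r up0[of k] by (intro mult_left_mono divide_nonneg_pos) auto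
      also have "\<dots> \<le> (\<Sum>k\<in>F m. up m k / min 1 (pow2 k)) * min 1 (w t)"
        unfolding r_def using term0 elim fin k(1)
        by (intro mult_right_mono member_le_sum[of k "F m" "\<lambda>k. up m k / min 1 (pow2 k)"]) auto
      finally show ?thesis .
    next
      case False
      then have "v m t = 0" using level_mult_off_levels[of t "F m"] by (simp add: v_def)
      then show ?thesis using S0 elim by simp
    qed
  qed
  fix z assume z: "z \<in> carr X" "z \<in> carr Xw"
  define M where "M = max (nrm X z) (nrm Xw z)"
  have M: "0 \<le> M" "nrm X z \<le> M" "nrm Xw z \<le> M" using nrm_nonneg[OF z(1)] by (auto simp: M_def)
  have zS: "z \<in> XS" by (rule XS_X[OF z(1)])
  have "nrm X (\<lambda>t. v m t * z t) = \<epsilon> m * nrm X (level_mult (F m) (up m) z)"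
    unfolding v_mult_eq using nrm_scale[OF level_mult_X[OF zS]] \<epsilon>_bounds(1)[of m] by simp
  also have "\<dots> \<le> 1 * nrm X (level_mult (F m) (up m) z)"
    using \<epsilon>_bounds(2) nrm_nonneg[OF level_mult_X[OF zS]] by (intro mult_right_mono) auto
  also have "\<dots> \<le> (\<Sum>k\<in>F m. \<bar>up m k\<bar> * nrm X (proj k z))" using nrm_level_mult_le[OF zS] by simp
  also have "\<dots> \<le> (\<Sum>k\<in>F m. decay k * M)"
  proof (rule sum_mono)
    fix k assume "k \<in> F m"
    have n0: "0 \<le> nrm X (proj k z)" by (rule nrm_nonneg[OF carr_proj[OF z(1)]])
    have "\<bar>up m k\<bar> * nrm X (proj k z) \<le> root_pow k * nrm X (proj k z)"
      using \<alpha>_bounds[of m k] n0 by (intro mult_right_mono) (auto simp: up_def abs_mult mult_left_le_one_le)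
    also have "\<dots> \<le> decay k * M"
    proof (cases "k \<le> 0")
      case True
      have "nrm X (proj k z) \<le> M" using nrm_proj[OF z(1), of k] M(2) by linarith
      then show ?thesis using True by (simp add: mult_left_mono)
    next
      case False
      have "nrm X (proj k z) \<le> 2 powr (- real_of_int k) * M"
        by (rule order_trans[OF nrm_proj_Xw[OF z(2)] mult_left_mono[OF M(3)]]) simp
      then have "root_pow k * nrm X (proj k z) \<le> root_pow k * (2 powr (- real_of_int k) * M)"
        by (intro mult_left_mono) auto
      also have "\<dots> = decay k * M"
      proof -
        have "- \<bar>real_of_int k\<bar> / 2 = real_of_int k / 2 + - real_of_int k" using False by simp
        then show ?thesis by (simp only: powr_add mult.assoc)
      qed
      finally show ?thesis .
    qed
    finally show "\<bar>up m k\<bar> * nrm X (proj k z) \<le> decay k * M" .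
  qed
  also have "\<dots> = (\<Sum>k\<in>F m. decay k) * M" by (simp add: sum_distrib_right)
  also have "\<dots> \<le> (geo_const * 2 powr (- real 0 / 2)) * M"
    using M(1) by (intro mult_right_mono two_sided_tail_sum fin) auto
  finally show "nrm X (\<lambda>t. v m t * z t) \<le> geo_const * max (nrm X z) (nrm Xw z)" by (simp add: M_def)
qed

lemma V_eq: "z \<in> XS \<Longrightarrow> op_bound 1 T \<Longrightarrow> V m T z = \<epsilon> m * nrm X (level_mult (F m) (up m) (T z))"
  unfolding V_def v_mult_eq using nrm_scale[OF level_mult_X[OF op_XS]] \<epsilon>_bounds(1)[of m] by simp

lemma xh_X: "xh n \<in> carr X"
  unfolding xh_def by (rule level_mult_X[OF XS_X[OF xX]])

text \<open>Divided by \<open>2 * \<delta> m\<close>, the off-diagonal part is dominated by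
  \<open>x m\<close> on every level, hence is a competitor in the supremum \<Lambda> m. Summing its
  level norms instead would lose all uniformity.\<close>

lemma off_diagonal_bound:
  assumes T: "op_bound 1 T"
  shows "nrm X (\<lambda>t. \<Sum>k\<in>F m. up m k * (\<Sum>l\<in>F n - {k}. down n l * proj k (T (proj l (x n))) t)) \<le> 2 * \<delta> m * \<Lambda> m"
proof -
  define g where "g k t = (\<Sum>l\<in>F n - {k}. down n l * T (proj l (x n)) t)" for k t
  have gX: "g k \<in> carr X" for k
    unfolding g_def[abs_def] using op_X[OF T carr_proj[OF xX]] by (intro carr_sum carr_scale) auto
  define h where "h k t = (\<Sum>l\<in>F n - {k}. down n l * proj k (T (proj l (x n))) t)" for k t
  have h_eq: "h k = proj k (g k)" for k
    unfolding h_def g_def proj_def by (auto simp: sum_distrib_left mult_ac)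
  have hX: "h k \<in> carr X" for k unfolding h_eq by (rule carr_proj[OF gX])
  define c where "c = 1 / (2 * \<delta> m)"
  have c: "0 < c" using \<delta>_pos[of m] by (simp add: c_def)
  define y where "y t = (\<Sum>k\<in>F m. (c * up m k) * h k t)" for t
  have yX: "y \<in> carr X" unfolding y_def[abs_def] by (intro carr_sum carr_scale hX)
  have h_out: "h k t = 0" if "t \<notin> lev k" for k t using that by (simp add: h_eq proj_apply)
  have y_supp: "y \<in> supported (F m)"
    using yX h_out by (auto simp: supported_def y_def intro!: sum.neutral)
  have y_proj: "proj l y = (\<lambda>t. (c * up m l) * h l t)" if l: "l \<in> F m" for l
  proof
    fix t
    show "proj l y t = (c * up m l) * h l t"
    proof (cases "t \<in> lev l")
      case True
      have "(c * up m k) * h k t = (if k = l then (c * up m l) * h l t else 0)" for k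
        using h_out lev_disjoint True by (metis mult_zero_right)
      then have "y t = (\<Sum>k\<in>F m. if k = l then (c * up m l) * h l t else 0)"
        unfolding y_def by (rule sum.cong[OF refl])
      then have "y t = (c * up m l) * h l t" using fin[of m] l by simp
      then show ?thesis using True by (simp add: proj_apply)
    next
      case False
      then show ?thesis using h_out by (simp add: proj_apply)
    qed
  qed
  have h_nrm: "nrm X (h k) \<le> 2 * half_pow k * \<delta> m" if k: "k \<in> F m" for k
  proof -
    have pX: "proj k (T (proj l (x n))) \<in> carr X" for l
      using op_X[OF T carr_proj[OF xX]] by (intro carr_proj) auto
    have "nrm X (h k) \<le> (\<Sum>l\<in>F n - {k}. nrm X (\<lambda>t. down n l * proj k (T (proj l (x n))) t))"
      unfolding h_def[abs_def] by (intro nrm_sum carr_scale pX)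
    also have "\<dots> \<le> (\<Sum>l\<in>F n - {k}. 2 * half_pow k * decay (k - l))"
    proof (rule sum_mono)
      fix l assume "l \<in> F n - {k}"
      define d where "d = 2 * 2 powr (real_of_int (l - k) / 2) * decay (k - l)"
      have "nrm X (\<lambda>t. down n l * proj k (T (proj l (x n))) t) = \<bar>down n l\<bar> * nrm X (proj k (T (proj l (x n))))"
        by (rule nrm_scale[OF pX])
      also have "\<dots> \<le> \<bar>down n l\<bar> * (d * \<alpha> n l)"
        unfolding d_def \<alpha>_def by (intro mult_left_mono op_matrix_decay[OF T] supported_single_proj xX) auto
      also have "\<dots> = d * (\<bar>down n l\<bar> * \<alpha> n l)" by simp
      also have "\<dots> \<le> d * half_pow l"
        by (intro mult_left_mono down_\<alpha>) (simp add: d_def)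
      also have "\<dots> = 2 * (2 powr (real_of_int (l - k) / 2) * half_pow l) * decay (k - l)"
        by (simp add: d_def)
      \<comment> \<open>The rescaling matches the matrix estimate: the source level \<open>l\<close>
        survives only in the decay factor, whose sum over levels at distance at least
        \<open>m\<close> is at most \<open>\<delta> m\<close>.\<close>
      also have "2 powr (real_of_int (l - k) / 2) * half_pow l = half_pow k"
      proof -
        have "- real_of_int k / 2 = real_of_int (l - k) / 2 + - real_of_int l / 2" by (simp add: field_simps)
        then show ?thesis by (simp only: powr_add)
      qed
      finally show "nrm X (\<lambda>t. down n l * proj k (T (proj l (x n))) t) \<le>
          2 * half_pow k * decay (k - l)" .
    qed
    also have "\<dots> = 2 * half_pow k * (\<Sum>l\<in>F n - {k}. decay (k - l))"
      by (simp only: sum_distrib_left)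
    also have "\<dots> \<le> 2 * half_pow k * \<delta> m"
      unfolding \<delta>_def using fin[of n] sep[OF k] by (intro mult_left_mono shifted_tail_sum) auto
    finally show ?thesis .
  qed
  have "level_dominated (F m) (x m) y"
    unfolding level_dominated_def
  proof (intro conjI ballI x_supp y_supp)
    fix k assume k: "k \<in> F m"
    have up0: "0 \<le> up m k" using \<alpha>_bounds(1)[of m k] by (simp add: up_def)
    have "nrm X (proj k y) = c * up m k * nrm X (h k)"
      unfolding y_proj[OF k] nrm_scale[OF hX] using c up0 by simp
    also have "\<dots> \<le> c * up m k * (2 * half_pow k * \<delta> m)"
      using c up0 by (intro mult_left_mono h_nrm[OF k]) auto
    also have "\<dots> = (2 * \<delta> m * c) * (up m k * half_pow k)" by simp
    also have "2 * \<delta> m * c = 1" using \<delta>_pos[of m] by (simp add: c_def)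
    also have "up m k * half_pow k = \<alpha> m k"
      by (simp add: up_def mult.assoc powr_add[symmetric])
    finally show "nrm X (proj k y) \<le> nrm X (proj k (x m))" by (simp add: \<alpha>_def)
  qed
  then have "nrm X y \<le> \<Lambda> m" by (rule \<Lambda>_upper)
  moreover have "(\<lambda>t. \<Sum>k\<in>F m. up m k * (\<Sum>l\<in>F n - {k}. down n l * proj k (T (proj l (x n))) t)) = (\<lambda>t. (2 * \<delta> m) * y t)"
    using \<delta>_pos[of m] by (auto simp: y_def h_def c_def sum_distrib_left)
  ultimately show ?thesis
    using nrm_scale[OF yX, of "2 * \<delta> m"] \<delta>_pos[of m] by simp
qed

text \<open>The diagonal part appears only for \<open>m = n\<close>, where \<open>up\<close> and
  \<open>down\<close> cancel and \<open>nrm_diagonal_le\<close> bounds it by the norm of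
  \<open>x n\<close>. The rest is \<open>off_diagonal_bound\<close>, and \<epsilon> m normalises the
  total.\<close>

lemma V_xh_le:
  assumes T: "op_bound 1 T"
  shows "V m T (xh n) \<le> 1"
proof -
  define off where "off t = (\<Sum>k\<in>F m. up m k * (\<Sum>l\<in>F n - {k}. down n l * proj k (T (proj l (x n))) t))" for t
  define diag where "diag t = (if m = n then (\<Sum>k\<in>F m. proj k (T (proj k (x n))) t) else 0)" for t
  have TX: "T (proj l (x n)) \<in> carr X" for l using op_X[OF T carr_proj[OF xX]] by auto
  have offX: "off \<in> carr X" unfolding off_def[abs_def] by (intro carr_sum carr_scale carr_proj TX)
  have diagX: "diag \<in> carr X"
  proof (cases "m = n")
    case True
    then show ?thesis unfolding diag_def[abs_def] using carr_sum[OF carr_proj[OF TX]] by simp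
  next
    case False
    then show ?thesis unfolding diag_def[abs_def] using carr_zero by simp
  qed
  have nd: "nrm X diag \<le> 1"
  proof (cases "m = n")
    case True
    then show ?thesis unfolding diag_def[abs_def]
      using nrm_diagonal_le[OF T fin x_supp, of n] by (simp add: x_nrm)
  next
    case False
    then show ?thesis unfolding diag_def[abs_def] by (simp add: nrm_zero)
  qed
  have pS: "proj l (x n) \<in> XS" for l by (intro XS_X carr_proj xX)
  have "AE t in leb01. T (xh n) t = (\<Sum>l\<in>F n. T (\<lambda>t. down n l * proj l (x n) t) t)"
    unfolding xh_def level_mult_def[abs_def] by (rule op_sum[OF T]) (intro XS_scale pS)
  moreover have "AE t in leb01. \<forall>l\<in>F n. T (\<lambda>t. down n l * proj l (x n) t) t = down n l * T (proj l (x n)) t"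
    using fin by (intro AE_finite_allI op_scale[OF T] pS)
  \<comment> \<open>Where \<alpha> n l = 0 the product of \<open>up\<close> and \<open>down\<close>
    is 0 instead of 1, but there the block of \<open>x n\<close> and its image vanish almost
    everywhere.\<close>
  moreover have "AE t in leb01. \<forall>l\<in>F n. \<alpha> n l = 0 \<longrightarrow> T (proj l (x n)) t = 0"
  proof (intro AE_finite_allI fin)
    fix l
    show "AE t in leb01. \<alpha> n l = 0 \<longrightarrow> T (proj l (x n)) t = 0"
    proof (cases "\<alpha> n l = 0")
      case True
      then have "AE t in leb01. proj l (x n) t = 0"
        using nrm_eq_0_iff[OF carr_proj[OF xX]] by (simp add: \<alpha>_def)
      from op_cong[OF T pS XS_zero this] op_zero[OF T] show ?thesis by eventually_elim simp
    qed simp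
  qed
  ultimately have ae: "AE t in leb01. level_mult (F m) (up m) (T (xh n)) t = diag t + off t"
  proof eventually_elim
    case (elim t)
    have Txh: "T (xh n) t = (\<Sum>l\<in>F n. down n l * T (proj l (x n)) t)" using elim by simp
    have pr: "proj k (T (xh n)) t = (\<Sum>l\<in>F n. down n l * proj k (T (proj l (x n))) t)" for k
      by (simp add: proj_apply Txh)
    have "up m k * proj k (T (xh n)) t = (if m = n then proj k (T (proj k (x n))) t else 0)
        + up m k * (\<Sum>l\<in>F n - {k}. down n l * proj k (T (proj l (x n))) t)" if k: "k \<in> F m" for k
    proof (cases "m = n")
      case True
      have "(\<Sum>l\<in>F n. down n l * proj k (T (proj l (x n))) t) =
          down n k * proj k (T (proj k (x n))) t + (\<Sum>l\<in>F n - {k}. down n l * proj k (T (proj l (x n))) t)"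
        using k True fin by (intro sum.remove) auto
      moreover have "up m k * (down n k * proj k (T (proj k (x n))) t) = proj k (T (proj k (x n))) t"
      proof (cases "\<alpha> n k = 0")
        case True
        then have "proj k (T (proj k (x n))) t = 0" using elim(3) k \<open>m = n\<close> by (simp add: proj_apply)
        then show ?thesis by simp
      next
        case False
        then have "up m k * down n k = root_pow k * half_pow k"
          using True by (simp add: up_def down_def)
        also have "\<dots> = 1" by (simp add: powr_add[symmetric])
        finally show ?thesis by (simp add: mult.assoc[symmetric])
      qed
      ultimately show ?thesis using True by (simp add: pr distrib_left)
    next
      case False
      then have "k \<notin> F n" using disj[OF False] k by blast
      then show ?thesis using False by (simp add: pr)
    qed
    then have "level_mult (F m) (up m) (T (xh n)) t = (\<Sum>k\<in>F m. (if m = n then proj k (T (proj k (x n))) t else 0)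
        + up m k * (\<Sum>l\<in>F n - {k}. down n l * proj k (T (proj l (x n))) t))"
      unfolding level_mult_def by (intro sum.cong) auto
    then show ?case by (simp add: sum.distrib diag_def off_def)
  qed
  have xS: "xh n \<in> XS" by (rule XS_X[OF xh_X])
  have "V m T (xh n) = \<epsilon> m * nrm X (level_mult (F m) (up m) (T (xh n)))" by (rule V_eq[OF xS T])
  also have "nrm X (level_mult (F m) (up m) (T (xh n))) = nrm X (\<lambda>t. diag t + off t)"
    by (rule nrm_AE_cong[OF carr_add[OF diagX offX] carr_measurable[OF level_mult_X[OF op_XS[OF T xS]]] ae])
  also have "\<epsilon> m * nrm X (\<lambda>t. diag t + off t) \<le> \<epsilon> m * (1 + 2 * \<delta> m * \<Lambda> m)"
    using nrm_add[OF diagX offX] nd off_diagonal_bound[OF T, of m n] \<epsilon>_bounds(1)[of m]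
    by (intro mult_left_mono) (auto simp: off_def[abs_def])
  also have "\<dots> = 1" using \<epsilon>_bounds(1)[of m] by (simp add: \<epsilon>_def)
  finally show ?thesis .
qed

text \<open>A rescaled block has norm at most \<open>half_pow k\<close> in \<open>X\<close> and at
  most \<open>2 * root_pow k\<close> in \<open>X(w)\<close>. The former is used for nonnegative
  levels and the latter for negative ones, so the blocks are summable in both directions.\<close>

lemma snrm_xh_le: "snrm (xh n) \<le> 2 * geo_const"
proof -
  have "snrm (xh n) \<le> (\<Sum>k\<in>F n. nrm X (\<lambda>t. down n k * (min 1 (w t) * proj k (x n) t)))"
  proof -
    have c: "(\<lambda>t. min 1 (w t) * proj k (x n) t) \<in> carr X" for k
      using XS_X[OF carr_proj[OF xX]] by (simp add: XS_iff)
    have e: "(\<lambda>t. min 1 (w t) * xh n t) = (\<lambda>t. \<Sum>k\<in>F n. down n k * (min 1 (w t) * proj k (x n) t))"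
      unfolding xh_def level_mult_def by (auto simp: sum_distrib_left mult_ac)
    show ?thesis unfolding snrm_def e by (intro nrm_sum carr_scale c)
  qed
  also have "\<dots> \<le> (\<Sum>k\<in>F n. 2 * decay k)"
  proof (rule sum_mono)
    fix k assume "k \<in> F n"
    have pX: "proj k (x n) \<in> carr X" by (rule carr_proj[OF xX])
    have "(\<lambda>t. min 1 (w t) * proj k (x n) t) \<in> carr X" using XS_X[OF pX] by (simp add: XS_iff)
    then have "nrm X (\<lambda>t. down n k * (min 1 (w t) * proj k (x n) t)) = \<bar>down n k\<bar> * snrm (proj k (x n))"
      by (simp add: nrm_scale snrm_def)
    also have "\<dots> \<le> 2 * decay k"
    proof (cases "0 \<le> k")
      case True
      have "\<bar>down n k\<bar> * snrm (proj k (x n)) \<le> \<bar>down n k\<bar> * \<alpha> n k"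
        unfolding \<alpha>_def by (intro mult_left_mono snrm_le_X pX) auto
      also have "\<dots> \<le> half_pow k" by (rule down_\<alpha>)
      also have "\<dots> \<le> 2 * half_pow k" by simp
      finally show ?thesis using True by simp
    next
      case False
      have "\<bar>down n k\<bar> * snrm (proj k (x n)) \<le> \<bar>down n k\<bar> * (2 * pow2 k * \<alpha> n k)"
        using snrm_le_Xw[OF supported_single_Xw(1)[OF supported_single_proj[OF xX]], of k n]
          supported_single_Xw(2)[OF supported_single_proj[OF xX], of k n]
        unfolding \<alpha>_def by (intro mult_left_mono) auto
      also have "\<dots> = 2 * pow2 k * (\<bar>down n k\<bar> * \<alpha> n k)" by simp
      also have "\<dots> \<le> 2 * pow2 k * half_pow k"
        by (intro mult_left_mono down_\<alpha>) auto
      also have "\<dots> = 2 * root_pow k" by (simp add: mult.assoc powr_add[symmetric])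
      finally show ?thesis using False by simp
    qed
    finally show "nrm X (\<lambda>t. down n k * (min 1 (w t) * proj k (x n) t)) \<le> 2 * decay k" .
  qed
  also have "\<dots> = 2 * (\<Sum>k\<in>F n. decay k)" by (simp add: sum_distrib_left)
  also have "\<dots> \<le> 2 * (geo_const * 2 powr (- real 0 / 2))"
    by (intro mult_left_mono two_sided_tail_sum fin) auto
  finally show ?thesis by simp
qed

lemma xh_E: "xh n \<in> carr E" "nrm E (xh n) \<le> 2 * geo_const + 1"
proof -
  show "xh n \<in> carr E" by (rule E_I[OF XS_X[OF xh_X] V_xh_le])
  show "nrm E (xh n) \<le> 2 * geo_const + 1"
    unfolding nrm_E using snrm_xh_le G_least[OF V_xh_le] by (intro add_mono)
qed

abbreviation yh :: "nat \<Rightarrow> (real \<Rightarrow> real) \<Rightarrow> real \<Rightarrow> real" where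
  "yh n \<equiv> level_mult (F n) (down n)"

text \<open>Each occupied level of \<open>xh n\<close> bounds its K-functional from below, and
  \<open>level_sum_K_le\<close> bounds that of \<open>yh n y\<close> from above by a multiple of the
  same quantity. The constant sits inside the function because K-monotonicity compares K-functionals
  without a constant.\<close>

lemma K_yh_le:
  assumes y: "level_dominated (F n) (x n) y" and s: "0 < s"
  shows "K_functional s (yh n y) X Xw \<le> K_functional s (\<lambda>t. 3 * geo_const * xh n t) X Xw"
proof -
  have yX: "y \<in> carr X" using y by (auto simp: level_dominated_def intro: supported_carr)
  have xS: "xh n \<in> XS" by (rule XS_X[OF xh_X])
  have swm: "(\<lambda>t. min 1 (s * w t) * xh n t) \<in> carr X"
    using min_weight_mult(1)[of "xh n" "\<lambda>_. 0" "xh n" s] s xh_X carr_zero carr_measurable[OF xh_X]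
    by (simp add: Xw_iff)
  define \<mu> where "\<mu> = nrm X (\<lambda>t. min 1 (s * w t) * xh n t)"
  \<comment> \<open>If \<open>down n k \<noteq> 0\<close>, the block of \<open>xh n\<close> on level
    \<open>k\<close> has norm exactly \<open>half_pow k\<close>, and there
    \<open>min 1 (s * w t)\<close> is at least \<open>min 1 (s * pow2 k)\<close>.\<close>
  have low: "min 1 (s * pow2 k) * half_pow k \<le> \<mu>"
    if k: "k \<in> F n" "down n k \<noteq> 0" for k
  proof -
    have \<alpha>: "0 < \<alpha> n k" using k(2) \<alpha>_bounds(1)[of n k] by (cases "\<alpha> n k = 0") (auto simp: down_def)
    define r where "r = min 1 (s * pow2 k)"
    have r: "0 < r" using s by (simp add: r_def)
    have pX: "proj k (x n) \<in> carr X" by (rule carr_proj[OF xX])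
    have "r * half_pow k = (r * down n k) * nrm X (proj k (x n))"
      using \<alpha> by (simp add: down_def \<alpha>_def)
    also have "\<dots> = nrm X (\<lambda>t. (r * down n k) * proj k (x n) t)"
      using nrm_scale[OF pX, of "r * down n k"] r \<alpha> by (simp add: down_def)
    also have "\<dots> \<le> \<mu>"
      unfolding \<mu>_def
    proof (rule nrm_dominated[OF carr_measurable[OF carr_scale[OF pX]] swm], rule AE_I2)
      fix t
      show "\<bar>(r * down n k) * proj k (x n) t\<bar> \<le> \<bar>min 1 (s * w t) * xh n t\<bar>"
      proof (cases "t \<in> lev k")
        case True
        have "xh n t = down n k * x n t" unfolding xh_def by (rule level_mult_on_level[OF fin k(1) True])
        moreover have "r \<le> min 1 (s * w t)" using lev_bounds(1)[OF True] s by (auto simp: r_def min_le_iff_disj)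
        then have "r * \<bar>down n k * x n t\<bar> \<le> \<bar>min 1 (s * w t)\<bar> * \<bar>down n k * x n t\<bar>"
          using r by (intro mult_right_mono) auto
        ultimately show ?thesis using True r by (simp add: proj_apply abs_mult mult.assoc)
      qed (simp add: proj_apply)
    qed
    finally show ?thesis by (simp add: r_def)
  qed
  have b: "\<bar>down n k\<bar> * nrm X (proj k y) \<le> half_pow k" if "k \<in> F n" for k
  proof -
    have "\<bar>down n k\<bar> * nrm X (proj k y) \<le> \<bar>down n k\<bar> * \<alpha> n k"
      using y that by (intro mult_left_mono) (auto simp: level_dominated_def \<alpha>_def)
    also have "\<dots> \<le> half_pow k" by (rule down_\<alpha>)
    finally show ?thesis .
  qed
  have \<mu>0: "0 \<le> \<mu>" unfolding \<mu>_def by (rule nrm_nonneg[OF swm])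
  have "K_functional s (yh n y) X Xw \<le> 3 * geo_const * \<mu>"
    by (rule level_sum_K_le[OF fin yX s low b \<mu>0])
  also have "\<dots> = nrm X (\<lambda>t. (3 * geo_const) * (min 1 (s * w t) * xh n t))"
    unfolding \<mu>_def using nrm_scale[OF swm, of "3 * geo_const"] geo_const_pos by simp
  also have "\<dots> = nrm X (\<lambda>t. min 1 (s * w t) * (3 * geo_const * xh n t))"
    by (simp add: mult_ac)
  also have "\<dots> \<le> K_functional s (\<lambda>t. 3 * geo_const * xh n t) X Xw"
    by (rule K_ge[OF s XS_scale[OF xS]])
  finally show ?thesis .
qed

text \<open>The identity contraction already recovers \<open>y\<close>: \<open>up\<close> undoes
  \<open>down\<close> except on levels with \<alpha> n k = 0, where domination forces
  \<open>y\<close> to vanish almost everywhere.\<close>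

lemma V_yh_eq:
  assumes y: "level_dominated (F n) (x n) y"
  shows "\<epsilon> n * nrm X y = V n (\<lambda>z. z) (yh n y)"
proof -
  have yX: "y \<in> carr X" and yF: "y \<in> supported (F n)" using y by (auto simp: level_dominated_def intro: supported_carr)
  have yhS: "yh n y \<in> XS" by (intro XS_X level_mult_X yX)
  have "AE t in leb01. \<forall>k\<in>F n. \<alpha> n k = 0 \<longrightarrow> proj k y t = 0"
  proof (intro AE_finite_allI fin)
    fix k assume k: "k \<in> F n"
    show "AE t in leb01. \<alpha> n k = 0 \<longrightarrow> proj k y t = 0"
    proof (cases "\<alpha> n k = 0")
      case True
      then have "nrm X (proj k y) \<le> 0" using y k by (auto simp: level_dominated_def \<alpha>_def)
      then have "nrm X (proj k y) = 0" using nrm_nonneg[OF carr_proj[OF yX]] by (simp add: antisym)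
      then show ?thesis using nrm_eq_0_iff[OF carr_proj[OF yX]] by simp
    qed simp
  qed
  then have "AE t in leb01. level_mult (F n) (up n) (yh n y) t = y t"
  proof eventually_elim
    case (elim t)
    show ?case
    proof (cases "\<exists>k\<in>F n. t \<in> lev k")
      case True
      then obtain k where k: "k \<in> F n" "t \<in> lev k" by blast
      have e: "level_mult (F n) (up n) (yh n y) t = up n k * (down n k * y t)"
        by (simp add: level_mult_on_level[OF fin k])
      show ?thesis
      proof (cases "\<alpha> n k = 0")
        case True
        then have "y t = 0" using elim k by (auto simp: proj_apply)
        then show ?thesis by (simp add: e)
      next
        case False
        then have "up n k * down n k = root_pow k * half_pow k"
          by (simp add: up_def down_def)
        also have "\<dots> = 1" by (simp add: powr_add[symmetric])
        finally show ?thesis by (simp add: e mult.assoc[symmetric])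
      qed
    next
      case False
      then show ?thesis using yF level_mult_off_levels[of t "F n"] by (simp add: supported_def)
    qed
  qed
  then have "nrm X (level_mult (F n) (up n) (yh n y)) = nrm X y"
    by (rule nrm_AE_cong[OF yX carr_measurable[OF level_mult_X[OF yhS]]])
  then show ?thesis using V_eq[OF yhS op_id] by simp
qed

text \<open>K-monotonicity bounds \<open>\<epsilon> n * \<Lambda> n\<close>, that is,
  \<open>\<Lambda> n \<le> R * (1 + 2 * \<delta> n * \<Lambda> n)\<close>. As \<delta> n tends to 0,
  the term with \<Lambda> n on the right is eventually absorbed into the left side.\<close>

lemma \<Lambda>_bounded:
  assumes "K_monotone_couple X Xw"
  shows "\<exists>R>0. \<exists>N. \<forall>n\<ge>N. \<Lambda> n \<le> R"
proof -
  obtain C where C: "1 \<le> C" and Km: "\<And>x y. x \<in> carr E \<Longrightarrow> y \<in> XS \<Longrightarrow>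
      (\<And>s. 0 < s \<Longrightarrow> K_functional s y X Xw \<le> K_functional s x X Xw) \<Longrightarrow> y \<in> carr E \<and> nrm E y \<le> C * nrm E x"
    using assms E_interpolation unfolding K_monotone_couple_def K_monotone_space_def by blast
  \<comment> \<open>The K-monotonicity constant, the loss in comparing K-functionals, and the bound
    on the norm of \<open>xh n\<close> in \<open>E\<close>.\<close>
  define R where "R = C * (3 * geo_const * (2 * geo_const + 1))"
  have R: "0 < R" using C geo_const_pos by (simp add: R_def)
  have bnd: "\<epsilon> n * nrm X y \<le> R" if y: "level_dominated (F n) (x n) y" for n y
  proof -
    have yX: "y \<in> carr X" using y by (auto simp: level_dominated_def intro: supported_carr)
    have yhS: "yh n y \<in> XS" by (intro XS_X level_mult_X yX)
    have "yh n y \<in> carr E \<and>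
       nrm E (yh n y) \<le> C * nrm E (\<lambda>t. 3 * geo_const * xh n t)"
      by (rule Km[OF E_scale_le(1)[OF xh_E(1)] yhS K_yh_le[OF y]])
    then have yE: "yh n y \<in> carr E"
      and nE: "nrm E (yh n y) \<le> C * nrm E (\<lambda>t. 3 * geo_const * xh n t)" by auto
    have "\<epsilon> n * nrm X y \<le> G (yh n y)"
      unfolding V_yh_eq[OF y] by (rule G_upper[OF yE op_id])
    also have "\<dots> \<le> nrm E (yh n y)"
      unfolding nrm_E using snrm_nonneg[OF yhS] by simp
    also have "\<dots> \<le> C * nrm E (\<lambda>t. 3 * geo_const * xh n t)" by (rule nE)
    also have "\<dots> \<le> C * (3 * geo_const * nrm E (xh n))"
      using E_scale_le(2)[OF xh_E(1), of "3 * geo_const" n] C geo_const_pos by (intro mult_left_mono) auto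
    also have "\<dots> \<le> R"
      unfolding R_def using xh_E(2) C geo_const_pos by (intro mult_left_mono) auto
    finally show ?thesis .
  qed
  have \<Lambda>R: "\<epsilon> n * \<Lambda> n \<le> R" for n
  proof -
    have "\<Lambda> n \<le> R / \<epsilon> n" unfolding \<Lambda>_def
    proof (rule cSup_least)
      show "nrm X ` Collect (level_dominated (F n) (x n)) \<noteq> {}"
        using x_supp[of n] by (auto simp: level_dominated_def)
      show "r \<le> R / \<epsilon> n" if "r \<in> nrm X ` Collect (level_dominated (F n) (x n))" for r
        using that bnd[of n] \<epsilon>_bounds(1)[of n] by (auto simp: field_simps)
    qed
    then show ?thesis using \<epsilon>_bounds(1)[of n] by (simp add: field_simps)
  qed
  have "(\<lambda>n. geo_const * (2 powr (- (1/2))) ^ n) \<longlonglongrightarrow> geo_const * 0"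
    by (intro tendsto_intros LIMSEQ_realpow_zero) (auto simp: powr_minus field_simps)
  then have "(\<lambda>n. geo_const * 2 powr (- real n / 2)) \<longlonglongrightarrow> 0"
    by (simp add: powr_realpow[symmetric] powr_powr)
  \<comment> \<open>Below \<open>1 / (4 * R)\<close> the absorbed term is at most
    \<open>\<Lambda> n / 2\<close>, so that \<open>\<Lambda> n \<le> 2 * R\<close>.\<close>
  then obtain N where N: "\<And>n. n \<ge> N \<Longrightarrow> \<delta> n < 1 / (4 * R)"
    using order_tendstoD(2)[of _ 0 sequentially "1 / (4 * R)"] R unfolding \<delta>_def eventually_sequentially by auto
  have "\<Lambda> n \<le> 2 * R" if "n \<ge> N" for n
  proof -
    have L: "1 \<le> \<Lambda> n" by (rule \<Lambda>_ge_1)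
    have "0 < 1 + 2 * \<delta> n * \<Lambda> n" using \<delta>_pos[of n] L by (simp add: add_pos_pos)
    then have "\<Lambda> n \<le> R * (1 + 2 * \<delta> n * \<Lambda> n)" using \<Lambda>R[of n] by (simp add: \<epsilon>_def field_simps)
    also have "\<dots> = R + 2 * R * \<Lambda> n * \<delta> n" by (simp add: algebra_simps)
    also have "\<dots> \<le> R + 2 * R * \<Lambda> n * (1 / (4 * R))"
      using N[OF that] R L by (intro add_left_mono mult_left_mono) auto
    also have "\<dots> = R + \<Lambda> n / 2" using R by (simp add: field_simps)
    finally show ?thesis by simp
  qed
  then show ?thesis using R by (intro exI[of _ "2 * R"]) auto
qed

end

section \<open>K-monotone couples\<close>

context weighted_symmetric_space
begin

lemma proj_scale: "proj k (\<lambda>t. a * x t) = (\<lambda>t. a * proj k x t)"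
  by (auto simp: proj_def)

lemma supported_scale: "x \<in> supported F \<Longrightarrow> (\<lambda>t. a * x t) \<in> supported F"
  by (auto simp: supported_def carr_scale)

lemma level_dominated_scale:
  assumes "level_dominated F x y"
  shows "level_dominated F (\<lambda>t. a * x t) (\<lambda>t. a * y t)"
proof -
  have c: "x \<in> carr X" "y \<in> carr X" using assms by (auto simp: level_dominated_def intro: supported_carr)
  show ?thesis using assms unfolding level_dominated_def proj_scale
    by (auto simp: supported_scale nrm_scale[OF carr_proj[OF c(1)]] nrm_scale[OF carr_proj[OF c(2)]] intro: mult_left_mono)
qed

text \<open>Otherwise all sparse configurations far out obey one bound. Every finite set of levels
  splits into a fixed number of pieces that are either such configurations or single levels near 0,
  and adding up the pieces would give level decomposability.\<close>

lemma sparse_failure: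
  assumes nd: "\<not> level_decomposable"
  shows "\<exists>F x y. finite F \<and> (\<forall>k\<in>F. int L < \<bar>k\<bar>) \<and> (\<forall>k\<in>F. \<forall>l\<in>F. k \<noteq> l \<longrightarrow> int n \<le> \<bar>k - l\<bar>) \<and>
     level_dominated F x y \<and> nrm X x = 1 \<and> real n < nrm X y"
proof (rule ccontr)
  assume no: "\<not> ?thesis"
  \<comment> \<open>Removes the normalisation of \<open>x\<close>; if \<open>x\<close> has norm 0,
    so has every function dominated by it.\<close>
  have good: "nrm X y \<le> real n * nrm X x"
    if F: "finite F" "\<And>k. k \<in> F \<Longrightarrow> int L < \<bar>k\<bar>" "\<And>k l. k \<in> F \<Longrightarrow> l \<in> F \<Longrightarrow> k \<noteq> l \<Longrightarrow> int n \<le> \<bar>k - l\<bar>"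
      and xy: "level_dominated F x y" for F x y
  proof (rule ccontr)
    assume gt: "\<not> nrm X y \<le> real n * nrm X x"
    have xX: "x \<in> carr X" and yX: "y \<in> carr X" using xy by (auto simp: level_dominated_def intro: supported_carr)
    have "nrm X x \<noteq> 0"
    proof
      assume 0: "nrm X x = 0"
      have "nrm X y \<le> (\<Sum>k\<in>F. nrm X (proj k x))" by (rule level_dominated_bound[OF F(1) xy])
      also have "\<dots> \<le> (\<Sum>k\<in>F. nrm X x)" by (intro sum_mono nrm_proj xX)
      finally show False using gt 0 by simp
    qed
    then have pos: "0 < nrm X x" using nrm_nonneg[OF xX] by simp
    define a where "a = 1 / nrm X x"
    have a: "0 < a" using pos by (simp add: a_def)
    have "level_dominated F (\<lambda>t. a * x t) (\<lambda>t. a * y t)" by (rule level_dominated_scale[OF xy])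
    moreover have "nrm X (\<lambda>t. a * x t) = 1" unfolding nrm_scale[OF xX] using pos by (simp add: a_def)
    moreover have "real n < nrm X (\<lambda>t. a * y t)"
      unfolding nrm_scale[OF yX] using gt pos by (simp add: a_def field_simps)
    ultimately show False using no F by blast
  qed
  define d where "d = int n + 1"
  \<comment> \<open>Indices up to \<open>L\<close> in absolute value stand for single levels; the
    index \<open>L + 1 + r\<close> stands for the residue class \<open>r\<close> modulo
    \<open>d\<close> among the levels beyond \<open>L\<close>.\<close>
  define I where "I = {- int L..int L + d}"
  define G where "G F i = (if \<bar>i\<bar> \<le> int L then {i} \<inter> F else {k\<in>F. int L < \<bar>k\<bar> \<and> k mod d = i - int L - 1})"
    for F :: "int set" and i
  \<comment> \<open>A single level needs the constant 1 and a residue class the constant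
    \<open>n\<close>; \<open>n + 1\<close> covers both.\<close>
  define C where "C = (\<Sum>i\<in>I. real n + 1)"
  have level_decomposable
    unfolding level_decomposable_def
  proof (intro exI[of _ C] conjI allI impI)
    have "0 \<in> I" by (auto simp: I_def d_def)
    then show "0 < C" unfolding C_def by (intro sum_pos) (auto simp: I_def)
    fix F x y
    assume F: "finite F" and x: "x \<in> supported F" and y: "y \<in> supported F"
      and eq: "\<forall>k\<in>F. nrm X (proj k y) = nrm X (proj k x)"
    have xX: "x \<in> carr X" and yX: "y \<in> carr X" using x y by (auto intro: supported_carr)
    have GF: "G F i \<subseteq> F" for i by (auto simp: G_def)
    have finG: "finite (G F i)" for i using finite_subset[OF GF F] .
    have cover: "F \<subseteq> (\<Union>i\<in>I. G F i)"
    proof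
      fix k assume k: "k \<in> F"
      show "k \<in> (\<Union>i\<in>I. G F i)"
      proof (cases "\<bar>k\<bar> \<le> int L")
        case True
        then have "k \<in> I" "k \<in> G F k" using k by (auto simp: I_def d_def G_def)
        then show ?thesis by blast
      next
        case False
        have "0 < d" by (simp add: d_def)
        then have "0 \<le> k mod d" "k mod d < d" by simp_all
        then have "k mod d + int L + 1 \<in> I" "k \<in> G F (k mod d + int L + 1)" using k False by (auto simp: I_def G_def)
        then show ?thesis by blast
      qed
    qed
    have part: "nrm X (restr (G F i) y) \<le> (real n + 1) * nrm X x" for i
    proof -
      have dom: "level_dominated (G F i) (restr (G F i) x) (restr (G F i) y)"
        unfolding level_dominated_def using xX yX eq GF[of i]
        by (auto simp: restr_supported proj_restr)
      have rn: "nrm X (restr (G F i) x) \<le> nrm X x" by (rule nrm_restr[OF xX])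
      have "nrm X (restr (G F i) y) \<le> (real n + 1) * nrm X (restr (G F i) x)"
      proof (cases "\<bar>i\<bar> \<le> int L")
        case True
        have n0: "0 \<le> nrm X (restr (G F i) x)" by (rule nrm_nonneg[OF supported_carr[OF restr_supported[OF xX]]])
        have "nrm X (restr (G F i) y) \<le> (\<Sum>k\<in>G F i. nrm X (proj k (restr (G F i) x)))"
          by (rule level_dominated_bound[OF finG dom])
        also have "\<dots> \<le> (\<Sum>k\<in>G F i. nrm X (restr (G F i) x))"
          by (intro sum_mono nrm_proj supported_carr[OF restr_supported[OF xX]])
        also have "\<dots> = real (card (G F i)) * nrm X (restr (G F i) x)" by simp
        also have "\<dots> \<le> (real n + 1) * nrm X (restr (G F i) x)"
        proof (intro mult_right_mono n0)
          have "card (G F i) \<le> card {i}" using True by (intro card_mono) (auto simp: G_def)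
          then show "real (card (G F i)) \<le> real n + 1" by simp
        qed
        finally show ?thesis .
      next
        case False
        have "nrm X (restr (G F i) y) \<le> real n * nrm X (restr (G F i) x)"
        proof (rule good[OF finG _ _ dom])
          show "int L < \<bar>k\<bar>" if "k \<in> G F i" for k using that False by (simp add: G_def)
          show "int n \<le> \<bar>k - l\<bar>" if "k \<in> G F i" "l \<in> G F i" "k \<noteq> l" for k l
          proof -
            have "k mod d = l mod d" using that False by (simp add: G_def)
            then have "d dvd k - l" by (simp add: mod_eq_dvd_iff)
            then have "\<bar>d\<bar> \<le> \<bar>k - l\<bar>" using that(3) by (intro dvd_imp_le_int) auto
            then show ?thesis by (simp add: d_def)
          qed
        qed
        also have "\<dots> \<le> (real n + 1) * nrm X (restr (G F i) x)"
          using nrm_nonneg[OF supported_carr[OF restr_supported[OF xX]]] by (intro mult_right_mono) auto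
        finally show ?thesis .
      qed
      also have "\<dots> \<le> (real n + 1) * nrm X x" using rn by (intro mult_left_mono) auto
      finally show ?thesis .
    qed
    have "nrm X y \<le> (\<Sum>i\<in>I. nrm X (restr (G F i) y))"
      by (rule nrm_le_sum_cover[OF _ y cover]) (simp add: I_def)
    also have "\<dots> \<le> (\<Sum>i\<in>I. (real n + 1) * nrm X x)" by (intro sum_mono part)
    also have "\<dots> = C * nrm X x" by (simp add: C_def)
    finally show "nrm X y \<le> C * nrm X x" .
  qed
  then show False using nd by simp
qed

theorem K_monotone_imp_level_decomposable:
  assumes "K_monotone_couple X Xw"
  shows level_decomposable
proof (rule ccontr)
  assume nd: "\<not> level_decomposable"
  have "\<forall>n L. \<exists>F x y. finite F \<and> (\<forall>k\<in>F. int L < \<bar>k\<bar>) \<and> (\<forall>k\<in>F. \<forall>l\<in>F. k \<noteq> l \<longrightarrow> int n \<le> \<bar>k - l\<bar>) \<and>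
     level_dominated F x y \<and> nrm X x = 1 \<and> real n < nrm X y"
    using sparse_failure[OF nd] by blast
  then obtain F x y where bad: "\<And>n L. finite (F n L) \<and> (\<forall>k\<in>F n L. int L < \<bar>k\<bar>) \<and>
      (\<forall>k\<in>F n L. \<forall>l\<in>F n L. k \<noteq> l \<longrightarrow> int n \<le> \<bar>k - l\<bar>) \<and>
     level_dominated (F n L) (x n L) (y n L) \<and> nrm X (x n L) = 1 \<and> real n < nrm X (y n L)"
    by metis
  \<comment> \<open>The next set of levels has to start beyond all absolute values used so far, with
    a margin that grows with \<open>n\<close>; the sum of absolute values bounds the largest
    one.\<close>
  define L where "L = rec_nat 0 (\<lambda>n L. L + n + 2 + nat (\<Sum>k\<in>F n L. \<bar>k\<bar>))"
  have L_Suc: "L (Suc n) = L n + n + 2 + nat (\<Sum>k\<in>F n (L n). \<bar>k\<bar>)" for n by (simp add: L_def)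
  have L_bound: "\<bar>k\<bar> + int n + 2 \<le> int (L (Suc n))" if "k \<in> F n (L n)" for n k
  proof -
    have "\<bar>k\<bar> \<le> (\<Sum>k\<in>F n (L n). \<bar>k\<bar>)" by (rule member_le_sum[OF that]) (use bad in auto)
    then show ?thesis unfolding L_Suc by simp
  qed
  have L_mono: "L m \<le> L n" if "m \<le> n" for m n
    by (rule lift_Suc_mono_le[OF _ that]) (simp add: L_Suc)
  \<comment> \<open>The gap exceeds the larger index, so it serves \<open>sep\<close> in both orders
    and also gives disjointness.\<close>
  have apart: "int n < \<bar>k\<bar> - \<bar>l\<bar>" if mn: "m < n" and k: "k \<in> F n (L n)" and l: "l \<in> F m (L m)" for m n k l
  proof -
    obtain n' where n': "n = Suc n'" using mn by (cases n) auto
    have kL: "int (L n) < \<bar>k\<bar>" using bad k by blast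
    show ?thesis
    proof (cases "m = n'")
      case True
      then show ?thesis using L_bound[OF l] kL n' by simp
    next
      case False
      then have "L (Suc m) \<le> L n'" using mn n' by (intro L_mono) auto
      moreover have "L n' + n' + 2 \<le> L n" by (simp add: n' L_Suc)
      ultimately show ?thesis using L_bound[OF l] kL n' by simp
    qed
  qed
  interpret bad_sequence X w "\<lambda>n. F n (L n)" "\<lambda>n. x n (L n)"
  proof
    show "finite (F n (L n))" for n using bad by blast
    show "F m (L m) \<inter> F n (L n) = {}" if "m \<noteq> n" for m n
    proof (rule ccontr)
      assume "F m (L m) \<inter> F n (L n) \<noteq> {}"
      then obtain k where "k \<in> F m (L m)" "k \<in> F n (L n)" by blast
      then show False using apart[of m n k k] apart[of n m k k] that by linarith
    qed
    show "int m \<le> \<bar>k - l\<bar>" if k: "k \<in> F m (L m)" and l: "l \<in> F n (L n)" and "k \<noteq> l" for m n k l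
    proof -
      consider "m < n" | "n < m" | "m = n" by linarith
      then show ?thesis
      proof cases
        case 1
        then show ?thesis using apart[OF 1 l k] by linarith
      next
        case 2
        then show ?thesis using apart[OF 2 k l] by linarith
      next
        case 3
        then show ?thesis using bad k l \<open>k \<noteq> l\<close> by blast
      qed
    qed
    show "x n (L n) \<in> supported (F n (L n))" for n using bad by (simp add: level_dominated_def)
    show "nrm X (x n (L n)) = 1" for n using bad by blast
  qed
  obtain R N where "\<And>n. n \<ge> N \<Longrightarrow> \<Lambda> n \<le> R" using \<Lambda>_bounded[OF assms] by blast
  moreover have "real n < \<Lambda> n" for n
    using \<Lambda>_upper[of n "y n (L n)"] bad[of n "L n"] by (auto intro: less_le_trans)
  moreover obtain n :: nat where "R < real n" using reals_Archimedean2 by blast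
  ultimately have "real (max n N) < R" using less_le_trans by (metis max.cobounded2)
  then show False using \<open>R < real n\<close> by simp
qed

end

theorem corollary6p2:
  fixes X :: fun_space and w :: "real \<Rightarrow> real" and p :: real
  assumes "symmetric_space X"
    and "nontrivial_weight w"
    and "\<exists>k0\<ge>1. \<exists>c0>0. \<forall>k\<ge>k0. weight_seq w k * 2 ^ k \<ge> c0"
    and "decomposable w X \<or> (fatou_property X \<and> K_monotone_couple X (weighted_space X w))"
    and "1 < p"
    and "\<forall>t\<in>{0..1}. fundamental_function X t = t powr (1 / p)"
  shows "equal_up_to_equivalent_norms X (Lp_space p)"
proof -
  interpret weighted_symmetric_space X w
    using assms(1,2) by unfold_locales (auto simp: nontrivial_weight_def)
  have level_decomposable
    using assms(4) decomposable_imp_level_decomposable K_monotone_imp_level_decomposable by blast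
  then interpret power_fundamental X w p
    using assms(5,6) by unfold_locales auto
  obtain k0 c0 where "1 \<le> k0" "0 < c0" "\<And>k. k0 \<le> k \<Longrightarrow> weight_seq w k * 2 ^ k \<ge> c0"
    using assms(3) by blast
  then show ?thesis by (intro equal_Lp)
qed

end
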